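(* Let $G$ be a Lie group. (i) Let $(X,\omega,\Phi)$ be a Hamiltonian $G$-space, and suppose the $G$-action on $X$ is proper. Then $X/\!\!/G$ carries a reduced $2$-form. (ii) Let $(\tilde X,\varpi)$ be a prequantum $G$-space, and suppose the $G$-action on $\tilde X$ is proper. Then $\tilde X/\!\!/G$ carries a reduced $1$-form.
   Context: Diffeology: notions (plot, smooth map, subset and quotient diffeology) are those of Souriau and Iglesias-Zemmour. A differential form $\alpha$ on a diffeological space assigns to each plot $P:U\to X$ an ordinary form $P^*\alpha$ on $U$, with $(P\circ f)^*\alpha=f^*(P^*\alpha)$ for all smooth $f:V\to U$ between open subsets of Euclidean spaces; forms are pulled back by smooth maps in the obvious way. Proper: the action of $G$ on a manifold $X$ is proper if the map $G\times X\to X\times X$, $(g,x)\mapsto(x,g(x))$, is proper, i.e. compact subsets have compact preimages. Hamiltonian $G$-space: a triple $(X,\omega,\Phi)$ with $X$ a manifold on which $G$ acts smoothly, $\omega$ a $G$-invariant symplectic form, and $\Phi:X\to\mathfrak g^*$ an $\mathrm{Ad}^*$-equivariant moment map: $\mathrm i_{Z_X}\omega=-d\langle\Phi(\cdot),Z\rangle$, where $Z_X(x)=\frac{d}{dt}e^{tZ}(x)|_{t=0}$ for $Z\in\mathfrak g$. Prequantum $G$-space: a pair $(\tilde X,\varpi)$ of a manifold $\tilde X$ on which $G$ acts smoothly and a $G$-invariant contact $1$-form $\varpi$ whose Reeb vector field generates a free action of the circle group $\mathbf T=\mathrm U_1$. Its moment map $\Phi:\tilde X\to\mathfrak g^*$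 is $\langle\Phi(\tilde x),Z\rangle=\varpi(Z_{\tilde X}(\tilde x))$. Reduced space: $X/\!\!/G:=\Phi^{-1}(0)/G$ (resp. $\tilde X/\!\!/G:=\Phi^{-1}(0)/G$) with the subquotient diffeology (subset diffeology on $\Phi^{-1}(0)$, then quotient diffeology). Let $j$ be the inclusion of $\Phi^{-1}(0)$ and $\pi$ its projection onto the reduced space. $X/\!\!/G$ carries a reduced $2$-form if there is a diffeological $2$-form $\omega_{X/\!\!/G}$ on it with $j^*\omega=\pi^*\omega_{X/\!\!/G}$; $\tilde X/\!\!/G$ carries a reduced $1$-form if there is a diffeological $1$-form $\varpi_{\tilde X/\!\!/G}$ on it with $j^*\varpi=\pi^*\varpi_{\tilde X/\!\!/G}$. *)

theory Defs
  imports "HOL-Analysis.Analysis" "HOL-Algebra.Group_Action"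
begin

section \<open>Calculus on open subsets of Euclidean spaces\<close>

text \<open>
  Diffeological plots have domains in \<open>\<real>\<^sup>n\<close> for all \<open>n\<close> simultaneously, so \<open>n\<close> has to be a number.
  We use \<^const>\<open>Euclidean_space\<close>: vectors of \<open>\<real>\<^sup>n\<close> are functions on \<^typ>\<open>nat\<close> vanishing from
  index \<open>n\<close> on.
\<close>

type_synonym rvec = "nat \<Rightarrow> real"

abbreviation Rn :: "nat \<Rightarrow> rvec set" where
  "Rn n \<equiv> topspace (Euclidean_space n)"

definition pd :: "nat \<Rightarrow> (rvec \<Rightarrow> real) \<Rightarrow> rvec \<Rightarrow> real" where
  "pd i f x = deriv (\<lambda>t. f (x(i := t))) (x i)"

primrec Ck_on :: "nat \<Rightarrow> nat \<Rightarrow> rvec set \<Rightarrow> (rvec \<Rightarrow> real) \<Rightarrow> bool" where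
  "Ck_on 0 n U f \<longleftrightarrow> continuous_map (subtopology (Euclidean_space n) U) euclideanreal f"
| "Ck_on (Suc k) n U f \<longleftrightarrow>
     continuous_map (subtopology (Euclidean_space n) U) euclideanreal f \<and>
     (\<forall>i<n. (\<forall>x\<in>U. (\<lambda>t. f (x(i := t))) field_differentiable at (x i)) \<and> Ck_on k n U (pd i f))"

definition Cinf_on :: "nat \<Rightarrow> rvec set \<Rightarrow> (rvec \<Rightarrow> real) \<Rightarrow> bool" where
  "Cinf_on n U f \<longleftrightarrow> (\<forall>k. Ck_on k n U f)"

definition dir_deriv :: "nat \<Rightarrow> (rvec \<Rightarrow> real) \<Rightarrow> rvec \<Rightarrow> rvec \<Rightarrow> real" where
  "dir_deriv n f x v = (\<Sum>i<n. v i * pd i f x)"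

text \<open>The differential at \<open>x\<close> of a map from an open subset of \<open>\<real>\<^sup>m\<close> to \<open>\<real>\<^sup>n\<close>, applied to \<open>v\<close>.\<close>

definition jacobian :: "nat \<Rightarrow> nat \<Rightarrow> (rvec \<Rightarrow> rvec) \<Rightarrow> rvec \<Rightarrow> rvec \<Rightarrow> rvec" where
  "jacobian m n f x v = (\<lambda>i. if i < n then dir_deriv m (\<lambda>y. f y i) x v else 0)"

text \<open>
  Alternating \<open>k\<close>-linear forms, taking the list of their \<open>k\<close> arguments.  They are used both for
  \<open>V = \<real>\<^sup>n\<close> and for tangent spaces of manifolds (spaces of derivations); in both cases vectors are
  real-valued functions and the vector space operations are pointwise.
\<close>

definition alternating_form :: "nat \<Rightarrow> ('b \<Rightarrow> real) set \<Rightarrow> (('b \<Rightarrow> real) list \<Rightarrow> real) \<Rightarrow> bool" where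
  "alternating_form k V \<alpha> \<longleftrightarrow>
     (\<forall>vs i v w a b. length vs = k \<and> set vs \<subseteq> V \<and> i < k \<and> v \<in> V \<and> w \<in> V \<longrightarrow>
        \<alpha> (vs[i := (\<lambda>j. a * v j + b * w j)]) = a * \<alpha> (vs[i := v]) + b * \<alpha> (vs[i := w])) \<and>
     (\<forall>vs i j. length vs = k \<and> set vs \<subseteq> V \<and> i < j \<and> j < k \<and> vs ! i = vs ! j \<longrightarrow> \<alpha> vs = 0)"

type_synonym eform = "rvec \<Rightarrow> rvec list \<Rightarrow> real"

definition euclidean_form :: "nat \<Rightarrow> nat \<Rightarrow> rvec set \<Rightarrow> eform \<Rightarrow> bool" where
  "euclidean_form k n U \<alpha> \<longleftrightarrow>
     (\<forall>x\<in>U. alternating_form k (Rn n) (\<alpha> x)) \<and>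
     (\<forall>vs. length vs = k \<and> set vs \<subseteq> Rn n \<longrightarrow> Cinf_on n U (\<lambda>x. \<alpha> x vs))"

definition eform_eq :: "nat \<Rightarrow> nat \<Rightarrow> rvec set \<Rightarrow> eform \<Rightarrow> eform \<Rightarrow> bool" where
  "eform_eq k n U \<alpha> \<beta> \<longleftrightarrow> (\<forall>x\<in>U. \<forall>vs. length vs = k \<and> set vs \<subseteq> Rn n \<longrightarrow> \<alpha> x vs = \<beta> x vs)"

definition eform_pullback :: "nat \<Rightarrow> nat \<Rightarrow> (rvec \<Rightarrow> rvec) \<Rightarrow> eform \<Rightarrow> eform" where
  "eform_pullback m n f \<alpha> = (\<lambda>x vs. \<alpha> (f x) (map (jacobian m n f x) vs))"

text \<open>Exterior derivative on \<open>\<real>\<^sup>n\<close>; the bracket terms are absent since the \<open>vs\<close> are constant fields.\<close>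

definition eform_d :: "nat \<Rightarrow> eform \<Rightarrow> eform" where
  "eform_d n \<alpha> = (\<lambda>x vs.
     \<Sum>i<length vs. (-1) ^ i * dir_deriv n (\<lambda>y. \<alpha> y (take i vs @ drop (Suc i) vs)) x (vs ! i))"

definition wedge :: "nat \<Rightarrow> nat \<Rightarrow> ('v list \<Rightarrow> real) \<Rightarrow> ('v list \<Rightarrow> real) \<Rightarrow> 'v list \<Rightarrow> real" where
  "wedge p q \<alpha> \<beta> vs =
     (\<Sum>\<sigma> | \<sigma> permutes {..<p + q}. of_int (sign \<sigma>) *
        \<alpha> (map (\<lambda>i. vs ! \<sigma> i) [0..<p]) * \<beta> (map (\<lambda>i. vs ! \<sigma> i) [p..<p + q])) / (fact p * fact q)"

primrec wedge_power2 :: "nat \<Rightarrow> ('v list \<Rightarrow> real) \<Rightarrow> 'v list \<Rightarrow> real" where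
  "wedge_power2 0 \<beta> = (\<lambda>_. 1)"
| "wedge_power2 (Suc k) \<beta> = wedge 2 (2 * k) \<beta> (wedge_power2 k \<beta>)"


section \<open>Manifolds\<close>

text \<open>
  Manifolds are finite-dimensional, smooth, Hausdorff and second countable.  A chart is a pair of
  its domain and its coordinate map; the atlas need not be maximal.
\<close>

record 'a manifold =
  mtop :: "'a topology"
  mdim :: nat
  charts :: "('a set \<times> ('a \<Rightarrow> rvec)) set"

abbreviation mspace :: "'a manifold \<Rightarrow> 'a set" where
  "mspace M \<equiv> topspace (mtop M)"

definition smooth_map :: "'a manifold \<Rightarrow> 'b manifold \<Rightarrow> ('a \<Rightarrow> 'b) \<Rightarrow> bool" where
  "smooth_map M N f \<longleftrightarrow>
     continuous_map (mtop M) (mtop N) f \<and>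
     (\<forall>(U, \<phi>)\<in>charts M. \<forall>(V, \<psi>)\<in>charts N. \<forall>i<mdim N.
        Cinf_on (mdim M) (\<phi> ` (U \<inter> f -` V)) (\<lambda>x. \<psi> (f (inv_into U \<phi> x)) i))"

definition smooth_manifold :: "'a manifold \<Rightarrow> bool" where
  "smooth_manifold M \<longleftrightarrow>
     Hausdorff_space (mtop M) \<and> second_countable (mtop M) \<and>
     (\<Union>(U, \<phi>)\<in>charts M. U) = mspace M \<and>
     (\<forall>(U, \<phi>)\<in>charts M.
        openin (mtop M) U \<and> openin (Euclidean_space (mdim M)) (\<phi> ` U) \<and>
        homeomorphic_map (subtopology (mtop M) U)
          (subtopology (Euclidean_space (mdim M)) (\<phi> ` U)) \<phi>) \<and>
     (\<forall>(U, \<phi>)\<in>charts M. \<forall>(V, \<psi>)\<in>charts M. \<forall>i<mdim M.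
        Cinf_on (mdim M) (\<phi> ` (U \<inter> V)) (\<lambda>x. \<psi> (inv_into U \<phi> x) i))"

definition euclidean_open :: "nat \<Rightarrow> rvec set \<Rightarrow> rvec manifold" where
  "euclidean_open n U =
     \<lparr>mtop = subtopology (Euclidean_space n) U, mdim = n, charts = {(U, \<lambda>x. x)}\<rparr>"

definition real_line :: "real manifold" where
  "real_line =
     \<lparr>mtop = euclideanreal, mdim = 1, charts = {(UNIV, \<lambda>t i. if i = 0 then t else 0)}\<rparr>"

definition prod_manifold :: "'a manifold \<Rightarrow> 'b manifold \<Rightarrow> ('a \<times> 'b) manifold" where
  "prod_manifold M N =
     \<lparr>mtop = prod_topology (mtop M) (mtop N),
      mdim = mdim M + mdim N,
      charts = {(U \<times> V, \<lambda>(x, y) i. if i < mdim M then \<phi> x i else \<psi> y (i - mdim M)) | U \<phi> V \<psi>.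
                  (U, \<phi>) \<in> charts M \<and> (V, \<psi>) \<in> charts N}\<rparr>"


section \<open>Tangent vectors\<close>

text \<open>
  Tangent vectors at \<open>p\<close> are the point derivations at \<open>p\<close> of the algebra of smooth functions.
  So that they form a vector space of functions under the pointwise operations, they
  are required to be \<open>0\<close> on arguments that are not smooth.  (The Leibniz rule forces them not to depend
  on the values of a function outside the carrier.)
\<close>

type_synonym 'a tvec = "('a \<Rightarrow> real) \<Rightarrow> real"

definition smooth_fun :: "'a manifold \<Rightarrow> ('a \<Rightarrow> real) set" where
  "smooth_fun M = {f. smooth_map M real_line f}"

definition tangent_space :: "'a manifold \<Rightarrow> 'a \<Rightarrow> 'a tvec set" where
  "tangent_space M p = {D.
     (\<forall>f\<in>smooth_fun M. \<forall>g\<in>smooth_fun M. \<forall>a b. D (\<lambda>x. a * f x + b * g x) = a * D f + b * D g) \<and>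
     (\<forall>f\<in>smooth_fun M. \<forall>g\<in>smooth_fun M. D (\<lambda>x. f x * g x) = f p * D g + g p * D f) \<and>
     (\<forall>f. f \<notin> smooth_fun M \<longrightarrow> D f = 0)}"

definition velocity :: "'a manifold \<Rightarrow> (real \<Rightarrow> 'a) \<Rightarrow> real \<Rightarrow> 'a tvec" where
  "velocity M \<gamma> t = (\<lambda>f. if f \<in> smooth_fun M then deriv (\<lambda>s. f (\<gamma> s)) t else 0)"

text \<open>Differential of a smooth map into \<open>N\<close>: between manifolds, and from an open subset of \<open>\<real>\<^sup>n\<close>.\<close>

definition tangent_map :: "'b manifold \<Rightarrow> ('a \<Rightarrow> 'b) \<Rightarrow> 'a tvec \<Rightarrow> 'b tvec" where
  "tangent_map N h D = (\<lambda>f. if f \<in> smooth_fun N then D (\<lambda>x. f (h x)) else 0)"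

definition plot_tangent :: "nat \<Rightarrow> 'a manifold \<Rightarrow> (rvec \<Rightarrow> 'a) \<Rightarrow> rvec \<Rightarrow> rvec \<Rightarrow> 'a tvec" where
  "plot_tangent n M P u v = (\<lambda>f. if f \<in> smooth_fun M then dir_deriv n (\<lambda>y. f (P y)) u v else 0)"


section \<open>Differential forms on manifolds\<close>

type_synonym 'a mform = "'a \<Rightarrow> 'a tvec list \<Rightarrow> real"

definition mform_pullback :: "nat \<Rightarrow> 'a manifold \<Rightarrow> (rvec \<Rightarrow> 'a) \<Rightarrow> 'a mform \<Rightarrow> eform" where
  "mform_pullback n M P \<omega> = (\<lambda>u vs. \<omega> (P u) (map (plot_tangent n M P u) vs))"

definition local_rep :: "'a manifold \<Rightarrow> 'a set \<times> ('a \<Rightarrow> rvec) \<Rightarrow> 'a mform \<Rightarrow> eform" where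
  "local_rep M c \<omega> = mform_pullback (mdim M) M (inv_into (fst c) (snd c)) \<omega>"

definition differential_form :: "nat \<Rightarrow> 'a manifold \<Rightarrow> 'a mform \<Rightarrow> bool" where
  "differential_form k M \<omega> \<longleftrightarrow>
     (\<forall>p\<in>mspace M. alternating_form k (tangent_space M p) (\<omega> p)) \<and>
     (\<forall>(U, \<phi>)\<in>charts M. euclidean_form k (mdim M) (\<phi> ` U) (local_rep M (U, \<phi>) \<omega>))"

text \<open>
  The exterior derivative at \<open>p\<close> is computed in any chart around \<open>p\<close>, from the coordinate
  expressions of the form and of the tangent vectors.
\<close>

definition chart_at :: "'a manifold \<Rightarrow> 'a \<Rightarrow> 'a set \<times> ('a \<Rightarrow> rvec)" where
  "chart_at M p = (SOME c. c \<in> charts M \<and> p \<in> fst c)"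

definition coords :: "'a manifold \<Rightarrow> 'a set \<times> ('a \<Rightarrow> rvec) \<Rightarrow> 'a \<Rightarrow> 'a tvec \<Rightarrow> rvec" where
  "coords M c p v =
     (THE r. r \<in> Rn (mdim M) \<and> plot_tangent (mdim M) M (inv_into (fst c) (snd c)) (snd c p) r = v)"

definition mform_d :: "'a manifold \<Rightarrow> 'a mform \<Rightarrow> 'a mform" where
  "mform_d M \<omega> = (\<lambda>p vs. let c = chart_at M p in
     eform_d (mdim M) (local_rep M c \<omega>) (snd c p) (map (coords M c p) vs))"

definition symplectic_form :: "'a manifold \<Rightarrow> 'a mform \<Rightarrow> bool" where
  "symplectic_form M \<omega> \<longleftrightarrow>
     differential_form 2 M \<omega> \<and>
     (\<forall>p\<in>mspace M. \<forall>vs. length vs = 3 \<and> set vs \<subseteq> tangent_space M p \<longrightarrow> mform_d M \<omega> p vs = 0) \<and>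
     (\<forall>p\<in>mspace M. \<forall>v\<in>tangent_space M p.
        (\<forall>w\<in>tangent_space M p. \<omega> p [v, w] = 0) \<longrightarrow> v = (\<lambda>_. 0))"

text \<open>\<open>\<eta> \<and> (d\<eta>)\<^sup>k\<close> is a volume form, where \<open>2k + 1\<close> is the dimension.\<close>

definition contact_form :: "'a manifold \<Rightarrow> 'a mform \<Rightarrow> bool" where
  "contact_form M \<eta> \<longleftrightarrow>
     differential_form 1 M \<eta> \<and>
     (\<exists>k. mdim M = 2 * k + 1 \<and>
       (\<forall>p\<in>mspace M. \<exists>vs. length vs = 2 * k + 1 \<and> set vs \<subseteq> tangent_space M p \<and>
          wedge 1 (2 * k) (\<eta> p) (wedge_power2 k (mform_d M \<eta> p)) vs \<noteq> 0))"

definition reeb :: "'a manifold \<Rightarrow> 'a mform \<Rightarrow> 'a \<Rightarrow> 'a tvec" where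
  "reeb M \<eta> p = (THE r. r \<in> tangent_space M p \<and> \<eta> p [r] = 1 \<and>
     (\<forall>w\<in>tangent_space M p. mform_d M \<eta> p [r, w] = 0))"


section \<open>Lie groups and their actions\<close>

record 'g lie_struct = "'g monoid" +
  mfd :: "'g manifold"

definition lie_group :: "'g lie_struct \<Rightarrow> bool" where
  "lie_group G \<longleftrightarrow>
     group G \<and> smooth_manifold (mfd G) \<and> mspace (mfd G) = carrier G \<and>
     smooth_map (prod_manifold (mfd G) (mfd G)) (mfd G) (\<lambda>(g, h). g \<otimes>\<^bsub>G\<^esub> h) \<and>
     smooth_map (mfd G) (mfd G) (\<lambda>g. inv\<^bsub>G\<^esub> g)"

definition lie_algebra :: "'g lie_struct \<Rightarrow> 'g tvec set" where
  "lie_algebra G = tangent_space (mfd G) \<one>\<^bsub>G\<^esub>"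

definition one_param_subgroup :: "'g lie_struct \<Rightarrow> (real \<Rightarrow> 'g) \<Rightarrow> bool" where
  "one_param_subgroup G \<gamma> \<longleftrightarrow>
     smooth_map real_line (mfd G) \<gamma> \<and> (\<forall>s t. \<gamma> (s + t) = \<gamma> s \<otimes>\<^bsub>G\<^esub> \<gamma> t)"

definition lie_exp :: "'g lie_struct \<Rightarrow> 'g tvec \<Rightarrow> 'g" where
  "lie_exp G Z = (THE \<gamma>. one_param_subgroup G \<gamma> \<and> velocity (mfd G) \<gamma> 0 = Z) 1"

definition Ad :: "'g lie_struct \<Rightarrow> 'g \<Rightarrow> 'g tvec \<Rightarrow> 'g tvec" where
  "Ad G g = tangent_map (mfd G) (\<lambda>h. g \<otimes>\<^bsub>G\<^esub> h \<otimes>\<^bsub>G\<^esub> inv\<^bsub>G\<^esub> g)"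

definition coAd :: "'g lie_struct \<Rightarrow> 'g \<Rightarrow> ('g tvec \<Rightarrow> real) \<Rightarrow> 'g tvec \<Rightarrow> real" where
  "coAd G g \<mu> = (\<lambda>Z. \<mu> (Ad G (inv\<^bsub>G\<^esub> g) Z))"

definition dual_lie_algebra :: "'g lie_struct \<Rightarrow> ('g tvec \<Rightarrow> real) set" where
  "dual_lie_algebra G = {\<mu>. \<forall>Z\<in>lie_algebra G. \<forall>W\<in>lie_algebra G. \<forall>a b.
     \<mu> (\<lambda>f. a * Z f + b * W f) = a * \<mu> Z + b * \<mu> W}"

definition smooth_action :: "'g lie_struct \<Rightarrow> 'a manifold \<Rightarrow> ('g \<Rightarrow> 'a \<Rightarrow> 'a) \<Rightarrow> bool" where
  "smooth_action G M act \<longleftrightarrow>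
     group_action G (mspace M) act \<and>
     smooth_map (prod_manifold (mfd G) M) M (\<lambda>(g, x). act g x)"

definition proper_action :: "'g lie_struct \<Rightarrow> 'a manifold \<Rightarrow> ('g \<Rightarrow> 'a \<Rightarrow> 'a) \<Rightarrow> bool" where
  "proper_action G M act \<longleftrightarrow>
     (\<forall>K. compactin (prod_topology (mtop M) (mtop M)) K \<longrightarrow>
        compactin (prod_topology (mtop (mfd G)) (mtop M))
          {(g, x). g \<in> carrier G \<and> x \<in> mspace M \<and> (x, act g x) \<in> K})"

definition inf_action :: "'g lie_struct \<Rightarrow> 'a manifold \<Rightarrow> ('g \<Rightarrow> 'a \<Rightarrow> 'a) \<Rightarrow> 'g tvec \<Rightarrow> 'a \<Rightarrow> 'a tvec" where
  "inf_action G M act Z x = velocity M (\<lambda>t. act (lie_exp G (\<lambda>f. t * Z f)) x) 0"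

definition invariant_form ::
    "nat \<Rightarrow> 'g lie_struct \<Rightarrow> 'a manifold \<Rightarrow> ('g \<Rightarrow> 'a \<Rightarrow> 'a) \<Rightarrow> 'a mform \<Rightarrow> bool" where
  "invariant_form k G M act \<omega> \<longleftrightarrow>
     (\<forall>g\<in>carrier G. \<forall>x\<in>mspace M. \<forall>vs. length vs = k \<and> set vs \<subseteq> tangent_space M x \<longrightarrow>
        \<omega> (act g x) (map (tangent_map M (act g)) vs) = \<omega> x vs)"

text \<open>The circle group \<open>U\<^sub>1\<close>, with the angle charts centred at all its points.\<close>

definition circle_group :: "complex lie_struct" where
  "circle_group =
     \<lparr>carrier = sphere 0 1, mult = (*), one = 1,
      mfd = \<lparr>mtop = top_of_set (sphere 0 1), mdim = 1,
             charts = {(sphere 0 1 - {- a}, \<lambda>z i. if i = 0 then Arg (z / a) else 0) | a.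
                         a \<in> sphere 0 1}\<rparr>\<rparr>"


section \<open>Hamiltonian and prequantum spaces\<close>

text \<open>
  The moment map takes values in functionals on the Lie algebra.  As the Lie algebra is
  finite-dimensional, smoothness of \<open>\<Phi>\<close> amounts to that of its components
  \<open>\<langle>\<Phi>(\<cdot>), Z\<rangle>\<close>.  Recall that \<open>w f\<close> is \<open>df(w)\<close> for a tangent vector \<open>w\<close>.
\<close>

definition hamiltonian_space ::
    "'g lie_struct \<Rightarrow> 'a manifold \<Rightarrow> ('g \<Rightarrow> 'a \<Rightarrow> 'a) \<Rightarrow> 'a mform \<Rightarrow> ('a \<Rightarrow> 'g tvec \<Rightarrow> real) \<Rightarrow> bool" where
  "hamiltonian_space G X act \<omega> \<Phi> \<longleftrightarrow>
     smooth_manifold X \<and> smooth_action G X act \<and>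
     symplectic_form X \<omega> \<and> invariant_form 2 G X act \<omega> \<and>
     (\<forall>x\<in>mspace X. \<Phi> x \<in> dual_lie_algebra G) \<and>
     (\<forall>Z\<in>lie_algebra G. (\<lambda>x. \<Phi> x Z) \<in> smooth_fun X) \<and>
     (\<forall>g\<in>carrier G. \<forall>x\<in>mspace X. \<forall>Z\<in>lie_algebra G. \<Phi> (act g x) Z = coAd G g (\<Phi> x) Z) \<and>
     (\<forall>Z\<in>lie_algebra G. \<forall>x\<in>mspace X. \<forall>w\<in>tangent_space X x.
        \<omega> x [inf_action G X act Z x, w] = - w (\<lambda>y. \<Phi> y Z))"

text \<open>
  The Reeb field is the infinitesimal generator \<open>d/d\<theta> e\<^sup>i\<^sup>\<theta>(x)\<close> at \<open>\<theta> = 0\<close> of a free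
  circle action.
\<close>

definition prequantum_space ::
    "'g lie_struct \<Rightarrow> 'a manifold \<Rightarrow> ('g \<Rightarrow> 'a \<Rightarrow> 'a) \<Rightarrow> 'a mform \<Rightarrow> bool" where
  "prequantum_space G X act \<eta> \<longleftrightarrow>
     smooth_manifold X \<and> smooth_action G X act \<and>
     contact_form X \<eta> \<and> invariant_form 1 G X act \<eta> \<and>
     (\<exists>\<tau>. smooth_action circle_group X \<tau> \<and>
        (\<forall>z\<in>carrier circle_group. \<forall>x\<in>mspace X. \<tau> z x = x \<longrightarrow> z = \<one>\<^bsub>circle_group\<^esub>) \<and>
        (\<forall>x\<in>mspace X. velocity X (\<lambda>\<theta>. \<tau> (cis \<theta>) x) 0 = reeb X \<eta> x))"

definition prequantum_moment ::
    "'g lie_struct \<Rightarrow> 'a manifold \<Rightarrow> ('g \<Rightarrow> 'a \<Rightarrow> 'a) \<Rightarrow> 'a mform \<Rightarrow> 'a \<Rightarrow> 'g tvec \<Rightarrow> real" where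
  "prequantum_moment G X act \<eta> x Z = \<eta> x [inf_action G X act Z x]"


section \<open>Diffeologies\<close>

text \<open>
  A diffeology is given by its plots: \<open>D n U P\<close> says that \<open>P\<close>, restricted to the open subset \<open>U\<close> of
  \<open>\<real>\<^sup>n\<close>, is a plot.  The values of \<open>P\<close> outside \<open>U\<close> are irrelevant.
\<close>

type_synonym 'a diffeology = "nat \<Rightarrow> rvec set \<Rightarrow> (rvec \<Rightarrow> 'a) \<Rightarrow> bool"

definition manifold_diffeology :: "'a manifold \<Rightarrow> 'a diffeology" where
  "manifold_diffeology M n U P \<longleftrightarrow>
     openin (Euclidean_space n) U \<and> smooth_map (euclidean_open n U) M P"

definition subset_diffeology :: "'a diffeology \<Rightarrow> 'a set \<Rightarrow> 'a diffeology" where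
  "subset_diffeology D Y n U P \<longleftrightarrow> D n U P \<and> P ` U \<subseteq> Y"

definition quotient_diffeology :: "'a diffeology \<Rightarrow> ('a \<Rightarrow> 'b) \<Rightarrow> 'b diffeology" where
  "quotient_diffeology D \<pi> n U P \<longleftrightarrow>
     openin (Euclidean_space n) U \<and>
     (\<forall>u\<in>U. \<exists>V Q. openin (Euclidean_space n) V \<and> u \<in> V \<and> V \<subseteq> U \<and> D n V Q \<and>
        (\<forall>v\<in>V. P v = \<pi> (Q v)))"

text \<open>
  A diffeological form assigns to each plot an ordinary form.  In the compatibility condition, the
  plot \<open>P \<circ> f\<close> is represented by any \<open>Q\<close> that agrees with it on the domain \<open>V\<close>; in particular the
  form assigned to a plot depends only on the values of the plot on its domain.
\<close>

type_synonym 'a dform = "nat \<Rightarrow> rvec set \<Rightarrow> (rvec \<Rightarrow> 'a) \<Rightarrow> eform"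

definition diffeological_form :: "nat \<Rightarrow> 'a diffeology \<Rightarrow> 'a dform \<Rightarrow> bool" where
  "diffeological_form k D \<alpha> \<longleftrightarrow>
     (\<forall>n U P. D n U P \<longrightarrow> euclidean_form k n U (\<alpha> n U P)) \<and>
     (\<forall>n U P m V f Q.
        D n U P \<and> openin (Euclidean_space m) V \<and>
        smooth_map (euclidean_open m V) (euclidean_open n U) f \<and>
        D m V Q \<and> (\<forall>v\<in>V. Q v = P (f v)) \<longrightarrow>
        eform_eq k m V (\<alpha> m V Q) (eform_pullback m n f (\<alpha> n U P)))"

definition dform_pullback :: "('a \<Rightarrow> 'b) \<Rightarrow> 'b dform \<Rightarrow> 'a dform" where
  "dform_pullback h \<alpha> n U P = \<alpha> n U (h \<circ> P)"

definition dform_eq :: "nat \<Rightarrow> 'a diffeology \<Rightarrow> 'a dform \<Rightarrow> 'a dform \<Rightarrow> bool" where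
  "dform_eq k D \<alpha> \<beta> \<longleftrightarrow> (\<forall>n U P. D n U P \<longrightarrow> eform_eq k n U (\<alpha> n U P) (\<beta> n U P))"

text \<open>An ordinary form on a manifold, regarded as a diffeological form.\<close>

definition dform_of :: "'a manifold \<Rightarrow> 'a mform \<Rightarrow> 'a dform" where
  "dform_of M \<omega> n U P = mform_pullback n M P \<omega>"


section \<open>Reduction\<close>

definition zero_level :: "'g lie_struct \<Rightarrow> 'a manifold \<Rightarrow> ('a \<Rightarrow> 'g tvec \<Rightarrow> real) \<Rightarrow> 'a set" where
  "zero_level G X \<Phi> = {x \<in> mspace X. \<forall>Z\<in>lie_algebra G. \<Phi> x Z = 0}"

definition zero_level_diffeology ::
    "'g lie_struct \<Rightarrow> 'a manifold \<Rightarrow> ('a \<Rightarrow> 'g tvec \<Rightarrow> real) \<Rightarrow> 'a diffeology" where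
  "zero_level_diffeology G X \<Phi> = subset_diffeology (manifold_diffeology X) (zero_level G X \<Phi>)"

text \<open>
  The underlying set of the reduced space is \<^term>\<open>orbits G (zero_level G X \<Phi>) act\<close>; it is the image of
  the zero level under the projection \<open>x \<mapsto> orbit G act x\<close>.
\<close>

definition reduced_diffeology ::
    "'g lie_struct \<Rightarrow> 'a manifold \<Rightarrow> ('g \<Rightarrow> 'a \<Rightarrow> 'a) \<Rightarrow> ('a \<Rightarrow> 'g tvec \<Rightarrow> real) \<Rightarrow> 'a set diffeology" where
  "reduced_diffeology G X act \<Phi> =
     quotient_diffeology (zero_level_diffeology G X \<Phi>) (orbit G act)"

definition carries_reduced_form ::
    "nat \<Rightarrow> 'g lie_struct \<Rightarrow> 'a manifold \<Rightarrow> ('g \<Rightarrow> 'a \<Rightarrow> 'a) \<Rightarrow> ('a \<Rightarrow> 'g tvec \<Rightarrow> real) \<Rightarrow>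
      'a mform \<Rightarrow> bool" where
  "carries_reduced_form k G X act \<Phi> \<omega> \<longleftrightarrow>
     (\<exists>\<beta>. diffeological_form k (reduced_diffeology G X act \<Phi>) \<beta> \<and>
        dform_eq k (zero_level_diffeology G X \<Phi>)
          (dform_pullback (\<lambda>x. x) (dform_of X \<omega>))
          (dform_pullback (orbit G act) \<beta>))"

end

theory Submission
  imports Defs "HOL-Probability.Discrete_Topology" "HOL-Library.Function_Algebras"
begin

text \<open>
  Two plots \<open>P\<close>, \<open>Q\<close> of the zero level with the same projection satisfy \<open>P u = g(u) Q u\<close>, where \<open>g\<close> need not
  be continuous.  The form descends if \<open>P\<close> and \<open>Q\<close> always pull it back to the same form, and by continuity it
  suffices to check this at a dense set of points \<open>u\<close>.  As the Lie group is second countable, Baire's theorem provides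
  a dense set of points \<open>u\<close> at which every \<open>g\<close> with \<open>P u = g Q u\<close> is a limit of elements relating \<open>P\<close> and
  \<open>Q\<close> at the points near \<open>u\<close>.  Replacing \<open>Q\<close> by \<open>g Q\<close>, let \<open>g = 1\<close> and \<open>x = P u = Q u\<close>.  Elements of \<open>G\<close> near \<open>1\<close> are
  products \<open>b h\<close> where \<open>h\<close> is close to \<open>1\<close> and fixes \<open>x\<close>, and \<open>b\<close> runs through a submanifold
  transversal to the stabilizer.  To first order \<open>h\<close> does not move the points near \<open>x\<close>, and
  \<open>b\<close> moves them along the orbit, so \<open>P\<^sub>* v - Q\<^sub>* v\<close> is tangent to the orbit of \<open>x\<close> for every \<open>v\<close>.  The moment map
  condition on the zero level says that such vectors do not contribute to the pullback.
\<close>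

section \<open>Calculus in coordinates\<close>

text \<open>The obstacle is the group element \<open>g\<close> relating \<open>P\<close> and
  \<open>Q\<close> near \<open>u\<close>: it is close to 1, but need be neither continuous in the
  point nor of size O(t) on the ray \<open>u + t v\<close>, so one cannot expand to first order in
  \<open>g\<close>. Two devices replace this. Strict differentiability compares the action of one
  and the same \<open>g\<close> at two points, with an error proportional to their distance and
  uniform in \<open>g\<close>. And if \<open>a\<close> is the coordinate of \<open>g\<close> adapted
  to the stabilizer, the effect of \<open>g\<close> on \<open>x\<close> depends on
  \<open>L a\<close> only, where \<open>L\<close> is the derivative of the orbit map:
  \<open>g x = b x\<close>, where \<open>b\<close> has coordinates \<open>e + s L a\<close> for a
  generalized inverse \<open>s\<close> of \<open>L\<close>. Hence the error in the motion of
  \<open>x\<close> is a small multiple of \<open>\<bar>L a\<bar>\<close> and can be absorbed into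
  \<open>L a\<close>, however large \<open>a\<close> is compared with \<open>t\<close>. What remains
  in the limit lies in the image of \<open>L\<close>, as the fixed space of \<open>L s\<close>. The
  stabilizer enters only through one-parameter subgroups with generators in the kernel of
  \<open>L\<close>. They are constructed from an ODE in a chart of the group; their uniqueness is
  needed too, because \<open>lie_exp\<close> is a definite description.\<close>

lemma Rn_iff: "x \<in> Rn n \<longleftrightarrow> (\<forall>i\<ge>n. x i = 0)"
  by (simp add: topspace_Euclidean_space)

lemma Rn_eqI: "x \<in> Rn n \<Longrightarrow> y \<in> Rn n \<Longrightarrow> (\<And>i. i < n \<Longrightarrow> x i = y i) \<Longrightarrow> x = y"
  by (metis Rn_iff ext not_less)

section \<open>Open sets and cubes in coordinate space\<close>

abbreviation opn :: "nat \<Rightarrow> rvec set \<Rightarrow> bool" where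
  "opn n U \<equiv> openin (Euclidean_space n) U"

text \<open>Sup-norm balls; they take the place of metric balls in \<open>Rn n\<close>.\<close>

definition cube :: "nat \<Rightarrow> rvec \<Rightarrow> real \<Rightarrow> rvec set" where
  "cube n x r = {y \<in> Rn n. \<forall>i<n. \<bar>y i - x i\<bar> < r}"

lemma cubeI: "y \<in> Rn n \<Longrightarrow> (\<And>i. i < n \<Longrightarrow> \<bar>y i - x i\<bar> < r) \<Longrightarrow> y \<in> cube n x r"
  by (simp add: cube_def)

lemma cubeD: "y \<in> cube n x r \<Longrightarrow> y \<in> Rn n" "y \<in> cube n x r \<Longrightarrow> i < n \<Longrightarrow> \<bar>y i - x i\<bar> < r"
  by (simp_all add: cube_def)

lemma cube_self: "x \<in> Rn n \<Longrightarrow> 0 < r \<Longrightarrow> x \<in> cube n x r"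
  by (simp add: cube_def)

lemma cube_mono: "r \<le> s \<Longrightarrow> cube n x r \<subseteq> cube n x s"
  by (force simp: cube_def)

lemma openin_cube: "opn n (cube n x r)"
proof -
  have "open (\<Inter>i<n. {y::rvec. \<bar>y i - x i\<bar> < r})"
  proof (intro open_INT finite_lessThan ballI)
    fix i
    have "continuous_on UNIV (\<lambda>y::rvec. \<bar>y i - x i\<bar>)"
      by (rule continuous_on_rabs[OF continuous_on_diff[OF continuous_on_product_coordinates continuous_on_const]])
    then show "open {y::rvec. \<bar>y i - x i\<bar> < r}"
      by (rule open_Collect_less[OF _ continuous_on_const])
  qed
  then have op: "openin (top_of_set (Rn n)) (Rn n \<inter> (\<Inter>i<n. {y::rvec. \<bar>y i - x i\<bar> < r}))"
    by (rule openin_open_Int)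
  have cu: "cube n x r = Rn n \<inter> (\<Inter>i<n. {y. \<bar>y i - x i\<bar> < r})"
    by (auto simp: cube_def)
  have E: "Euclidean_space n = top_of_set (Rn n)"
    unfolding topspace_Euclidean_space by (simp add: Euclidean_space_def euclidean_product_topology)
  show ?thesis
    unfolding cu using op unfolding E[symmetric] .
qed

text \<open>A basic open set of the product topology constrains every coordinate, but points of
  \<open>Rn n\<close> vanish from index \<open>n\<close> on, so only finitely many constraints
  matter and a positive radius exists.\<close>

lemma opn_iff: "opn n U \<longleftrightarrow> U \<subseteq> Rn n \<and> (\<forall>x\<in>U. \<exists>r>0. cube n x r \<subseteq> U)"
proof safe
  fix x i assume "opn n U" "x \<in> U"
  then show "x \<in> Rn n" using openin_subset by blast
next
  fix x assume U: "opn n U" and x: "x \<in> U"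
  have xR: "x \<in> Rn n" using U x openin_subset by blast
  have "Euclidean_space n = subtopology (powertop_real UNIV) (Rn n)"
    unfolding topspace_Euclidean_space by (simp add: Euclidean_space_def)
  then obtain T where T: "openin (powertop_real UNIV) T" "U = T \<inter> Rn n"
    using U by (metis openin_subtopology)
  obtain X where X: "x \<in> (\<Pi>\<^sub>E i\<in>UNIV. X i)" "\<And>i. open (X i)" "(\<Pi>\<^sub>E i\<in>UNIV. X i) \<subseteq> T"
    using product_topology_open_contains_basis[OF T(1), of x] x T(2) by auto
  have "\<exists>e>0. \<forall>t. \<bar>t - x i\<bar> < e \<longrightarrow> t \<in> X i" for i
    using X(1) X(2)[of i] by (auto simp: open_real PiE_iff)
  then obtain e where e: "\<And>i. e i > 0" "\<And>i t. \<bar>t - x i\<bar> < e i \<Longrightarrow> t \<in> X i"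
    by metis
  \<comment> \<open>The entry 1 covers \<open>n = 0\<close>, where the minimum would be over the
    empty set.\<close>
  define r where "r = Min (insert 1 (e ` {..<n}))"
  have r0: "r > 0" using e(1) by (simp add: r_def)
  have re: "r \<le> e i" if "i < n" for i using that by (simp add: r_def)
  have "cube n x r \<subseteq> U"
  proof
    fix y assume y: "y \<in> cube n x r"
    have "y i \<in> X i" for i
    proof (cases "i < n")
      case True
      then show ?thesis using cubeD(2)[OF y True] re[OF True] e(2) by force
    next
      case False
      then have "y i = x i" using cubeD(1)[OF y] xR by (simp add: Rn_iff)
      then show ?thesis using e by simp
    qed
    then have "y \<in> T" using X(3) by (auto simp: PiE_iff)
    then show "y \<in> U" using T(2) cubeD(1)[OF y] by blast
  qed
  then show "\<exists>r>0. cube n x r \<subseteq> U" using r0 by blast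
next
  assume U: "U \<subseteq> Rn n" and c: "\<forall>x\<in>U. \<exists>r>0. cube n x r \<subseteq> U"
  show "opn n U"
  proof (subst openin_subopen, intro ballI)
    fix x assume x: "x \<in> U"
    then obtain r where r: "r > 0" "cube n x r \<subseteq> U" using c by blast
    have "x \<in> cube n x r" using U x r(1) by (intro cube_self) auto
    then show "\<exists>T. opn n T \<and> x \<in> T \<and> T \<subseteq> U"
      using openin_cube r(2) by metis
  qed
qed

lemma opn_subset: "opn n U \<Longrightarrow> U \<subseteq> Rn n"
  by (rule openin_subset)

lemma opn_cube: "opn n U \<Longrightarrow> x \<in> U \<Longrightarrow> \<exists>r>0. cube n x r \<subseteq> U"
  by (simp add: opn_iff)

lemma opn_Rn: "opn n (Rn n)"
  by simp

lemma topspace_sub: "U \<subseteq> Rn n \<Longrightarrow> topspace (subtopology (Euclidean_space n) U) = U"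
  by (simp add: Int_absorb1)

text \<open>Cubes may be shrunk into \<open>U\<close>, so the right-hand side need not ask for
  \<open>y \<in> U\<close>.\<close>

lemma cont_Rn_iff:
  assumes U: "opn n U"
  shows "continuous_map (subtopology (Euclidean_space n) U) euclideanreal f \<longleftrightarrow>
    (\<forall>x\<in>U. \<forall>e>0. \<exists>r>0. \<forall>y\<in>cube n x r. \<bar>f y - f x\<bar> < e)" (is "?L \<longleftrightarrow> ?R")
proof
  assume L: ?L
  show ?R
  proof (intro ballI allI impI)
    fix x and e::real assume x: "x \<in> U" and e: "e > 0"
    have "openin (subtopology (Euclidean_space n) U) {y \<in> topspace (subtopology (Euclidean_space n) U). f y \<in> ball (f x) e}"
      by (rule openin_continuous_map_preimage[OF L]) simp
    then have "opn n {y \<in> U. f y \<in> ball (f x) e}"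
      unfolding topspace_sub[OF opn_subset[OF U]] openin_open_subtopology[OF U] by blast
    then obtain r where "r > 0" "cube n x r \<subseteq> {y \<in> U. f y \<in> ball (f x) e}"
      using opn_cube[of n "{y \<in> U. f y \<in> ball (f x) e}" x] x e by fastforce
    then have "\<bar>f y - f x\<bar> < e" if "y \<in> cube n x r" for y
      using that by (auto simp: dist_real_def abs_minus_commute)
    then show "\<exists>r>0. \<forall>y\<in>cube n x r. \<bar>f y - f x\<bar> < e"
      using \<open>r > 0\<close> by blast
  qed
next
  assume R: ?R
  show ?L
    unfolding continuous_map_def
  proof (intro conjI allI impI)
    fix V :: "real set" assume V: "openin euclideanreal V"
    have "opn n {x \<in> U. f x \<in> V}"
      unfolding opn_iff
    proof safe
      fix x assume x: "x \<in> U" "f x \<in> V"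
      then show "x \<in> Rn n" using opn_subset[OF U] by blast
    next
      fix x assume x: "x \<in> U" "f x \<in> V"
      then obtain e where e: "e > 0" "\<And>t. \<bar>t - f x\<bar> < e \<Longrightarrow> t \<in> V"
        using V by (auto simp: open_real)
      obtain r where r: "r > 0" "\<forall>y\<in>cube n x r. \<bar>f y - f x\<bar> < e" using R x e by blast
      obtain s where s: "s > 0" "cube n x s \<subseteq> U" using opn_cube[OF U x(1)] by blast
      have "cube n x (min r s) \<subseteq> {x \<in> U. f x \<in> V}"
        using r s e cube_mono[of "min r s" r n x] cube_mono[of "min r s" s n x] by (auto simp: subset_iff)
      then show "\<exists>r>0. cube n x r \<subseteq> {x \<in> U. f x \<in> V}" using r(1) s(1) by (metis min_less_iff_conj)
    qed
    then show "openin (subtopology (Euclidean_space n) U)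
          {x \<in> topspace (subtopology (Euclidean_space n) U). f x \<in> V}"
      unfolding topspace_sub[OF opn_subset[OF U]] openin_open_subtopology[OF U] by blast
  qed auto
qed

lemma line_eventually:
  assumes "opn n U" "x \<in> U" "i < n"
  shows "\<forall>\<^sub>F t in nhds (x i). x(i := t) \<in> U"
proof -
  obtain r where r: "r > 0" "cube n x r \<subseteq> U" using opn_cube assms by blast
  have xR: "x \<in> Rn n" using assms opn_subset by blast
  have "\<forall>\<^sub>F t in nhds (x i). dist t (x i) < r"
    using r(1) eventually_nhds_metric by blast
  then show ?thesis
  proof eventually_elim
    case (elim t)
    then have "x(i := t) \<in> cube n x r" using xR assms(3) r(1)
      by (auto simp: cube_def Rn_iff dist_real_def)
    then show ?case using r(2) by blast
  qed
qed

section \<open>Closure properties of \<open>Ck_on\<close> and \<open>Cinf_on\<close>\<close>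

lemma Ck_on_cont: "Ck_on k n U f \<Longrightarrow> continuous_map (subtopology (Euclidean_space n) U) euclideanreal f"
  by (cases k) auto

lemma Ck_on_has_pd:
  assumes "Ck_on (Suc k) n U f" "i < n" "x \<in> U"
  shows "((\<lambda>t. f (x(i := t))) has_real_derivative pd i f x) (at (x i))"
  using assms by (simp add: pd_def DERIV_deriv_iff_field_differentiable)

lemma Ck_on_pd: "Ck_on (Suc k) n U f \<Longrightarrow> i < n \<Longrightarrow> Ck_on k n U (pd i f)"
  by simp

lemma Ck_on_Suc_down: "Ck_on (Suc k) n U f \<Longrightarrow> Ck_on k n U f"
proof (induction k arbitrary: f)
  case (Suc k)
  then show ?case by (metis Ck_on.simps(2))
qed simp

lemma Ck_on_mono: "Ck_on k n U f \<Longrightarrow> j \<le> k \<Longrightarrow> Ck_on j n U f"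
  by (induction k) (auto simp: le_Suc_eq dest: Ck_on_Suc_down simp del: Ck_on.simps)

lemma Cinf_Ck: "Cinf_on n U f \<Longrightarrow> Ck_on k n U f"
  by (simp add: Cinf_on_def)

lemma pd_cong:
  assumes "opn n U" "x \<in> U" "i < n" "\<And>y. y \<in> U \<Longrightarrow> f y = g y"
  shows "pd i f x = pd i g x"
proof -
  have "\<forall>\<^sub>F t in nhds (x i). f (x(i := t)) = g (x(i := t))"
    using line_eventually[OF assms(1-3)] by (rule eventually_mono) (simp add: assms(4))
  then show ?thesis unfolding pd_def by (rule deriv_cong_ev) simp
qed

lemma Ck_on_cong_imp:
  assumes "opn n U" "\<And>x. x \<in> U \<Longrightarrow> f x = g x" "Ck_on k n U f"
  shows "Ck_on k n U g"
  using assms(2,3)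
proof (induction k arbitrary: f g)
  case 0
  then show ?case
    by (auto elim!: continuous_map_eq)
next
  case (Suc k)
  have "(\<lambda>t. g (x(i := t))) field_differentiable at (x i)" if "i < n" "x \<in> U" for i x
  proof -
    have ev: "\<forall>\<^sub>F t in nhds (x i). f (x(i := t)) = g (x(i := t))"
      by (rule eventually_mono[OF line_eventually[OF assms(1) that(2,1)]]) (rule Suc.prems(1))
    have "((\<lambda>t. f (x(i := t))) has_real_derivative pd i f x) (at (x i))"
      using Ck_on_has_pd[OF Suc.prems(2) that] .
    then have "((\<lambda>t. g (x(i := t))) has_real_derivative pd i f x) (at (x i))"
      using DERIV_cong_ev[OF refl ev refl] by simp
    then show ?thesis using field_differentiable_def by blast
  qed
  moreover have "Ck_on k n U (pd i g)" if "i < n" for i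
    using Suc.IH[of "pd i f" "pd i g"] Suc.prems that pd_cong[OF assms(1) _ that, of _ f g] by simp
  moreover have "continuous_map (subtopology (Euclidean_space n) U) euclideanreal g"
    using Suc.prems by (auto elim!: continuous_map_eq)
  ultimately show ?case by simp
qed

lemma Ck_on_cong:
  assumes "opn n U" "\<And>x. x \<in> U \<Longrightarrow> f x = g x"
  shows "Ck_on k n U f \<longleftrightarrow> Ck_on k n U g"
  using Ck_on_cong_imp[OF assms(1), of f g k] Ck_on_cong_imp[OF assms(1), of g f k] assms(2) by auto

lemma Cinf_on_cong:
  assumes "opn n U" "\<And>x. x \<in> U \<Longrightarrow> f x = g x"
  shows "Cinf_on n U f \<longleftrightarrow> Cinf_on n U g"
  using Ck_on_cong[OF assms] by (simp add: Cinf_on_def)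

lemma Ck_on_subset:
  assumes "Ck_on k n U f" "V \<subseteq> U"
  shows "Ck_on k n V f"
  using assms(1)
proof (induction k arbitrary: f)
  case 0
  then show ?case using assms(2) by (auto intro: continuous_map_from_subtopology_mono)
next
  case (Suc k)
  then show ?case using assms(2) by (auto intro: continuous_map_from_subtopology_mono)
qed

lemma Cinf_on_subset: "Cinf_on n U f \<Longrightarrow> V \<subseteq> U \<Longrightarrow> Cinf_on n V f"
  using Ck_on_subset unfolding Cinf_on_def by blast

lemma cont_local:
  assumes "opn n U"
    and "\<And>x. x \<in> U \<Longrightarrow> \<exists>V. opn n V \<and> x \<in> V \<and> continuous_map (subtopology (Euclidean_space n) V) euclideanreal f"
  shows "continuous_map (subtopology (Euclidean_space n) U) euclideanreal f"
  unfolding cont_Rn_iff[OF assms(1)] using assms(2) cont_Rn_iff by metis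

lemma Ck_on_local:
  assumes "opn n U" "\<And>x. x \<in> U \<Longrightarrow> \<exists>V. opn n V \<and> x \<in> V \<and> Ck_on k n V f"
  shows "Ck_on k n U f"
  using assms(2)
proof (induction k arbitrary: f)
  case 0
  then show ?case using cont_local[OF assms(1), of f] by auto
next
  case (Suc k)
  have "continuous_map (subtopology (Euclidean_space n) U) euclideanreal f"
    using cont_local[OF assms(1), of f] Suc.prems by (metis Ck_on_cont)
  moreover have "(\<lambda>t. f (x(i := t))) field_differentiable at (x i)" if "i < n" "x \<in> U" for i x
    using Suc.prems[OF that(2)] that(1) by auto
  moreover have "Ck_on k n U (pd i f)" if "i < n" for i
  proof (rule Suc.IH)
    fix x assume "x \<in> U"
    from Suc.prems[OF this] show "\<exists>V. opn n V \<and> x \<in> V \<and> Ck_on k n V (pd i f)"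
      using that by auto
  qed
  ultimately show ?case by simp
qed

lemma Cinf_on_local:
  assumes "opn n U" "\<And>x. x \<in> U \<Longrightarrow> \<exists>V. opn n V \<and> x \<in> V \<and> Cinf_on n V f"
  shows "Cinf_on n U f"
  unfolding Cinf_on_def
  by (intro allI Ck_on_local[OF assms(1)]) (meson Cinf_on_def assms(2))

lemma Ck_on_SucI:
  assumes "opn n U" "continuous_map (subtopology (Euclidean_space n) U) euclideanreal f"
    and D: "\<And>i x. i < n \<Longrightarrow> x \<in> U \<Longrightarrow> ((\<lambda>t. f (x(i := t))) has_real_derivative D i x) (at (x i))"
    and "\<And>i. i < n \<Longrightarrow> Ck_on k n U (D i)"
  shows "Ck_on (Suc k) n U f"
proof -
  have "D i x = pd i f x" if "i < n" "x \<in> U" for i x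
    using D[OF that] by (simp add: pd_def DERIV_imp_deriv)
  then have "Ck_on k n U (pd i f)" if "i < n" for i
    using Ck_on_cong_imp[OF assms(1) _ assms(4)[OF that]] that by blast
  moreover have "(\<lambda>t. f (x(i := t))) field_differentiable at (x i)" if "i < n" "x \<in> U" for i x
    unfolding field_differentiable_def using D[OF that] by blast
  ultimately show ?thesis using assms(2) by simp
qed

lemma Ck_on_const: "opn n U \<Longrightarrow> Ck_on k n U (\<lambda>_. c)"
proof (induction k arbitrary: c)
  case (Suc k)
  show ?case
    by (rule Ck_on_SucI[where D="\<lambda>i x. 0"]) (use Suc in \<open>auto intro!: derivative_eq_intros\<close>)
qed simp

lemma cont_coord: "continuous_map (subtopology (Euclidean_space n) U) euclideanreal (\<lambda>x. x i)"
  unfolding Euclidean_space_def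
  by (intro continuous_map_from_subtopology continuous_map_product_coordinates) auto

lemma Ck_on_coord:
  assumes "opn n U"
  shows "Ck_on k n U (\<lambda>x. x i)"
proof (cases k)
  case 0
  then show ?thesis by (simp add: cont_coord)
next
  case (Suc k)
  show ?thesis
    unfolding Suc
  proof (rule Ck_on_SucI[OF assms cont_coord, where D="\<lambda>j x. if i = j then 1 else 0"])
    fix j x assume "j < n" "x \<in> U"
    show "((\<lambda>t. (x(j := t)) i) has_real_derivative (if i = j then 1 else 0)) (at (x j))"
      by (cases "i = j") (auto intro!: derivative_eq_intros)
  qed (use Ck_on_const[OF assms] in auto)
qed

lemma Ck_on_add:
  assumes "opn n U" "Ck_on k n U f" "Ck_on k n U g"
  shows "Ck_on k n U (\<lambda>x. f x + g x)"
  using assms(2,3)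
proof (induction k arbitrary: f g)
  case 0
  then show ?case by (auto intro: continuous_map_add)
next
  case (Suc k)
  show ?case
  proof (rule Ck_on_SucI[OF assms(1), where D="\<lambda>i x. pd i f x + pd i g x"])
    show "continuous_map (subtopology (Euclidean_space n) U) euclideanreal (\<lambda>x. f x + g x)"
      using Suc.prems by (auto intro: continuous_map_add)
  next
    fix i x assume "i < n" "x \<in> U"
    show "((\<lambda>t. f (x(i := t)) + g (x(i := t))) has_real_derivative pd i f x + pd i g x) (at (x i))"
      by (rule DERIV_add[OF Ck_on_has_pd[OF Suc.prems(1) \<open>i < n\<close> \<open>x \<in> U\<close>] Ck_on_has_pd[OF Suc.prems(2) \<open>i < n\<close> \<open>x \<in> U\<close>]])
  next
    fix i assume "i < n"
    show "Ck_on k n U (\<lambda>x. pd i f x + pd i g x)"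
      by (intro Suc.IH Ck_on_pd[OF Suc.prems(1)] Ck_on_pd[OF Suc.prems(2)] \<open>i < n\<close>)
  qed
qed

lemma Ck_on_mult:
  assumes "opn n U" "Ck_on k n U f" "Ck_on k n U g"
  shows "Ck_on k n U (\<lambda>x. f x * g x)"
  using assms(2,3)
proof (induction k arbitrary: f g)
  case 0
  then show ?case by (auto intro: continuous_map_real_mult)
next
  case (Suc k)
  show ?case
  proof (rule Ck_on_SucI[OF assms(1), where D="\<lambda>i x. pd i f x * g x + pd i g x * f x"])
    show "continuous_map (subtopology (Euclidean_space n) U) euclideanreal (\<lambda>x. f x * g x)"
      using Suc.prems by (auto intro: continuous_map_real_mult)
  next
    fix i x assume "i < n" "x \<in> U"
    show "((\<lambda>t. f (x(i := t)) * g (x(i := t))) has_real_derivative pd i f x * g x + pd i g x * f x) (at (x i))"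
      using DERIV_mult[OF Ck_on_has_pd[OF Suc.prems(1) \<open>i < n\<close> \<open>x \<in> U\<close>] Ck_on_has_pd[OF Suc.prems(2) \<open>i < n\<close> \<open>x \<in> U\<close>]]
      by (simp only: fun_upd_triv add.commute mult.commute)
  next
    fix i assume "i < n"
    show "Ck_on k n U (\<lambda>x. pd i f x * g x + pd i g x * f x)"
      by (intro Ck_on_add[OF assms(1)] Suc.IH Ck_on_pd[OF Suc.prems(1)] Ck_on_pd[OF Suc.prems(2)]
          Ck_on_Suc_down[OF Suc.prems(1)] Ck_on_Suc_down[OF Suc.prems(2)] \<open>i < n\<close>)
  qed
qed

lemma Ck_on_sum:
  assumes "opn n U" "\<And>i. i \<in> I \<Longrightarrow> Ck_on k n U (f i)"
  shows "Ck_on k n U (\<lambda>x. \<Sum>i\<in>I. f i x)"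
  using assms(2)
  by (induction I rule: infinite_finite_induct)
     (auto simp del: Ck_on.simps intro: Ck_on_add[OF assms(1)] Ck_on_const[OF assms(1)])

text \<open>The proof moves from \<open>z\<close> to \<open>y\<close> one coordinate at a time.\<close>

lemma strict_diff:
  assumes U: "opn n U" and f: "Ck_on 1 n U f" and x: "x \<in> U" and e: "e > 0"
  shows "\<exists>r>0. cube n x r \<subseteq> U \<and> (\<forall>y\<in>cube n x r. \<forall>z\<in>cube n x r.
    \<bar>f y - f z - (\<Sum>i<n. pd i f x * (y i - z i))\<bar> \<le> e * (\<Sum>i<n. \<bar>y i - z i\<bar>))"
proof -
  have f1: "Ck_on (Suc 0) n U f" using f by simp
  have "\<exists>r>0. \<forall>y\<in>cube n x r. \<bar>pd i f y - pd i f x\<bar> < e" if "i < n" for i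
    using Ck_on_cont[OF Ck_on_pd[OF f1 that]] x e by (auto simp: cont_Rn_iff[OF U])
  then obtain d where d: "\<And>i. i < n \<Longrightarrow> d i > 0"
    "\<And>i y. i < n \<Longrightarrow> y \<in> cube n x (d i) \<Longrightarrow> \<bar>pd i f y - pd i f x\<bar> < e" by metis
  obtain r0 where r0: "r0 > 0" "cube n x r0 \<subseteq> U" using opn_cube[OF U x] by blast
  define r where "r = Min (insert r0 (d ` {..<n}))"
  have r: "r > 0" "r \<le> r0" "\<And>i. i < n \<Longrightarrow> r \<le> d i" using d(1) r0(1) by (auto simp: r_def)
  have cU: "cube n x r \<subseteq> U" using cube_mono[OF r(2)] r0(2) by blast
  show ?thesis
  proof (intro exI conjI ballI)
    fix y z assume y: "y \<in> cube n x r" and z: "z \<in> cube n x r"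
    define w where "w k = (\<lambda>i. if i < k then y i else z i)" for k :: nat
    have step: "\<bar>f (w (Suc k)) - f (w k) - pd k f x * (y k - z k)\<bar> \<le> e * \<bar>y k - z k\<bar>" if k: "k < n" for k
    proof -
      define g where "g t = f ((w k)(k := t))" for t
      have g: "f (w (Suc k)) = g (y k)" "f (w k) = g (z k)"
        by (auto simp: g_def w_def intro!: arg_cong[where f=f])
      \<comment> \<open>A cube is a box, so changing one coordinate to a value between those of
        \<open>y\<close> and \<open>z\<close> does not leave it; the mean value theorem may be
        applied along this segment.\<close>
      have inc: "(w k)(k := t) \<in> cube n x r" if "min (y k) (z k) \<le> t" "t \<le> max (y k) (z k)" for t
      proof (rule cubeI)
        show "(w k)(k := t) \<in> Rn n" using y z k by (auto simp: cube_def Rn_iff w_def)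
        fix i assume "i < n"
        have "\<bar>y i - x i\<bar> < r" "\<bar>z i - x i\<bar> < r" using y z \<open>i < n\<close> by (auto simp: cube_def)
        then show "\<bar>((w k)(k := t)) i - x i\<bar> < r"
          using that by (cases "i = k") (auto simp: w_def)
      qed
      have gd: "(g has_real_derivative pd k f ((w k)(k := t))) (at t)"
        if "min (y k) (z k) \<le> t" "t \<le> max (y k) (z k)" for t
      proof -
        have "(w k)(k := t) \<in> U" using inc[OF that] cU by blast
        from Ck_on_has_pd[OF f1 k this] show ?thesis by (simp add: g_def[abs_def])
      qed
      have "\<exists>t. min (y k) (z k) \<le> t \<and> t \<le> max (y k) (z k) \<and>
          g (y k) - g (z k) = (y k - z k) * pd k f ((w k)(k := t))"
      proof (cases "y k" "z k" rule: linorder_cases)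
        case less
        then obtain t where "t > y k" "t < z k" "g (z k) - g (y k) = (z k - y k) * pd k f ((w k)(k := t))"
          using MVT2[OF less, of g "\<lambda>t. pd k f ((w k)(k := t))"] gd by auto
        then show ?thesis using less by (intro exI[of _ t]) (auto simp: algebra_simps)
      next
        case equal
        then show ?thesis by auto
      next
        case greater
        then obtain t where "t > z k" "t < y k" "g (y k) - g (z k) = (y k - z k) * pd k f ((w k)(k := t))"
          using MVT2[OF greater, of g "\<lambda>t. pd k f ((w k)(k := t))"] gd by auto
        then show ?thesis using greater by (intro exI[of _ t]) auto
      qed
      then obtain t where t: "min (y k) (z k) \<le> t" "t \<le> max (y k) (z k)"
          "g (y k) - g (z k) = (y k - z k) * pd k f ((w k)(k := t))" by blast
      have "\<bar>pd k f ((w k)(k := t)) - pd k f x\<bar> \<le> e"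
        using d(2)[OF k] inc[OF t(1,2)] cube_mono[OF r(3)[OF k]] by force
      then have "\<bar>(y k - z k) * (pd k f ((w k)(k := t)) - pd k f x)\<bar> \<le> \<bar>y k - z k\<bar> * e"
        by (simp add: abs_mult mult_left_mono)
      then show ?thesis unfolding g t(3) by (simp add: algebra_simps)
    qed
    have w0: "w 0 = z" by (simp add: w_def)
    have wn: "w n = y" using cubeD(1)[OF y] cubeD(1)[OF z] by (auto simp: w_def Rn_iff)
    have "f y - f z = (\<Sum>k<n. f (w (Suc k)) - f (w k))"
      by (subst sum_lessThan_telescope) (simp add: w0 wn)
    then have "\<bar>f y - f z - (\<Sum>i<n. pd i f x * (y i - z i))\<bar>
        = \<bar>\<Sum>k<n. f (w (Suc k)) - f (w k) - pd k f x * (y k - z k)\<bar>"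
      by (simp add: sum_subtractf)
    also have "\<dots> \<le> (\<Sum>k<n. e * \<bar>y k - z k\<bar>)"
      by (rule order_trans[OF sum_abs sum_mono]) (use step in auto)
    finally show "\<bar>f y - f z - (\<Sum>i<n. pd i f x * (y i - z i))\<bar> \<le> e * (\<Sum>i<n. \<bar>y i - z i\<bar>)"
      by (simp add: sum_distrib_left)
  qed (use r cU in auto)
qed

lemma strict_diff_family:
  fixes d :: nat
  assumes U: "opn n U" and f: "\<And>i. i < d \<Longrightarrow> Ck_on 1 n U (f i)" and x: "x \<in> U" and e: "e > 0"
  shows "\<exists>r>0. cube n x r \<subseteq> U \<and> (\<forall>i<d. \<forall>y\<in>cube n x r. \<forall>z\<in>cube n x r.
    \<bar>f i y - f i z - (\<Sum>j<n. pd j (f i) x * (y j - z j))\<bar> \<le> e * (\<Sum>j<n. \<bar>y j - z j\<bar>))"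
proof -
  let ?P = "\<lambda>i r. 0 < r \<and> cube n x r \<subseteq> U \<and> (\<forall>y\<in>cube n x r. \<forall>z\<in>cube n x r.
    \<bar>f i y - f i z - (\<Sum>j<n. pd j (f i) x * (y j - z j))\<bar> \<le> e * (\<Sum>j<n. \<bar>y j - z j\<bar>))"
  have "\<forall>i\<in>{..<d}. \<exists>r. ?P i r"
    by (intro ballI strict_diff[OF U f x e]) auto
  from bchoice[OF this] obtain c where c: "\<forall>i\<in>{..<d}. ?P i (c i)" ..
  \<comment> \<open>For \<open>d = 0\<close> the radius has to come from \<open>U\<close>
    alone.\<close>
  obtain r0 where r0: "r0 > 0" "cube n x r0 \<subseteq> U" using opn_cube[OF U x] by blast
  define r where "r = Min (insert r0 (c ` {..<d}))"
  have "\<And>i. i < d \<Longrightarrow> 0 < c i" using c by blast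
  then have r: "r > 0" using r0(1) unfolding r_def by (subst Min_gr_iff) auto
  have r': "r \<le> r0" "\<And>i. i < d \<Longrightarrow> r \<le> c i" unfolding r_def by (rule Min_le; force)+
  have "cube n x r \<subseteq> cube n x (c i)" if "i < d" for i by (rule cube_mono[OF r'(2)[OF that]])
  moreover have "cube n x r \<subseteq> U" using cube_mono[OF r'(1), of n x] r0(2) by blast
  ultimately show ?thesis using r c by (intro exI[of _ r]) (simp add: subset_iff)
qed

section \<open>Chain rules\<close>

lemma DERIV_transfer:
  fixes f :: "real \<Rightarrow> real"
  assumes "(f has_real_derivative c) (at t)" "\<forall>\<^sub>F s in nhds t. f s = g s"
  shows "(g has_real_derivative c) (at t)"
  using assms(1) DERIV_cong_ev[OF refl assms(2) refl] by blast

lemma coords_near: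
  assumes "\<And>j. j < n \<Longrightarrow> ((\<lambda>s. h s j) has_real_derivative z j) (at (t::real))" "r > 0"
  shows "\<forall>\<^sub>F s in nhds t. \<forall>j\<in>{..<n::nat}. \<bar>h s j - h t j\<bar> < r"
proof (intro eventually_ball_finite ballI)
  fix j assume "j \<in> {..<n}"
  then have "isCont (\<lambda>s. h s j) t" using DERIV_isCont[OF assms(1)] by simp
  then have "((\<lambda>s. h s j) \<longlongrightarrow> h t j) (nhds t)"
    using tendsto_at_iff_tendsto_nhds[of "\<lambda>s. h s j" t] by (simp add: isCont_def)
  then show "\<forall>\<^sub>F s in nhds t. \<bar>h s j - h t j\<bar> < r"
    using tendstoD assms(2) by (fastforce simp: dist_real_def)
qed simp

text \<open>The curve is differentiable at the single time \<open>t\<close> only. The estimate of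
  \<open>strict_diff\<close> with one point fixed at \<open>h t\<close> bounds the error by a small
  multiple of the distance from \<open>h s\<close> to \<open>h t\<close>, hence of
  \<open>\<bar>s - t\<bar>\<close>, as the difference quotients of \<open>h\<close> stay bounded
  near \<open>t\<close>.\<close>

lemma C1_curve:
  assumes U: "opn n U" and f: "Ck_on 1 n U f" and ht: "h t \<in> U"
    and hR: "\<forall>\<^sub>F s in nhds t. h s \<in> Rn n"
    and hd: "\<And>i. i < n \<Longrightarrow> ((\<lambda>s. h s i) has_real_derivative d i) (at t)"
  shows "((\<lambda>s. f (h s)) has_real_derivative (\<Sum>i<n. pd i f (h t) * d i)) (at t)"
proof -
  define q where "q i s = (h s i - h t i) / (s - t)" for i s
  define r where "r s = (f (h s) - f (h t)) / (s - t) - (\<Sum>i<n. pd i f (h t) * q i s)" for s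
  have q: "(q i \<longlongrightarrow> d i) (at t)" if "i < n" for i
    using hd[OF that] by (simp add: has_field_derivative_iff q_def[abs_def])
  have near: "\<forall>\<^sub>F s in at t. h s \<in> cube n (h t) \<delta>" if "\<delta> > 0" for \<delta>
  proof -
    have "\<forall>\<^sub>F s in at t. \<forall>i\<in>{..<n}. \<bar>h s i - h t i\<bar> < \<delta>"
      using coords_near[where h=h and z=d and n=n, OF hd that] by (auto simp: eventually_at_filter elim: eventually_mono)
    moreover have "\<forall>\<^sub>F s in at t. h s \<in> Rn n" using hR by (auto simp: eventually_at_filter elim: eventually_mono)
    ultimately show ?thesis by eventually_elim (auto simp: cube_def)
  qed
  have "(r \<longlongrightarrow> 0) (at t)"
  proof (rule tendstoI)
    fix e :: real assume e: "e > 0"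
    \<comment> \<open>\<open>K\<close> is an eventual bound for the sum of the difference quotients;
      the factor 2 in \<open>e / (2*K)\<close> makes the final inequality strict.\<close>
    define K where "K = (\<Sum>i<n. \<bar>d i\<bar>) + 1"
    have K: "K > 0" by (auto simp: K_def intro: add_nonneg_pos sum_nonneg)
    obtain \<delta> where \<delta>: "\<delta> > 0" "\<And>y z. y \<in> cube n (h t) \<delta> \<Longrightarrow> z \<in> cube n (h t) \<delta> \<Longrightarrow>
       \<bar>f y - f z - (\<Sum>i<n. pd i f (h t) * (y i - z i))\<bar> \<le> e / (2*K) * (\<Sum>i<n. \<bar>y i - z i\<bar>)"
      using strict_diff[OF U f ht, of "e / (2*K)"] e K by auto
    have "((\<lambda>s. \<Sum>i<n. \<bar>q i s\<bar>) \<longlongrightarrow> (\<Sum>i<n. \<bar>d i\<bar>)) (at t)"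
      by (intro tendsto_sum tendsto_rabs q) auto
    then have "\<forall>\<^sub>F s in at t. (\<Sum>i<n. \<bar>q i s\<bar>) < K"
      by (rule order_tendstoD) (simp add: K_def)
    moreover have "\<forall>\<^sub>F s in at t. h s \<in> cube n (h t) \<delta>" by (rule near[OF \<delta>(1)])
    moreover have "\<forall>\<^sub>F s in at t. s \<noteq> t" by (simp add: eventually_at_filter)
    ultimately show "\<forall>\<^sub>F s in at t. dist (r s) 0 < e"
    proof eventually_elim
      case (elim s)
      have htR: "h t \<in> cube n (h t) \<delta>" using \<delta>(1) ht opn_subset[OF U] cube_self by blast
      have "r s * (s - t) = f (h s) - f (h t) - (\<Sum>i<n. pd i f (h t) * (h s i - h t i))"
      proof -
        have "q i s * (s - t) = h s i - h t i" for i using elim(3) by (simp add: q_def)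
        then have "(\<Sum>i<n. pd i f (h t) * q i s) * (s - t) = (\<Sum>i<n. pd i f (h t) * (h s i - h t i))"
          by (simp add: sum_distrib_right mult.assoc)
        then show ?thesis using elim(3) by (simp add: r_def left_diff_distrib[of "(f (h s) - f (h t)) / (s - t)"])
      qed
      then have "\<bar>r s\<bar> * \<bar>s - t\<bar> \<le> e / (2*K) * (\<Sum>i<n. \<bar>h s i - h t i\<bar>)"
        using \<delta>(2)[OF elim(2) htR] by (simp add: abs_mult[symmetric])
      also have "(\<Sum>i<n. \<bar>h s i - h t i\<bar>) = (\<Sum>i<n. \<bar>q i s\<bar>) * \<bar>s - t\<bar>"
        using elim(3) by (simp add: q_def sum_distrib_right abs_divide)
      finally have "\<bar>r s\<bar> \<le> e / (2*K) * (\<Sum>i<n. \<bar>q i s\<bar>)"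
        using elim(3) by (simp add: mult.assoc[symmetric] del: times_divide_eq_left)
      also have "\<dots> \<le> e / (2*K) * K" using elim(1) e K by (intro mult_left_mono) auto
      also have "\<dots> < e" using K e by simp
      finally show ?case by simp
    qed
  qed
  moreover have "((\<lambda>s. \<Sum>i<n. pd i f (h t) * q i s) \<longlongrightarrow> (\<Sum>i<n. pd i f (h t) * d i)) (at t)"
    by (intro tendsto_sum tendsto_mult tendsto_const q) auto
  ultimately have "((\<lambda>s. r s + (\<Sum>i<n. pd i f (h t) * q i s)) \<longlongrightarrow> 0 + (\<Sum>i<n. pd i f (h t) * d i)) (at t)"
    by (rule tendsto_add)
  then show ?thesis by (simp add: has_field_derivative_iff r_def)
qed

text \<open>Induction on \<open>k\<close> for all outer functions at once: the derivatives of the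
  composite are sums of products of \<open>pd i f \<circ> h\<close>, to which the induction
  hypothesis applies, with derivatives of \<open>h\<close>.\<close>

lemma Ck_on_compose:
  assumes V: "opn m V" and U: "opn n U" and hU: "\<And>x. x \<in> V \<Longrightarrow> h x \<in> U"
    and "\<And>i. i < n \<Longrightarrow> Ck_on k m V (\<lambda>x. h x i)" "Ck_on k n U f"
  shows "Ck_on k m V (\<lambda>x. f (h x))"
  using assms(4,5)
proof (induction k arbitrary: f)
  case 0
  have "continuous_map (subtopology (Euclidean_space m) V) (subtopology (Euclidean_space n) U) h"
  proof -
    \<comment> \<open>Components from \<open>n\<close> on vanish on \<open>Rn n\<close>, so
      truncating \<open>h\<close> changes nothing and gives the form required by the componentwise
      criterion for \<open>Euclidean_space\<close>.\<close>
    have "continuous_map (subtopology (Euclidean_space m) V) (Euclidean_space n) (\<lambda>x i. if i < n then h x i else 0)"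
      using 0 by (simp add: continuous_map_componentwise_Euclidean_space)
    moreover have "(\<lambda>i. if i < n then h x i else 0) = h x" if "x \<in> V" for x
      using hU[OF that] opn_subset[OF U] by (auto simp: Rn_iff subset_iff)
    ultimately have "continuous_map (subtopology (Euclidean_space m) V) (Euclidean_space n) h"
      by (elim continuous_map_eq) auto
    then show ?thesis using hU by (auto simp: continuous_map_in_subtopology)
  qed
  then show ?case using 0 continuous_map_compose by (fastforce simp: o_def)
next
  case (Suc k)
  have d: "((\<lambda>t. f (h (x(j := t)))) has_real_derivative (\<Sum>i<n. pd i f (h x) * pd j (\<lambda>y. h y i) x)) (at (x j))"
    if j: "j < m" and x: "x \<in> V" for j x
  proof -
    have "((\<lambda>s. f (h (x(j := s)))) has_real_derivative
        (\<Sum>i<n. pd i f (h (x(j := x j))) * pd j (\<lambda>y. h y i) x)) (at (x j))"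
    proof (rule C1_curve[OF U, where h="\<lambda>s. h (x(j := s))" and t="x j"])
      show "Ck_on 1 n U f" by (rule Ck_on_mono[OF Suc.prems(2)]) simp
      show "h (x(j := x j)) \<in> U" using hU x by simp
      show "\<forall>\<^sub>F s in nhds (x j). h (x(j := s)) \<in> Rn n"
        by (rule eventually_mono[OF line_eventually[OF V x j]]) (use hU opn_subset[OF U] in blast)
      show "((\<lambda>s. h (x(j := s)) i) has_real_derivative pd j (\<lambda>y. h y i) x) (at (x j))" if "i < n" for i
        using Ck_on_has_pd[OF Suc.prems(1)[OF that] j x] .
    qed
    then show ?thesis by simp
  qed
  show ?case
  proof (rule Ck_on_SucI[OF V _ d])
    have "Ck_on k m V (\<lambda>x. f (h x))"
      by (rule Suc.IH) (use Suc.prems Ck_on_Suc_down in blast)+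
    then show "continuous_map (subtopology (Euclidean_space m) V) euclideanreal (\<lambda>x. f (h x))"
      by (rule Ck_on_cont)
  next
    fix j assume j: "j < m"
    show "Ck_on k m V (\<lambda>x. \<Sum>i<n. pd i f (h x) * pd j (\<lambda>y. h y i) x)"
    proof (intro Ck_on_sum[OF V] Ck_on_mult[OF V])
      fix i assume "i \<in> {..<n}"
      then have i: "i < n" by simp
      show "Ck_on k m V (\<lambda>x. pd i f (h x))"
        by (rule Suc.IH) (use Suc.prems Ck_on_Suc_down Ck_on_pd i in blast)+
      show "Ck_on k m V (pd j (\<lambda>y. h y i))"
        using Ck_on_pd[OF Suc.prems(1)[OF i] j] .
    qed
  qed
qed

lemma Cinf_on_compose:
  assumes "opn m V" "opn n U" "\<And>x. x \<in> V \<Longrightarrow> h x \<in> U"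
    and "\<And>i. i < n \<Longrightarrow> Cinf_on m V (\<lambda>x. h x i)" "Cinf_on n U f"
  shows "Cinf_on m V (\<lambda>x. f (h x))"
  unfolding Cinf_on_def
proof
  fix k
  show "Ck_on k m V (\<lambda>x. f (h x))"
    by (rule Ck_on_compose[OF assms(1-3)]) (use assms(4,5) Cinf_Ck in blast)+
qed

lemma Cinf_on_const: "opn n U \<Longrightarrow> Cinf_on n U (\<lambda>_. c)"
  by (simp add: Cinf_on_def Ck_on_const)

lemma Cinf_on_coord: "opn n U \<Longrightarrow> Cinf_on n U (\<lambda>x. x i)"
  by (simp add: Cinf_on_def Ck_on_coord)

lemma Cinf_on_add: "opn n U \<Longrightarrow> Cinf_on n U f \<Longrightarrow> Cinf_on n U g \<Longrightarrow> Cinf_on n U (\<lambda>x. f x + g x)"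
  by (simp add: Cinf_on_def Ck_on_add)

lemma Cinf_on_mult: "opn n U \<Longrightarrow> Cinf_on n U f \<Longrightarrow> Cinf_on n U g \<Longrightarrow> Cinf_on n U (\<lambda>x. f x * g x)"
  by (simp add: Cinf_on_def Ck_on_mult)

lemma Cinf_on_sum:
  "opn n U \<Longrightarrow> (\<And>i. i \<in> I \<Longrightarrow> Cinf_on n U (F i)) \<Longrightarrow> Cinf_on n U (\<lambda>x. \<Sum>i\<in>I. F i x)"
  by (simp add: Cinf_on_def Ck_on_sum)

lemma Cinf_on_pd: "Cinf_on n U f \<Longrightarrow> i < n \<Longrightarrow> Cinf_on n U (pd i f)"
  unfolding Cinf_on_def using Ck_on_pd by blast

lemma Cinf_on_has_pd:
  "Cinf_on n U f \<Longrightarrow> i < n \<Longrightarrow> x \<in> U \<Longrightarrow> ((\<lambda>t. f (x(i := t))) has_real_derivative pd i f x) (at (x i))"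
  unfolding Cinf_on_def using Ck_on_has_pd by blast

lemma Cinf_on_cont:
  "Cinf_on n U f \<Longrightarrow> continuous_map (subtopology (Euclidean_space n) U) euclideanreal f"
  unfolding Cinf_on_def using Ck_on_cont by blast

lemma pd_compose:
  assumes V: "opn m V" and U: "opn n U" and hU: "\<And>x. x \<in> V \<Longrightarrow> h x \<in> U"
    and h: "\<And>i. i < n \<Longrightarrow> Cinf_on m V (\<lambda>x. h x i)" and f: "Cinf_on n U f"
    and j: "j < m" and x: "x \<in> V"
  shows "pd j (\<lambda>y. f (h y)) x = (\<Sum>i<n. pd i f (h x) * pd j (\<lambda>y. h y i) x)"
proof -
  have "((\<lambda>s. f (h (x(j := s)))) has_real_derivative
        (\<Sum>i<n. pd i f (h (x(j := x j))) * pd j (\<lambda>y. h y i) x)) (at (x j))"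
  proof (rule C1_curve[OF U, where h="\<lambda>s. h (x(j := s))" and t="x j"])
    show "Ck_on 1 n U f" by (rule Cinf_Ck[OF f])
    show "h (x(j := x j)) \<in> U" using hU x by simp
    show "\<forall>\<^sub>F s in nhds (x j). h (x(j := s)) \<in> Rn n"
      by (rule eventually_mono[OF line_eventually[OF V x j]]) (use hU opn_subset[OF U] in blast)
    show "((\<lambda>s. h (x(j := s)) i) has_real_derivative pd j (\<lambda>y. h y i) x) (at (x j))" if "i < n" for i
      using Cinf_on_has_pd[OF h[OF that] j x] .
  qed
  then show ?thesis by (simp add: pd_def DERIV_imp_deriv)
qed

lemma jacobian_Rn: "jacobian m n f x v \<in> Rn n"
  by (simp add: jacobian_def Rn_iff)

lemma dir_deriv_compose:
  assumes "opn m V" "opn n U" "\<And>x. x \<in> V \<Longrightarrow> h x \<in> U"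
    and "\<And>i. i < n \<Longrightarrow> Cinf_on m V (\<lambda>x. h x i)" "Cinf_on n U f" "x \<in> V"
  shows "dir_deriv m (\<lambda>y. f (h y)) x v = dir_deriv n f (h x) (jacobian m n h x v)"
proof -
  have "dir_deriv m (\<lambda>y. f (h y)) x v = (\<Sum>j<m. \<Sum>i<n. v j * (pd i f (h x) * pd j (\<lambda>y. h y i) x))"
    unfolding dir_deriv_def using pd_compose[OF assms(1-5) _ assms(6)] by (simp add: sum_distrib_left)
  also have "\<dots> = (\<Sum>i<n. \<Sum>j<m. v j * (pd i f (h x) * pd j (\<lambda>y. h y i) x))"
    by (rule sum.swap)
  also have "\<dots> = dir_deriv n f (h x) (jacobian m n h x v)"
    by (simp add: dir_deriv_def jacobian_def sum_distrib_left sum_distrib_right algebra_simps)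
  finally show ?thesis .
qed

lemma dir_deriv_cong:
  assumes "opn n U" "x \<in> U" "\<And>y. y \<in> U \<Longrightarrow> f y = g y"
  shows "dir_deriv n f x v = dir_deriv n g x v"
  unfolding dir_deriv_def using pd_cong[OF assms(1,2) _ assms(3)] by (auto intro!: sum.cong)

section \<open>Plots of manifolds\<close>

lemma continuous_map_local:
  assumes "\<And>x. x \<in> topspace X \<Longrightarrow> \<exists>U. openin X U \<and> x \<in> U \<and> continuous_map (subtopology X U) Y f"
  shows "continuous_map X Y f"
  unfolding continuous_map_def
proof (intro conjI allI impI)
  show "f \<in> topspace X \<rightarrow> topspace Y"
  proof
    fix x assume "x \<in> topspace X"
    with assms[OF this] show "f x \<in> topspace Y"
      by (fastforce simp: continuous_map_def Pi_iff)
  qed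
  fix W assume W: "openin Y W"
  show "openin X {x \<in> topspace X. f x \<in> W}"
  proof (subst openin_subopen, intro ballI)
    fix x assume x: "x \<in> {x \<in> topspace X. f x \<in> W}"
    then obtain U where U: "openin X U" "x \<in> U" "continuous_map (subtopology X U) Y f" using assms by blast
    have "openin (subtopology X U) {x \<in> topspace (subtopology X U). f x \<in> W}"
      by (rule openin_continuous_map_preimage[OF U(3) W])
    then have "openin X {x \<in> topspace (subtopology X U). f x \<in> W}"
      using openin_open_subtopology[OF U(1)] by blast
    then show "\<exists>T. openin X T \<and> x \<in> T \<and> T \<subseteq> {x \<in> topspace X. f x \<in> W}"
      using U x by (intro exI[of _ "{x \<in> topspace (subtopology X U). f x \<in> W}"]) auto
  qed
qed

lemma openin_sub_preimage:
  assumes "openin X U" "continuous_map (subtopology X U) Y f" "openin Y W"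
  shows "openin X (U \<inter> f -` W)"
proof -
  have "openin (subtopology X U) {x \<in> topspace (subtopology X U). f x \<in> W}"
    by (rule openin_continuous_map_preimage[OF assms(2,3)])
  moreover have "{x \<in> topspace (subtopology X U). f x \<in> W} = U \<inter> f -` W"
    using openin_subset[OF assms(1)] by auto
  ultimately show ?thesis using openin_open_subtopology[OF assms(1)] by simp
qed

text \<open>The conditions of \<open>smooth_manifold\<close> on single charts, without separation,
  countability and smoothness of transition maps. For \<open>real_line\<close> and for products only
  these are established.\<close>

definition charted :: "'a manifold \<Rightarrow> bool" where
  "charted M \<longleftrightarrow> (\<Union>(U, \<phi>)\<in>charts M. U) = mspace M \<and>
     (\<forall>(U, \<phi>)\<in>charts M.
        openin (mtop M) U \<and> opn (mdim M) (\<phi> ` U) \<and>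
        homeomorphic_map (subtopology (mtop M) U) (subtopology (Euclidean_space (mdim M)) (\<phi> ` U)) \<phi>)"

lemma smooth_manifold_charted: "smooth_manifold M \<Longrightarrow> charted M"
  unfolding smooth_manifold_def charted_def by blast

lemma chart_open: "charted M \<Longrightarrow> (U, \<phi>) \<in> charts M \<Longrightarrow> openin (mtop M) U"
  and chart_image_open: "charted M \<Longrightarrow> (U, \<phi>) \<in> charts M \<Longrightarrow> opn (mdim M) (\<phi> ` U)"
  and chart_homeo: "charted M \<Longrightarrow> (U, \<phi>) \<in> charts M \<Longrightarrow>
    homeomorphic_map (subtopology (mtop M) U) (subtopology (Euclidean_space (mdim M)) (\<phi> ` U)) \<phi>"
  unfolding charted_def by blast+

lemma chart_exists: "charted M \<Longrightarrow> p \<in> mspace M \<Longrightarrow> \<exists>U \<phi>. (U, \<phi>) \<in> charts M \<and> p \<in> U"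
  unfolding charted_def by blast

lemma chart_topspace: "charted M \<Longrightarrow> (U, \<phi>) \<in> charts M \<Longrightarrow> topspace (subtopology (mtop M) U) = U"
  using openin_subset[OF chart_open] by (metis topspace_subtopology_subset)

lemma chart_inj: "charted M \<Longrightarrow> (U, \<phi>) \<in> charts M \<Longrightarrow> inj_on \<phi> U"
  using homeomorphic_imp_injective_map[OF chart_homeo] chart_topspace by metis

lemma chart_inv: "charted M \<Longrightarrow> (U, \<phi>) \<in> charts M \<Longrightarrow> p \<in> U \<Longrightarrow> inv_into U \<phi> (\<phi> p) = p"
  using chart_inj inv_into_f_f by metis

lemma chart_Rn: "charted M \<Longrightarrow> (U, \<phi>) \<in> charts M \<Longrightarrow> p \<in> U \<Longrightarrow> \<phi> p \<in> Rn (mdim M)"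
  using opn_subset[OF chart_image_open] by blast

lemma chart_cont:
  assumes "charted M" "(U, \<phi>) \<in> charts M"
  shows "continuous_map (subtopology (mtop M) U) (Euclidean_space (mdim M)) \<phi>"
  using homeomorphic_imp_continuous_map[OF chart_homeo[OF assms]] by (simp add: continuous_map_in_subtopology)

lemma chart_inv_cont:
  assumes M: "charted M" "(U, \<phi>) \<in> charts M"
  shows "continuous_map (subtopology (Euclidean_space (mdim M)) (\<phi> ` U)) (mtop M) (inv_into U \<phi>)"
proof -
  obtain g where g: "homeomorphic_maps (subtopology (mtop M) U) (subtopology (Euclidean_space (mdim M)) (\<phi> ` U)) \<phi> g"
    using chart_homeo[OF M] homeomorphic_map_maps by blast
  have gc: "continuous_map (subtopology (Euclidean_space (mdim M)) (\<phi> ` U)) (mtop M) g"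
    using g by (simp add: homeomorphic_maps_def continuous_map_in_subtopology)
  have "g y = inv_into U \<phi> y" if "y \<in> \<phi> ` U" for y
    using that g chart_inv[OF M] chart_topspace[OF M] by (auto simp: homeomorphic_maps_def)
  then show ?thesis
    by (intro continuous_map_eq[OF gc]) auto
qed

section \<open>Plots and smooth maps\<close>

abbreviation plot :: "'a manifold \<Rightarrow> nat \<Rightarrow> rvec set \<Rightarrow> (rvec \<Rightarrow> 'a) \<Rightarrow> bool" where
  "plot M \<equiv> manifold_diffeology M"

text \<open>The only chart of \<open>euclidean_open n U\<close> is the identity, so the inverse
  chart in \<open>smooth_map\<close> disappears on \<open>U\<close>.\<close>

lemma plot_iff:
  assumes M: "charted M"
  shows "plot M n U P \<longleftrightarrow> opn n U \<and> continuous_map (subtopology (Euclidean_space n) U) (mtop M) P \<and>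
    (\<forall>V \<psi> i. (V, \<psi>) \<in> charts M \<and> i < mdim M \<longrightarrow> Cinf_on n (U \<inter> P -` V) (\<lambda>x. \<psi> (P x) i))"
proof -
  have "Cinf_on n (U \<inter> P -` V) (\<lambda>x. \<psi> (P (inv_into U (\<lambda>x. x) x)) i) \<longleftrightarrow> Cinf_on n (U \<inter> P -` V) (\<lambda>x. \<psi> (P x) i)"
    if "opn n U" "continuous_map (subtopology (Euclidean_space n) U) (mtop M) P" "(V, \<psi>) \<in> charts M" for V \<psi> i
    by (rule Cinf_on_cong[OF openin_sub_preimage[OF that(1,2) chart_open[OF M that(3)]]])
       (use inv_into_f_f[of "\<lambda>x. x" U] in auto)
  then show ?thesis
    by (auto simp: manifold_diffeology_def smooth_map_def euclidean_open_def)
qed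

lemma plot_opn: "plot M n U P \<Longrightarrow> opn n U"
  by (simp add: manifold_diffeology_def)

lemma plot_cont: "plot M n U P \<Longrightarrow> continuous_map (subtopology (Euclidean_space n) U) (mtop M) P"
  by (simp add: manifold_diffeology_def smooth_map_def euclidean_open_def)

lemma plot_in: "plot M n U P \<Longrightarrow> u \<in> U \<Longrightarrow> P u \<in> mspace M"
  using plot_cont[of M n U P] topspace_sub[OF opn_subset[OF plot_opn[of M n U P]]]
  by (auto simp: continuous_map_def Pi_iff)

lemma plot_preimage: "plot M n U P \<Longrightarrow> openin (mtop M) W \<Longrightarrow> opn n (U \<inter> P -` W)"
  by (rule openin_sub_preimage[OF plot_opn plot_cont])

lemma plot_coord:
  assumes "charted M" "plot M n U P" "(V, \<psi>) \<in> charts M" "i < mdim M" "W \<subseteq> U" "P ` W \<subseteq> V"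
  shows "Cinf_on n W (\<lambda>x. \<psi> (P x) i)"
proof -
  have "Cinf_on n (U \<inter> P -` V) (\<lambda>x. \<psi> (P x) i)" using plot_iff assms by blast
  then show ?thesis by (rule Cinf_on_subset) (use assms in blast)
qed

lemma plot_restrict:
  assumes M: "charted M" and P: "plot M n U P" and V: "opn n V" "V \<subseteq> U"
  shows "plot M n V P"
  unfolding plot_iff[OF M]
proof (intro conjI allI impI)
  show "continuous_map (subtopology (Euclidean_space n) V) (mtop M) P"
    by (rule continuous_map_from_subtopology_mono[OF plot_cont[OF P] V(2)])
  fix W \<psi> i assume W: "(W, \<psi>) \<in> charts M \<and> i < mdim M"
  show "Cinf_on n (V \<inter> P -` W) (\<lambda>x. \<psi> (P x) i)"
    by (rule plot_coord[OF M P, of W]) (use W V in auto)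
qed (rule V)

lemma plot_cong:
  assumes M: "charted M" and P: "plot M n U P" and eq: "\<And>x. x \<in> U \<Longrightarrow> P x = Q x"
  shows "plot M n U Q"
  unfolding plot_iff[OF M]
proof (intro conjI allI impI)
  show U: "opn n U" by (rule plot_opn[OF P])
  show "continuous_map (subtopology (Euclidean_space n) U) (mtop M) Q"
    by (rule continuous_map_eq[OF plot_cont[OF P]]) (use eq in auto)
  fix W \<psi> i assume W: "(W, \<psi>) \<in> charts M \<and> i < mdim M"
  have e: "U \<inter> P -` W = U \<inter> Q -` W" using eq by auto
  have o: "opn n (U \<inter> P -` W)" using plot_preimage[OF P] chart_open[OF M] W by blast
  have "Cinf_on n (U \<inter> P -` W) (\<lambda>x. \<psi> (P x) i)" using P W plot_iff[OF M] by blast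
  then have "Cinf_on n (U \<inter> P -` W) (\<lambda>x. \<psi> (Q x) i)"
    using Cinf_on_cong[OF o, of "\<lambda>x. \<psi> (P x) i" "\<lambda>x. \<psi> (Q x) i"] eq by auto
  then show "Cinf_on n (U \<inter> Q -` W) (\<lambda>x. \<psi> (Q x) i)" by (simp add: e)
qed

lemma plot_local:
  assumes M: "charted M" and U: "opn n U"
    and loc: "\<And>u. u \<in> U \<Longrightarrow> \<exists>V. u \<in> V \<and> plot M n V P"
  shows "plot M n U P"
  unfolding plot_iff[OF M]
proof (intro conjI allI impI)
  have loc': "\<exists>V. u \<in> V \<and> V \<subseteq> U \<and> plot M n V P" if u: "u \<in> U" for u
  proof -
    obtain V where V: "u \<in> V" "plot M n V P" using loc[OF u] by blast
    then show ?thesis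
      using u plot_restrict[OF M V(2), of "V \<inter> U"] U plot_opn[OF V(2)] openin_Int by (intro exI[of _ "V \<inter> U"]) auto
  qed
  show c: "continuous_map (subtopology (Euclidean_space n) U) (mtop M) P"
  proof (rule continuous_map_local)
    fix u assume "u \<in> topspace (subtopology (Euclidean_space n) U)"
    then obtain V where V: "u \<in> V" "V \<subseteq> U" "plot M n V P" using loc' by auto
    have "openin (subtopology (Euclidean_space n) U) V"
      using openin_open_subtopology[OF U] V plot_opn by blast
    moreover have "subtopology (subtopology (Euclidean_space n) U) V = subtopology (Euclidean_space n) V"
      using V(2) by (simp add: subtopology_subtopology Int_absorb1)
    ultimately show "\<exists>W. openin (subtopology (Euclidean_space n) U) W \<and> u \<in> W \<and>
        continuous_map (subtopology (subtopology (Euclidean_space n) U) W) (mtop M) P"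
      using V plot_cont by metis
  qed
  fix W \<psi> i assume W: "(W, \<psi>) \<in> charts M \<and> i < mdim M"
  show "Cinf_on n (U \<inter> P -` W) (\<lambda>x. \<psi> (P x) i)"
  proof (rule Cinf_on_local)
    show o: "opn n (U \<inter> P -` W)" using openin_sub_preimage[OF U c] chart_open[OF M] W by blast
    fix u assume u: "u \<in> U \<inter> P -` W"
    then obtain V where V: "u \<in> V" "V \<subseteq> U" "plot M n V P" using loc' by blast
    have "opn n (V \<inter> P -` W)" using plot_preimage[OF V(3)] chart_open[OF M] W by blast
    moreover have "Cinf_on n (V \<inter> P -` W) (\<lambda>x. \<psi> (P x) i)"
      by (rule plot_coord[OF M V(3), of W]) (use W in auto)
    ultimately show "\<exists>V. opn n V \<and> u \<in> V \<and> Cinf_on n V (\<lambda>x. \<psi> (P x) i)"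
      using u V(1) by blast
  qed
qed (rule U)

lemma Cinf_continuous_map:
  assumes V: "opn m V" and U: "opn n U" and hU: "\<And>x. x \<in> V \<Longrightarrow> h x \<in> U"
    and h: "\<And>i. i < n \<Longrightarrow> Cinf_on m V (\<lambda>x. h x i)"
  shows "continuous_map (subtopology (Euclidean_space m) V) (subtopology (Euclidean_space n) U) h"
proof -
  have "continuous_map (subtopology (Euclidean_space m) V) (Euclidean_space n) (\<lambda>x i. if i < n then h x i else 0)"
    using h Cinf_on_cont by (simp add: continuous_map_componentwise_Euclidean_space)
  moreover have "(\<lambda>i. if i < n then h x i else 0) = h x" if "x \<in> V" for x
    using hU[OF that] opn_subset[OF U] by (auto simp: Rn_iff subset_iff)
  ultimately have "continuous_map (subtopology (Euclidean_space m) V) (Euclidean_space n) h"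
    by (elim continuous_map_eq) auto
  then show ?thesis using hU by (auto simp: continuous_map_in_subtopology)
qed

lemma plot_compose:
  assumes M: "charted M" and P: "plot M n U P" and V: "opn m V" and hU: "\<And>x. x \<in> V \<Longrightarrow> h x \<in> U"
    and h: "\<And>i. i < n \<Longrightarrow> Cinf_on m V (\<lambda>x. h x i)"
  shows "plot M m V (\<lambda>x. P (h x))"
  unfolding plot_iff[OF M]
proof (intro conjI allI impI)
  have hc: "continuous_map (subtopology (Euclidean_space m) V) (subtopology (Euclidean_space n) U) h"
    by (rule Cinf_continuous_map[OF V plot_opn[OF P] hU h])
  show c: "continuous_map (subtopology (Euclidean_space m) V) (mtop M) (\<lambda>x. P (h x))"
    using continuous_map_compose[OF hc plot_cont[OF P]] by (simp add: o_def)
  fix W \<psi> i assume W: "(W, \<psi>) \<in> charts M \<and> i < mdim M"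
  then have Wo: "openin (mtop M) W" using chart_open[OF M] by blast
  show "Cinf_on m (V \<inter> (\<lambda>x. P (h x)) -` W) (\<lambda>x. \<psi> (P (h x)) i)"
  proof (rule Cinf_on_compose[where U = "U \<inter> P -` W" and n=n and f="\<lambda>y. \<psi> (P y) i"])
    show "opn m (V \<inter> (\<lambda>x. P (h x)) -` W)" by (rule openin_sub_preimage[OF V c Wo])
    show "opn n (U \<inter> P -` W)" by (rule plot_preimage[OF P Wo])
    show "Cinf_on n (U \<inter> P -` W) (\<lambda>y. \<psi> (P y) i)" using P W plot_iff[OF M] by blast
    fix i assume "i < n" then show "Cinf_on m (V \<inter> (\<lambda>x. P (h x)) -` W) (\<lambda>x. h x i)"
      using Cinf_on_subset[OF h] by blast
  qed (use hU in auto)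
qed (rule V)

text \<open>This is where the smoothness of the transition maps enters. Most plots below are built
  from inverse charts by composition.\<close>

lemma plot_chart_inv:
  assumes M: "smooth_manifold M" and c: "(V, \<psi>) \<in> charts M"
  shows "plot M (mdim M) (\<psi> ` V) (inv_into V \<psi>)"
proof -
  note M' = smooth_manifold_charted[OF M]
  show ?thesis
    unfolding plot_iff[OF M']
  proof (intro conjI allI impI)
    show "opn (mdim M) (\<psi> ` V)" by (rule chart_image_open[OF M' c])
    show "continuous_map (subtopology (Euclidean_space (mdim M)) (\<psi> ` V)) (mtop M) (inv_into V \<psi>)"
      by (rule chart_inv_cont[OF M' c])
    fix W \<kappa> i assume W: "(W, \<kappa>) \<in> charts M \<and> i < mdim M"
    have e: "\<psi> ` V \<inter> inv_into V \<psi> -` W = \<psi> ` (V \<inter> W)"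
      using chart_inv[OF M' c] by (auto 4 3)
    have "Cinf_on (mdim M) (\<psi> ` (V \<inter> W)) (\<lambda>x. \<kappa> (inv_into V \<psi> x) i)"
      using M c W unfolding smooth_manifold_def by blast
    then show "Cinf_on (mdim M) (\<psi> ` V \<inter> inv_into V \<psi> -` W) (\<lambda>x. \<kappa> (inv_into V \<psi> x) i)"
      by (simp only: e)
  qed
qed

lemma plot_of_chart:
  assumes M: "smooth_manifold M" and c: "(V, \<psi>) \<in> charts M" and W: "opn m W"
    and "\<And>x. x \<in> W \<Longrightarrow> h x \<in> \<psi> ` V" "\<And>i. i < mdim M \<Longrightarrow> Cinf_on m W (\<lambda>x. h x i)"
  shows "plot M m W (\<lambda>x. inv_into V \<psi> (h x))"
  by (rule plot_compose[OF smooth_manifold_charted[OF M] plot_chart_inv[OF M c] W]) (use assms in auto)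

text \<open>Near each point \<open>P\<close> runs in one chart of \<open>M\<close>, and there
  \<open>f \<circ> P\<close> is the coordinate expression of \<open>f\<close> composed with that of
  \<open>P\<close>.\<close>

lemma smooth_map_plot:
  assumes M: "charted M" and N: "charted N" and f: "smooth_map M N f" and P: "plot M n U P"
  shows "plot N n U (\<lambda>x. f (P x))"
  unfolding plot_iff[OF N]
proof (intro conjI allI impI)
  have fc: "continuous_map (mtop M) (mtop N) f" using f by (simp add: smooth_map_def)
  show U: "opn n U" by (rule plot_opn[OF P])
  show c: "continuous_map (subtopology (Euclidean_space n) U) (mtop N) (\<lambda>x. f (P x))"
    using continuous_map_compose[OF plot_cont[OF P] fc] by (simp add: o_def)
  fix B \<psi> i assume B: "(B, \<psi>) \<in> charts N \<and> i < mdim N"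
  then have Bo: "openin (mtop N) B" using chart_open[OF N] by blast
  show "Cinf_on n (U \<inter> (\<lambda>x. f (P x)) -` B) (\<lambda>x. \<psi> (f (P x)) i)"
  proof (rule Cinf_on_local)
    show oS: "opn n (U \<inter> (\<lambda>x. f (P x)) -` B)" by (rule openin_sub_preimage[OF U c Bo])
    fix u assume u: "u \<in> U \<inter> (\<lambda>x. f (P x)) -` B"
    then obtain A \<phi> where A: "(A, \<phi>) \<in> charts M" "P u \<in> A" using chart_exists[OF M] plot_in[OF P] by blast
    define T where "T = (U \<inter> P -` A) \<inter> (U \<inter> (\<lambda>x. f (P x)) -` B)"
    have T: "opn n T" unfolding T_def
      by (intro openin_Int oS plot_preimage[OF P] chart_open[OF M A(1)])
    have O: "opn (mdim M) (\<phi> ` (A \<inter> f -` B))"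
    proof -
      have "continuous_map (subtopology (Euclidean_space (mdim M)) (\<phi> ` A)) (mtop N) (\<lambda>y. f (inv_into A \<phi> y))"
        using continuous_map_compose[OF chart_inv_cont[OF M A(1)] fc] by (simp add: o_def)
      from openin_sub_preimage[OF chart_image_open[OF M A(1)] this Bo]
      have "opn (mdim M) (\<phi> ` A \<inter> (\<lambda>y. f (inv_into A \<phi> y)) -` B)" .
      moreover have "\<phi> ` A \<inter> (\<lambda>y. f (inv_into A \<phi> y)) -` B = \<phi> ` (A \<inter> f -` B)"
        using chart_inv[OF M A(1)] by auto
      ultimately show ?thesis by simp
    qed
    have "Cinf_on n T (\<lambda>x. \<psi> (f (inv_into A \<phi> (\<phi> (P x)))) i)"
    proof (rule Cinf_on_compose[OF T O, where h="\<lambda>x. \<phi> (P x)" and f="\<lambda>y. \<psi> (f (inv_into A \<phi> y)) i"])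
      show "Cinf_on n T (\<lambda>x. \<phi> (P x) i)" if "i < mdim M" for i
        by (rule plot_coord[OF M P A(1) that]) (auto simp: T_def)
      show "Cinf_on (mdim M) (\<phi> ` (A \<inter> f -` B)) (\<lambda>y. \<psi> (f (inv_into A \<phi> y)) i)"
        using f A(1) B unfolding smooth_map_def by blast
    qed (auto simp: T_def)
    moreover have "\<psi> (f (inv_into A \<phi> (\<phi> (P x)))) i = \<psi> (f (P x)) i" if "x \<in> T" for x
      using that chart_inv[OF M A(1)] by (auto simp: T_def)
    ultimately have "Cinf_on n T (\<lambda>x. \<psi> (f (P x)) i)"
      using Cinf_on_cong[OF T, of "\<lambda>x. \<psi> (f (inv_into A \<phi> (\<phi> (P x)))) i" "\<lambda>x. \<psi> (f (P x)) i"] by blast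
    then show "\<exists>V. opn n V \<and> u \<in> V \<and> Cinf_on n V (\<lambda>x. \<psi> (f (P x)) i)"
      using T u A(2) by (intro exI[of _ T]) (auto simp: T_def)
  qed
qed

lemma smooth_map_of_plots:
  assumes M: "charted M" and N: "charted N"
    and f: "\<And>V \<psi>. (V, \<psi>) \<in> charts M \<Longrightarrow> plot N (mdim M) (\<psi> ` V) (\<lambda>y. f (inv_into V \<psi> y))"
  shows "smooth_map M N f"
proof -
  have c: "continuous_map (mtop M) (mtop N) f"
  proof (rule continuous_map_local)
    fix x assume "x \<in> mspace M"
    then obtain V \<psi> where V: "(V, \<psi>) \<in> charts M" "x \<in> V" using chart_exists[OF M] by blast
    have "continuous_map (subtopology (mtop M) V) (subtopology (Euclidean_space (mdim M)) (\<psi> ` V)) \<psi>"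
      by (rule homeomorphic_imp_continuous_map[OF chart_homeo[OF M V(1)]])
    from continuous_map_compose[OF this plot_cont[OF f[OF V(1)]]]
    have "continuous_map (subtopology (mtop M) V) (mtop N) f"
      by (rule continuous_map_eq) (use chart_inv[OF M V(1)] in auto)
    then show "\<exists>U. openin (mtop M) U \<and> x \<in> U \<and> continuous_map (subtopology (mtop M) U) (mtop N) f"
      using V chart_open[OF M] by blast
  qed
  have "Cinf_on (mdim M) (\<phi> ` (U \<inter> f -` V)) (\<lambda>x. \<psi> (f (inv_into U \<phi> x)) i)"
    if "(U, \<phi>) \<in> charts M" "(V, \<psi>) \<in> charts N" "i < mdim N" for U \<phi> V \<psi> i
    by (rule plot_coord[OF N f[OF that(1)] that(2,3)]) (use chart_inv[OF M that(1)] in auto)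
  then show ?thesis using c unfolding smooth_map_def by blast
qed

section \<open>Real-valued smooth functions and tangent vectors of plots\<close>

lemma Rn1_range: "range (\<lambda>t i. if i = 0 then t else (0::real)) = Rn 1"
proof safe
  fix x :: rvec assume "x \<in> Rn 1"
  then have "x = (\<lambda>i. if i = 0 then x 0 else 0)" by (auto simp: Rn_iff)
  then show "x \<in> range (\<lambda>t i. if i = 0 then t else 0)" by blast
qed (auto simp: Rn_iff)

lemma charted_real_line: "charted real_line"
proof -
  have h: "homeomorphic_map euclideanreal (Euclidean_space 1) (\<lambda>t i. if i = 0 then t else 0)"
  proof (rule homeomorphic_maps_map[THEN iffD1, THEN conjunct1])
    have "continuous_map euclideanreal (Euclidean_space 1) (\<lambda>t i. if i < 1 then t else 0)"
      unfolding continuous_map_componentwise_Euclidean_space by simp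
    moreover have "(\<lambda>t i. if i < 1 then t else 0) = (\<lambda>(t::real) (i::nat). if i = 0 then t else 0)"
      by (auto simp: fun_eq_iff)
    ultimately have "continuous_map euclideanreal (Euclidean_space 1) (\<lambda>t i. if i = 0 then t else 0)" by simp
    moreover have "continuous_map (Euclidean_space 1) euclideanreal (\<lambda>x. x 0)"
      using cont_coord[of 1 UNIV 0] by simp
    ultimately show "homeomorphic_maps euclideanreal (Euclidean_space 1) (\<lambda>t i. if i = 0 then t else 0) (\<lambda>x. x 0)"
      by (auto simp: homeomorphic_maps_def Rn_iff fun_eq_iff)
  qed
  have "opn 1 (range (\<lambda>t i. if i = 0 then t else (0::real)))"
    unfolding Rn1_range by simp
  moreover have "subtopology (Euclidean_space 1) (range (\<lambda>t i. if i = 0 then t else (0::real))) = Euclidean_space 1"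
    unfolding Rn1_range by simp
  ultimately show ?thesis using h by (simp add: charted_def real_line_def)
qed

lemma plot_real_line: "plot real_line n U f \<longleftrightarrow> opn n U \<and> Cinf_on n U f"
  using Cinf_on_cont by (auto simp: plot_iff[OF charted_real_line]) (auto simp: real_line_def)

lemma smooth_fun_plot:
  assumes "charted M" "f \<in> smooth_fun M" "plot M n U P"
  shows "Cinf_on n U (\<lambda>x. f (P x))"
  using smooth_map_plot[OF assms(1) charted_real_line _ assms(3), of f] assms(2)
  by (simp add: smooth_fun_def plot_real_line)

lemma smooth_funI:
  assumes "charted M" "\<And>V \<psi>. (V, \<psi>) \<in> charts M \<Longrightarrow> Cinf_on (mdim M) (\<psi> ` V) (\<lambda>y. f (inv_into V \<psi> y))"
  shows "f \<in> smooth_fun M"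
  using smooth_map_of_plots[OF assms(1) charted_real_line, of f] assms chart_image_open[OF assms(1)]
  by (simp add: smooth_fun_def plot_real_line)

lemma smooth_fun_chart:
  assumes "smooth_manifold M" "f \<in> smooth_fun M" "(V, \<psi>) \<in> charts M"
  shows "Cinf_on (mdim M) (\<psi> ` V) (\<lambda>y. f (inv_into V \<psi> y))"
  by (rule smooth_fun_plot[OF smooth_manifold_charted[OF assms(1)] assms(2) plot_chart_inv[OF assms(1,3)]])

lemma smooth_fun_lin:
  assumes M: "smooth_manifold M" and f: "f \<in> smooth_fun M" "g \<in> smooth_fun M"
  shows "(\<lambda>x. a * f x + b * g x) \<in> smooth_fun M"
proof (rule smooth_funI[OF smooth_manifold_charted[OF M]])
  fix V \<psi> assume V: "(V, \<psi>) \<in> charts M"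
  note o = chart_image_open[OF smooth_manifold_charted[OF M] V]
  show "Cinf_on (mdim M) (\<psi> ` V) (\<lambda>y. a * f (inv_into V \<psi> y) + b * g (inv_into V \<psi> y))"
    by (intro Cinf_on_add Cinf_on_mult Cinf_on_const o smooth_fun_chart[OF M f(1) V] smooth_fun_chart[OF M f(2) V])
qed

lemma smooth_fun_mult:
  assumes M: "smooth_manifold M" and f: "f \<in> smooth_fun M" "g \<in> smooth_fun M"
  shows "(\<lambda>x. f x * g x) \<in> smooth_fun M"
proof (rule smooth_funI[OF smooth_manifold_charted[OF M]])
  fix V \<psi> assume V: "(V, \<psi>) \<in> charts M"
  note o = chart_image_open[OF smooth_manifold_charted[OF M] V]
  show "Cinf_on (mdim M) (\<psi> ` V) (\<lambda>y. f (inv_into V \<psi> y) * g (inv_into V \<psi> y))"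
    by (intro Cinf_on_mult o smooth_fun_chart[OF M f(1) V] smooth_fun_chart[OF M f(2) V])
qed

lemma smooth_fun_compose:
  assumes M: "smooth_manifold M" and N: "charted N" and f: "smooth_map M N f" and g: "g \<in> smooth_fun N"
  shows "(\<lambda>x. g (f x)) \<in> smooth_fun M"
proof (rule smooth_funI[OF smooth_manifold_charted[OF M]])
  fix V \<psi> assume V: "(V, \<psi>) \<in> charts M"
  show "Cinf_on (mdim M) (\<psi> ` V) (\<lambda>y. g (f (inv_into V \<psi> y)))"
    by (rule smooth_fun_plot[OF N g smooth_map_plot[OF smooth_manifold_charted[OF M] N f plot_chart_inv[OF M V]]])
qed

lemma dir_deriv_lin:
  assumes "Cinf_on n U f" "Cinf_on n U g" "u \<in> U"
  shows "dir_deriv n (\<lambda>x. a * f x + b * g x) u v = a * dir_deriv n f u v + b * dir_deriv n g u v"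
proof -
  have "pd i (\<lambda>x. a * f x + b * g x) u = a * pd i f u + b * pd i g u" if "i < n" for i
    unfolding pd_def[of i "\<lambda>x. a * f x + b * g x"]
    by (rule DERIV_imp_deriv)
       (intro DERIV_add DERIV_cmult Cinf_on_has_pd[OF assms(1) that assms(3)] Cinf_on_has_pd[OF assms(2) that assms(3)])
  then show ?thesis
    by (simp add: dir_deriv_def sum_distrib_left distrib_left sum.distrib mult.left_commute)
qed

lemma dir_deriv_mult:
  assumes "Cinf_on n U f" "Cinf_on n U g" "u \<in> U"
  shows "dir_deriv n (\<lambda>x. f x * g x) u v = f u * dir_deriv n g u v + g u * dir_deriv n f u v"
proof -
  have "pd i (\<lambda>x. f x * g x) u = pd i f u * g u + pd i g u * f u" if "i < n" for i
    unfolding pd_def[of i "\<lambda>x. f x * g x"]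
    using DERIV_mult[OF Cinf_on_has_pd[OF assms(1) that assms(3)] Cinf_on_has_pd[OF assms(2) that assms(3)]]
    by (intro DERIV_imp_deriv) simp
  then show ?thesis
    by (simp add: dir_deriv_def sum_distrib_left distrib_left sum.distrib mult_ac)
qed

lemma plot_tangent_in:
  assumes M: "smooth_manifold M" and P: "plot M n U P" and u: "u \<in> U"
  shows "plot_tangent n M P u v \<in> tangent_space M (P u)"
proof -
  note sm = smooth_fun_plot[OF smooth_manifold_charted[OF M] _ P]
  show ?thesis
    unfolding tangent_space_def plot_tangent_def mem_Collect_eq
    using dir_deriv_lin[OF sm sm u] dir_deriv_mult[OF sm sm u] smooth_fun_lin[OF M] smooth_fun_mult[OF M]
    by simp
qed

lemma plot_tangent_compose:
  assumes M: "charted M" and P: "plot M n U P" and V: "opn m V" and hU: "\<And>x. x \<in> V \<Longrightarrow> h x \<in> U"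
    and h: "\<And>i. i < n \<Longrightarrow> Cinf_on m V (\<lambda>x. h x i)" and x: "x \<in> V"
  shows "plot_tangent m M (\<lambda>x. P (h x)) x v = plot_tangent n M P (h x) (jacobian m n h x v)"
  unfolding plot_tangent_def fun_eq_iff
  using dir_deriv_compose[OF V plot_opn[OF P] hU h smooth_fun_plot[OF M _ P] x] by simp

lemma plot_tangent_cong:
  assumes "opn n U" "u \<in> U" "\<And>x. x \<in> U \<Longrightarrow> P x = Q x"
  shows "plot_tangent n M P u v = plot_tangent n M Q u v"
proof -
  have "dir_deriv n (\<lambda>y. f (P y)) u v = dir_deriv n (\<lambda>y. f (Q y)) u v" for f :: "'a \<Rightarrow> real"
    by (rule dir_deriv_cong[OF assms(1,2)]) (simp add: assms(3))
  then show ?thesis by (simp add: plot_tangent_def fun_eq_iff)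
qed

lemma plot_tangent_lin:
  "plot_tangent n M P u (\<lambda>j. a * v j + b * w j) = (\<lambda>f. a * plot_tangent n M P u v f + b * plot_tangent n M P u w f)"
  by (simp add: plot_tangent_def dir_deriv_def fun_eq_iff distrib_right sum.distrib sum_distrib_left mult.assoc)

lemma tangent_map_plot:
  assumes M: "smooth_manifold M" and N: "charted N" and f: "smooth_map M N f"
  shows "tangent_map N f (plot_tangent n M P u v) = plot_tangent n N (\<lambda>x. f (P x)) u v"
  unfolding tangent_map_def plot_tangent_def fun_eq_iff
  using smooth_fun_compose[OF M N f] by simp

section \<open>Products of manifolds; \<open>cat\<close>, \<open>lo\<close>, \<open>hi\<close> are
  pairing and projections in the product charts\<close>

definition cat :: "nat \<Rightarrow> rvec \<Rightarrow> rvec \<Rightarrow> rvec" where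
  "cat m x y = (\<lambda>i. if i < m then x i else y (i - m))"

definition lo :: "nat \<Rightarrow> rvec \<Rightarrow> rvec" where
  "lo m y = (\<lambda>i. if i < m then y i else 0)"

definition hi :: "nat \<Rightarrow> nat \<Rightarrow> rvec \<Rightarrow> rvec" where
  "hi m n y = (\<lambda>i. if i < n then y (i + m) else 0)"

lemma lo_Rn [simp]: "lo m y \<in> Rn m" and hi_Rn [simp]: "hi m n y \<in> Rn n"
  by (auto simp: lo_def hi_def Rn_iff)

lemma lo_cat: "x \<in> Rn m \<Longrightarrow> lo m (cat m x y) = x"
  by (auto simp: lo_def cat_def Rn_iff)

lemma hi_cat: "y \<in> Rn n \<Longrightarrow> hi m n (cat m x y) = y"
  by (auto simp: hi_def cat_def Rn_iff)

lemma cat_lo_hi: "z \<in> Rn (m + n) \<Longrightarrow> cat m (lo m z) (hi m n z) = z"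
  by (auto simp: lo_def hi_def cat_def Rn_iff)

lemma cat_Rn: "y \<in> Rn n \<Longrightarrow> cat m x y \<in> Rn (m + n)"
  by (auto simp: cat_def Rn_iff)

lemma continuous_map_Rn_coord: "continuous_map (Euclidean_space k) euclideanreal (\<lambda>x. x i)"
  using cont_coord[of k UNIV i] by simp

lemma continuous_map_lo: "continuous_map (Euclidean_space k) (Euclidean_space m) (lo m)"
  unfolding lo_def continuous_map_componentwise_Euclidean_space by (simp add: continuous_map_Rn_coord)

lemma continuous_map_hi: "continuous_map (Euclidean_space k) (Euclidean_space n) (hi m n)"
  unfolding hi_def
  using continuous_map_componentwise_Euclidean_space[of "Euclidean_space k" n "\<lambda>y i. y (i + m)"]
  by (simp add: continuous_map_Rn_coord)

lemma charted_prod: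
  assumes M: "charted M" and N: "charted N"
  shows "charted (prod_manifold M N)"
  unfolding charted_def
proof
  have "(\<Union>(U, \<phi>)\<in>charts (prod_manifold M N). U) = (\<Union>(U, \<phi>)\<in>charts M. U) \<times> (\<Union>(U, \<phi>)\<in>charts N. U)"
    by (auto simp: prod_manifold_def) blast
  also have "\<dots> = mspace (prod_manifold M N)"
    using M N by (simp add: charted_def prod_manifold_def)
  finally show "(\<Union>(U, \<phi>)\<in>charts (prod_manifold M N). U) = mspace (prod_manifold M N)" .
next
  let ?m = "mdim M" and ?n = "mdim N"
  show "\<forall>(U, \<phi>)\<in>charts (prod_manifold M N).
       openin (mtop (prod_manifold M N)) U \<and> opn (mdim (prod_manifold M N)) (\<phi> ` U) \<and>
       homeomorphic_map (subtopology (mtop (prod_manifold M N)) U)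
        (subtopology (Euclidean_space (mdim (prod_manifold M N))) (\<phi> ` U)) \<phi>"
  proof safe
    fix W \<kappa> assume "(W, \<kappa>) \<in> charts (prod_manifold M N)"
    then obtain U \<phi> V \<psi> where U: "(U, \<phi>) \<in> charts M" and V: "(V, \<psi>) \<in> charts N"
      and W: "W = U \<times> V" and \<kappa>: "\<kappa> = (\<lambda>(x, y). cat ?m (\<phi> x) (\<psi> y))"
      unfolding prod_manifold_def cat_def by auto
    show Wo: "openin (mtop (prod_manifold M N)) W"
      using chart_open[OF M U] chart_open[OF N V] by (simp add: W prod_manifold_def openin_prod_Times_iff)
    \<comment> \<open>As an intersection of preimages under the two projections, the image is
      visibly open, and the inverse is continuous on it.\<close>
    have im: "\<kappa> ` W = (Rn (?m + ?n) \<inter> lo ?m -` (\<phi> ` U)) \<inter> (Rn (?m + ?n) \<inter> hi ?m ?n -` (\<psi> ` V))" (is "_ = ?R")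
    proof
      show "\<kappa> ` W \<subseteq> ?R"
        using chart_Rn[OF M U] chart_Rn[OF N V] by (auto simp: W \<kappa> lo_cat hi_cat cat_Rn)
      show "?R \<subseteq> \<kappa> ` W"
      proof
        fix z assume z: "z \<in> ?R"
        then obtain p q where "p \<in> U" "lo ?m z = \<phi> p" "q \<in> V" "hi ?m ?n z = \<psi> q" by auto
        then have "z = \<kappa> (p, q)" "(p, q) \<in> W" using z cat_lo_hi[of z ?m ?n] by (auto simp: \<kappa> W)
        then show "z \<in> \<kappa> ` W" by blast
      qed
    qed
    have o1: "opn (?m + ?n) (Rn (?m + ?n) \<inter> lo ?m -` (\<phi> ` U))"
      by (rule openin_sub_preimage[OF _ _ chart_image_open[OF M U]]) (simp_all add: continuous_map_lo)
    have o2: "opn (?m + ?n) (Rn (?m + ?n) \<inter> hi ?m ?n -` (\<psi> ` V))"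
      by (rule openin_sub_preimage[OF _ _ chart_image_open[OF N V]]) (simp_all add: continuous_map_hi)
    show op: "opn (mdim (prod_manifold M N)) (\<kappa> ` W)"
      unfolding im using openin_Int[OF o1 o2] by (simp add: prod_manifold_def)
    have md: "mdim (prod_manifold M N) = ?m + ?n" and mt: "mtop (prod_manifold M N) = prod_topology (mtop M) (mtop N)"
      by (simp_all add: prod_manifold_def)
    have tW: "topspace (subtopology (mtop (prod_manifold M N)) W) = W"
      using openin_subset[OF Wo] by (simp add: Int_absorb1)
    have c1: "continuous_map (subtopology (mtop (prod_manifold M N)) W) (Euclidean_space ?m) (\<lambda>p. \<phi> (fst p))"
    proof -
      have "continuous_map (subtopology (mtop (prod_manifold M N)) W) (subtopology (mtop M) U) fst"
        unfolding mt continuous_map_in_subtopology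
        by (auto simp: W intro: continuous_map_from_subtopology continuous_map_fst)
      from continuous_map_compose[OF this chart_cont[OF M U]] show ?thesis by (simp add: o_def)
    qed
    have c2: "continuous_map (subtopology (mtop (prod_manifold M N)) W) (Euclidean_space ?n) (\<lambda>p. \<psi> (snd p))"
    proof -
      have "continuous_map (subtopology (mtop (prod_manifold M N)) W) (subtopology (mtop N) V) snd"
        unfolding mt continuous_map_in_subtopology
        by (auto simp: W intro: continuous_map_from_subtopology continuous_map_snd)
      from continuous_map_compose[OF this chart_cont[OF N V]] show ?thesis by (simp add: o_def)
    qed
    have "continuous_map (subtopology (mtop (prod_manifold M N)) W) (Euclidean_space (?m + ?n))
        (\<lambda>p i. if i < ?m + ?n then cat ?m (\<phi> (fst p)) (\<psi> (snd p)) i else 0)"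
      unfolding continuous_map_componentwise_Euclidean_space
    proof (intro allI impI)
      fix i assume "i < ?m + ?n"
      show "continuous_map (subtopology (mtop (prod_manifold M N)) W) euclideanreal (\<lambda>p. cat ?m (\<phi> (fst p)) (\<psi> (snd p)) i)"
        using continuous_map_compose[OF c1 continuous_map_Rn_coord[of ?m i]]
          continuous_map_compose[OF c2 continuous_map_Rn_coord[of ?n "i - ?m"]]
        by (cases "i < ?m") (simp_all add: cat_def o_def)
    qed
    moreover have "(\<lambda>i. if i < ?m + ?n then cat ?m (\<phi> (fst p)) (\<psi> (snd p)) i else 0) = \<kappa> p" if "p \<in> W" for p
      using cat_Rn[of "\<psi> (snd p)" ?n ?m "\<phi> (fst p)"] chart_Rn[OF N V, of "snd p"] that
      by (auto simp: W \<kappa> Rn_iff)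
    ultimately have "continuous_map (subtopology (mtop (prod_manifold M N)) W) (Euclidean_space (?m + ?n)) \<kappa>"
      by (elim continuous_map_eq) (simp add: tW[unfolded topspace_subtopology])
    then have cont: "continuous_map (subtopology (mtop (prod_manifold M N)) W) (subtopology (Euclidean_space (?m + ?n)) (\<kappa> ` W)) \<kappa>"
      by (auto simp: continuous_map_in_subtopology)
    let ?g = "\<lambda>z. (inv_into U \<phi> (lo ?m z), inv_into V \<psi> (hi ?m ?n z))"
    have l: "continuous_map (subtopology (Euclidean_space (?m + ?n)) (\<kappa> ` W)) (subtopology (Euclidean_space ?m) (\<phi> ` U)) (lo ?m)"
      unfolding continuous_map_in_subtopology
      by (auto simp: im intro: continuous_map_from_subtopology continuous_map_lo)
    have h: "continuous_map (subtopology (Euclidean_space (?m + ?n)) (\<kappa> ` W)) (subtopology (Euclidean_space ?n) (\<psi> ` V)) (hi ?m ?n)"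
      unfolding continuous_map_in_subtopology
      by (auto simp: im intro: continuous_map_from_subtopology continuous_map_hi)
    have g: "continuous_map (subtopology (Euclidean_space (?m + ?n)) (\<kappa> ` W)) (mtop (prod_manifold M N)) ?g"
      unfolding mt
      by (intro continuous_map_pairedI continuous_map_compose[OF l chart_inv_cont[OF M U], unfolded o_def]
          continuous_map_compose[OF h chart_inv_cont[OF N V], unfolded o_def])
    have gl: "?g (\<kappa> p) = p" if "p \<in> W" for p
      using that chart_inv[OF M U] chart_inv[OF N V] chart_Rn[OF M U] chart_Rn[OF N V]
      by (auto simp: W \<kappa> lo_cat hi_cat)
    have "homeomorphic_maps (subtopology (mtop (prod_manifold M N)) W) (subtopology (Euclidean_space (?m + ?n)) (\<kappa> ` W)) \<kappa> ?g"
      unfolding homeomorphic_maps_def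
    proof (intro conjI ballI)
      show "continuous_map (subtopology (Euclidean_space (?m + ?n)) (\<kappa> ` W)) (subtopology (mtop (prod_manifold M N)) W) ?g"
        unfolding continuous_map_in_subtopology using g gl by auto
    qed (use cont gl tW in auto)
    then show "homeomorphic_map (subtopology (mtop (prod_manifold M N)) W)
        (subtopology (Euclidean_space (mdim (prod_manifold M N))) (\<kappa> ` W)) \<kappa>"
      unfolding md using homeomorphic_maps_map by blast
  qed
qed

lemma plot_pair:
  assumes M: "charted M" and N: "charted N" and P: "plot M n U P" and Q: "plot N n U Q"
  shows "plot (prod_manifold M N) n U (\<lambda>x. (P x, Q x))"
  unfolding plot_iff[OF charted_prod[OF M N]]
proof (intro conjI allI impI)
  show "opn n U" by (rule plot_opn[OF P])
  show "continuous_map (subtopology (Euclidean_space n) U) (mtop (prod_manifold M N)) (\<lambda>x. (P x, Q x))"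
    unfolding prod_manifold_def by (simp add: continuous_map_pairedI plot_cont[OF P] plot_cont[OF Q])
  fix W \<kappa> i assume W: "(W, \<kappa>) \<in> charts (prod_manifold M N) \<and> i < mdim (prod_manifold M N)"
  then obtain A \<phi> B \<psi> where A: "(A, \<phi>) \<in> charts M" and B: "(B, \<psi>) \<in> charts N"
      and W': "W = A \<times> B" and \<kappa>: "\<kappa> = (\<lambda>(x, y) i. if i < mdim M then \<phi> x i else \<psi> y (i - mdim M))"
    unfolding prod_manifold_def by auto
  show "Cinf_on n (U \<inter> (\<lambda>x. (P x, Q x)) -` W) (\<lambda>x. \<kappa> (P x, Q x) i)"
  proof (cases "i < mdim M")
    case True
    have "Cinf_on n (U \<inter> (\<lambda>x. (P x, Q x)) -` W) (\<lambda>x. \<phi> (P x) i)"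
      by (rule plot_coord[OF M P A True]) (auto simp: W')
    then show ?thesis using True by (simp add: \<kappa>)
  next
    case False
    then have "i - mdim M < mdim N" using W by (auto simp: prod_manifold_def)
    then have "Cinf_on n (U \<inter> (\<lambda>x. (P x, Q x)) -` W) (\<lambda>x. \<psi> (Q x) (i - mdim M))"
      by (rule plot_coord[OF N Q B]) (auto simp: W')
    then show ?thesis using False by (simp add: \<kappa>)
  qed
qed

lemma plot_smooth_map2:
  assumes "charted M" "charted N" "charted L" "smooth_map (prod_manifold M N) L (\<lambda>(x, y). f x y)"
    "plot M n U P" "plot N n U Q"
  shows "plot L n U (\<lambda>x. f (P x) (Q x))"
  using smooth_map_plot[OF charted_prod[OF assms(1,2)] assms(3,4) plot_pair[OF assms(1,2,5,6)]] by simp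

lemma plot_const:
  assumes M: "charted M" and "p \<in> mspace M" "opn n U"
  shows "plot M n U (\<lambda>_. p)"
  unfolding plot_iff[OF M]
  using assms by (auto intro!: Cinf_on_subset[OF Cinf_on_const])

section \<open>Forms and plots\<close>

definition ev :: "nat \<Rightarrow> rvec" where
  "ev i = (\<lambda>j. if j = i then 1 else 0)"

lemma ev_Rn: "i < n \<Longrightarrow> ev i \<in> Rn n"
  by (auto simp: ev_def Rn_iff)

text \<open>Induction on the number of retained coordinates: \<open>lo k v\<close> keeps the first
  \<open>k\<close> entries of \<open>v\<close>.\<close>

lemma linear_on_Rn_expand:
  assumes lin: "\<And>v w a b. v \<in> Rn n \<Longrightarrow> w \<in> Rn n \<Longrightarrow> l (\<lambda>j. a * v j + b * w j) = a * l v + b * (l w :: real)"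
    and v: "v \<in> Rn n"
  shows "l v = (\<Sum>i<n. v i * l (ev i))"
proof -
  have "l (lo k v) = (\<Sum>i<k. v i * l (ev i))" if "k \<le> n" for k
    using that
  proof (induction k)
    case 0
    \<comment> \<open>Linearity with both coefficients 0 says that \<open>l\<close> vanishes at the
      zero vector.\<close>
    have "l (\<lambda>j. 0 * v j + 0 * v j) = 0 * l v + 0 * l v" by (rule lin[OF v v])
    then show ?case by (simp add: lo_def)
  next
    case (Suc k)
    have lR: "lo k v \<in> Rn n" using Suc.prems by (auto simp: lo_def Rn_iff)
    have eR: "ev k \<in> Rn n" using Suc.prems by (auto intro: ev_Rn)
    have "lo (Suc k) v = (\<lambda>j. 1 * lo k v j + v k * ev k j)"
      by (auto simp: lo_def ev_def fun_eq_iff less_Suc_eq)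
    then have "l (lo (Suc k) v) = 1 * l (lo k v) + v k * l (ev k)" using lin[OF lR eR, of 1 "v k"] by simp
    then show ?case using Suc by simp
  qed
  moreover have "lo n v = v" using v by (auto simp: lo_def Rn_iff fun_eq_iff)
  ultimately show ?thesis by fastforce
qed

text \<open>Multilinearity with the argument list split at the slot in question, which spares list
  updates in the applications.\<close>

lemma alternating_form_slot:
  assumes a: "alternating_form k V \<alpha>" and len: "length pre + Suc (length post) = k"
    and sub: "set pre \<subseteq> V" "set post \<subseteq> V" and vw: "v \<in> V" "w \<in> V"
  shows "\<alpha> (pre @ (\<lambda>j. a * v j + b * w j) # post) = a * \<alpha> (pre @ v # post) + b * \<alpha> (pre @ w # post)"
proof -
  let ?vs = "pre @ v # post" and ?i = "length pre"
  have "\<alpha> (?vs[?i := (\<lambda>j. a * v j + b * w j)]) = a * \<alpha> (?vs[?i := v]) + b * \<alpha> (?vs[?i := w])"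
    using a len sub vw unfolding alternating_form_def by (elim conjE allE[of _ ?vs] allE[of _ ?i]) auto
  then show ?thesis by simp
qed

text \<open>By multilinearity the fields \<open>ws\<close> are replaced by coordinate vectors one after the other.\<close>

lemma euclidean_form_fields:
  assumes \<alpha>: "euclidean_form k n U \<alpha>" and U: "opn n U" and V: "opn m V"
    and hU: "\<And>x. x \<in> V \<Longrightarrow> h x \<in> U" and h: "\<And>i. i < n \<Longrightarrow> Cinf_on m V (\<lambda>x. h x i)"
    and ws: "\<And>w x. w \<in> set ws \<Longrightarrow> x \<in> V \<Longrightarrow> w x \<in> Rn n"
      "\<And>w i. w \<in> set ws \<Longrightarrow> i < n \<Longrightarrow> Cinf_on m V (\<lambda>x. w x i)"
    and vs: "set vs \<subseteq> Rn n" "length vs + length ws = k"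
  shows "Cinf_on m V (\<lambda>x. \<alpha> (h x) (vs @ map (\<lambda>w. w x) ws))"
  using ws vs
proof (induction ws arbitrary: vs)
  case Nil
  have "Cinf_on n U (\<lambda>y. \<alpha> y vs)" using \<alpha> Nil unfolding euclidean_form_def by simp
  then show ?case using Cinf_on_compose[OF V U hU h] by simp
next
  case (Cons w ws)
  let ?r = "\<lambda>x. map (\<lambda>w. w x) ws"
  have "\<alpha> (h x) (vs @ w x # ?r x) = (\<Sum>i<n. w x i * \<alpha> (h x) (vs @ ev i # ?r x))" if x: "x \<in> V" for x
  proof (rule linear_on_Rn_expand[where l="\<lambda>v. \<alpha> (h x) (vs @ v # ?r x)"])
    show "w x \<in> Rn n" using Cons.prems(1) x by simp
    fix v u a b assume "v \<in> Rn n" "u \<in> Rn n"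
    then show "\<alpha> (h x) (vs @ (\<lambda>j. a * v j + b * u j) # ?r x) = a * \<alpha> (h x) (vs @ v # ?r x) + b * \<alpha> (h x) (vs @ u # ?r x)"
      using \<alpha> hU[OF x] Cons.prems x
      by (intro alternating_form_slot[where k=k and V="Rn n"]) (auto simp: euclidean_form_def)
  qed
  moreover have "Cinf_on m V (\<lambda>x. \<Sum>i<n. w x i * \<alpha> (h x) (vs @ ev i # ?r x))"
  proof (intro Cinf_on_sum Cinf_on_mult V)
    fix i assume i: "i \<in> {..<n}"
    show "Cinf_on m V (\<lambda>x. w x i)" using Cons.prems(2) i by simp
    \<comment> \<open>The coordinate vector joins the constant arguments; this is why the induction
      is over all \<open>vs\<close>.\<close>
    have "Cinf_on m V (\<lambda>x. \<alpha> (h x) ((vs @ [ev i]) @ ?r x))"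
      using Cons.prems i by (intro Cons.IH) (auto simp: ev_Rn)
    then show "Cinf_on m V (\<lambda>x. \<alpha> (h x) (vs @ ev i # ?r x))" by simp
  qed
  ultimately show ?case
    using Cinf_on_cong[OF V, of "\<lambda>x. \<alpha> (h x) (vs @ w x # ?r x)" "\<lambda>x. \<Sum>i<n. w x i * \<alpha> (h x) (vs @ ev i # ?r x)"]
    by simp
qed

lemma Cinf_on_dir_deriv: "opn n U \<Longrightarrow> Cinf_on n U f \<Longrightarrow> Cinf_on n U (\<lambda>x. dir_deriv n f x v)"
  unfolding dir_deriv_def
  by (intro Cinf_on_sum Cinf_on_mult Cinf_on_const) (auto intro: Cinf_on_pd)

lemma mform_pullback_compose:
  assumes M: "charted M" and P: "plot M n U P" and V: "opn m V" and hU: "\<And>x. x \<in> V \<Longrightarrow> h x \<in> U"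
    and h: "\<And>i. i < n \<Longrightarrow> Cinf_on m V (\<lambda>x. h x i)" and x: "x \<in> V"
  shows "mform_pullback m M (\<lambda>x. P (h x)) \<omega> x vs = mform_pullback n M P \<omega> (h x) (map (jacobian m n h x) vs)"
proof -
  have "plot_tangent m M (\<lambda>x. P (h x)) x = plot_tangent n M P (h x) \<circ> jacobian m n h x"
    using plot_tangent_compose[OF M P V hU h x] by (simp add: fun_eq_iff)
  then show ?thesis by (simp add: mform_pullback_def)
qed

lemma mform_pullback_cong:
  assumes "opn n U" "u \<in> U" "\<And>x. x \<in> U \<Longrightarrow> P x = Q x"
  shows "mform_pullback n M P \<omega> u vs = mform_pullback n M Q \<omega> u vs"
proof -
  have "plot_tangent n M P u = plot_tangent n M Q u"
    by (rule ext) (rule plot_tangent_cong[OF assms])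
  then show ?thesis using assms(2,3) by (simp add: mform_pullback_def)
qed

lemma mform_pullback_alternating:
  assumes M: "smooth_manifold M" and \<omega>: "differential_form k M \<omega>" and P: "plot M n U P" and u: "u \<in> U"
  shows "alternating_form k (Rn n) (mform_pullback n M P \<omega> u)"
proof -
  let ?T = "plot_tangent n M P u"
  have alt: "alternating_form k (tangent_space M (P u)) (\<omega> (P u))"
    using \<omega> plot_in[OF P u] by (simp add: differential_form_def)
  have T: "?T v \<in> tangent_space M (P u)" for v by (rule plot_tangent_in[OF M P u])
  show ?thesis
    unfolding alternating_form_def mform_pullback_def
  proof (intro conjI allI impI)
    fix vs :: "rvec list" and i v w a b
    assume as: "length vs = k \<and> set vs \<subseteq> Rn n \<and> i < k \<and> v \<in> Rn n \<and> w \<in> Rn n"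
    then have "length (map ?T vs) = k \<and> set (map ?T vs) \<subseteq> tangent_space M (P u) \<and> i < k
        \<and> ?T v \<in> tangent_space M (P u) \<and> ?T w \<in> tangent_space M (P u)" using T by auto
    then have "\<omega> (P u) ((map ?T vs)[i := (\<lambda>f. a * ?T v f + b * ?T w f)])
       = a * \<omega> (P u) ((map ?T vs)[i := ?T v]) + b * \<omega> (P u) ((map ?T vs)[i := ?T w])"
      using alt unfolding alternating_form_def by blast
    then show "\<omega> (P u) (map ?T (vs[i := \<lambda>j. a * v j + b * w j]))
       = a * \<omega> (P u) (map ?T (vs[i := v])) + b * \<omega> (P u) (map ?T (vs[i := w]))"
      by (simp add: map_update plot_tangent_lin)
  next
    fix vs :: "rvec list" and i j
    assume as: "length vs = k \<and> set vs \<subseteq> Rn n \<and> i < j \<and> j < k \<and> vs ! i = vs ! j"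
    then have "length (map ?T vs) = k \<and> set (map ?T vs) \<subseteq> tangent_space M (P u) \<and> i < j \<and> j < k
        \<and> map ?T vs ! i = map ?T vs ! j" using T by auto
    then show "\<omega> (P u) (map ?T vs) = 0" using alt unfolding alternating_form_def by blast
  qed
qed

text \<open>A differential form is known to be smooth only in charts and on constant vectors. Near a
  point the plot is an inverse chart composed with a map \<open>h\<close>, and the differential of
  \<open>h\<close> turns constant vectors into vector fields, which
  \<open>euclidean_form_fields\<close> admits.\<close>

lemma mform_pullback_euclidean:
  assumes M: "smooth_manifold M" and \<omega>: "differential_form k M \<omega>" and P: "plot M n U P"
  shows "euclidean_form k n U (mform_pullback n M P \<omega>)"
  unfolding euclidean_form_def
proof (intro conjI ballI allI impI)
  fix u assume "u \<in> U"
  then show "alternating_form k (Rn n) (mform_pullback n M P \<omega> u)"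
    by (rule mform_pullback_alternating[OF M \<omega> P])
next
  note M' = smooth_manifold_charted[OF M]
  fix vs :: "rvec list" assume vs: "length vs = k \<and> set vs \<subseteq> Rn n"
  show "Cinf_on n U (\<lambda>x. mform_pullback n M P \<omega> x vs)"
  proof (rule Cinf_on_local[OF plot_opn[OF P]])
    fix u assume u: "u \<in> U"
    obtain A \<phi> where A: "(A, \<phi>) \<in> charts M" "P u \<in> A" using chart_exists[OF M'] plot_in[OF P u] by blast
    define W where "W = U \<inter> P -` A"
    have W: "opn n W" unfolding W_def by (rule plot_preimage[OF P chart_open[OF M' A(1)]])
    define h where "h = (\<lambda>x. \<phi> (P x))"
    have hi: "Cinf_on n W (\<lambda>x. h x i)" if "i < mdim M" for i
      unfolding h_def by (rule plot_coord[OF M' P A(1) that]) (auto simp: W_def)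
    have hW: "h x \<in> \<phi> ` A" if "x \<in> W" for x using that by (auto simp: W_def h_def)
    note pc = plot_chart_inv[OF M A(1)]
    have "mform_pullback n M P \<omega> x vs = mform_pullback n M (\<lambda>x. inv_into A \<phi> (h x)) \<omega> x vs" if "x \<in> W" for x
      by (rule mform_pullback_cong[OF W that]) (auto simp: W_def h_def chart_inv[OF M' A(1)])
    also have "\<dots> x = local_rep M (A, \<phi>) \<omega> (h x) (map (jacobian n (mdim M) h x) vs)" if "x \<in> W" for x
      unfolding local_rep_def using mform_pullback_compose[OF M' pc W hW hi that] by simp
    finally have eq: "mform_pullback n M P \<omega> x vs =
        local_rep M (A, \<phi>) \<omega> (h x) ([] @ map (\<lambda>w. w x) (map (\<lambda>v x. jacobian n (mdim M) h x v) vs))"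
      if "x \<in> W" for x using that by (simp add: o_def)
    have "Cinf_on n W (\<lambda>x. local_rep M (A, \<phi>) \<omega> (h x) ([] @ map (\<lambda>w. w x) (map (\<lambda>v x. jacobian n (mdim M) h x v) vs)))"
    proof (rule euclidean_form_fields[OF _ chart_image_open[OF M' A(1)] W hW hi])
      show "euclidean_form k (mdim M) (\<phi> ` A) (local_rep M (A, \<phi>) \<omega>)"
        using \<omega> A(1) unfolding differential_form_def by blast
      fix w i assume "w \<in> set (map (\<lambda>v x. jacobian n (mdim M) h x v) vs)" "i < mdim M"
      then obtain v where "w = (\<lambda>x. jacobian n (mdim M) h x v)" by auto
      then show "Cinf_on n W (\<lambda>x. w x i)"
        using \<open>i < mdim M\<close> Cinf_on_dir_deriv[OF W hi[OF \<open>i < mdim M\<close>]] by (simp add: jacobian_def)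
    qed (use vs in \<open>auto simp: jacobian_Rn\<close>)
    then have "Cinf_on n W (\<lambda>x. mform_pullback n M P \<omega> x vs)"
      using Cinf_on_cong[OF W, of "\<lambda>x. mform_pullback n M P \<omega> x vs"] eq by simp
    then show "\<exists>V. opn n V \<and> u \<in> V \<and> Cinf_on n V (\<lambda>x. mform_pullback n M P \<omega> x vs)"
      using W u A(2) by (intro exI[of _ W]) (auto simp: W_def)
  qed
qed

text \<open>Both sides depend continuously on the point, so a difference at \<open>u\<close> would
  persist on a cube around \<open>u\<close>.\<close>

lemma mform_pullback_eq_dense:
  assumes M: "smooth_manifold M" and \<omega>: "differential_form k M \<omega>"
    and P: "plot M n U P" and Q: "plot M n U Q"
    and dense: "\<And>W. opn n W \<Longrightarrow> W \<noteq> {} \<Longrightarrow> W \<subseteq> U \<Longrightarrow> \<exists>u\<in>W. mform_pullback n M P \<omega> u vs = mform_pullback n M Q \<omega> u vs"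
    and vs: "length vs = k" "set vs \<subseteq> Rn n" and u: "u \<in> U"
  shows "mform_pullback n M P \<omega> u vs = mform_pullback n M Q \<omega> u vs"
proof (rule ccontr)
  let ?d = "\<lambda>u. mform_pullback n M P \<omega> u vs - mform_pullback n M Q \<omega> u vs"
  assume "\<not> ?thesis"
  then have d: "\<bar>?d u\<bar> > 0" by simp
  have U: "opn n U" by (rule plot_opn[OF P])
  have "continuous_map (subtopology (Euclidean_space n) U) euclideanreal ?d"
    using mform_pullback_euclidean[OF M \<omega> P] mform_pullback_euclidean[OF M \<omega> Q] vs
    by (intro continuous_map_diff Cinf_on_cont) (auto simp: euclidean_form_def)
  then obtain r where r: "r > 0" "\<forall>y\<in>cube n u r. \<bar>?d y - ?d u\<bar> < \<bar>?d u\<bar>"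
    unfolding cont_Rn_iff[OF U] using u d by blast
  obtain s where s: "s > 0" "cube n u s \<subseteq> U" using opn_cube[OF U u] by blast
  let ?W = "cube n u (min r s)"
  have "u \<in> ?W" using r s u opn_subset[OF U] by (intro cube_self) auto
  moreover have "?W \<subseteq> U" using s(2) cube_mono[of "min r s" s] by force
  ultimately obtain y where y: "y \<in> ?W" "?d y = 0" using dense[OF openin_cube, of u "min r s"] by auto
  then have "\<bar>?d y - ?d u\<bar> < \<bar>?d u\<bar>" using r(2) cube_mono[of "min r s" r] by force
  then show False using y(2) by simp
qed

lemma smooth_map_euclidean_open:
  assumes "opn m V" "smooth_map (euclidean_open m V) (euclidean_open n U) f"
  shows "\<And>x. x \<in> V \<Longrightarrow> f x \<in> U" "\<And>i. i < n \<Longrightarrow> Cinf_on m V (\<lambda>x. f x i)"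
proof -
  have c: "continuous_map (subtopology (Euclidean_space m) V) (subtopology (Euclidean_space n) U) f"
    using assms(2) by (simp add: smooth_map_def euclidean_open_def)
  then show fV: "f x \<in> U" if "x \<in> V" for x
    using that topspace_sub[OF opn_subset[OF assms(1)]] by (auto simp: continuous_map_in_subtopology)
  fix i assume i: "i < n"
  have "V \<inter> f -` U = V" using fV by auto
  then have "Cinf_on m V (\<lambda>x. f (inv_into V (\<lambda>x. x) x) i)"
    using assms(2) i by (auto simp: smooth_map_def euclidean_open_def)
  moreover have "f (inv_into V (\<lambda>x. x) x) i = f x i" if "x \<in> V" for x
    using inv_into_f_f[of "\<lambda>x. x" V x] that by simp
  ultimately show "Cinf_on m V (\<lambda>x. f x i)"
    using Cinf_on_cong[OF assms(1), of "\<lambda>x. f (inv_into V (\<lambda>x. x) x) i" "\<lambda>x. f x i"] by blast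
qed

text \<open>Plots of the quotient lift locally, and the form on the quotient is read off from a
  lift; \<open>basic\<close> says that the choice of the lift does not matter.\<close>

lemma form_descends:
  fixes \<pi> :: "'a \<Rightarrow> 'b"
  assumes X: "smooth_manifold X" and \<omega>: "differential_form k X \<omega>"
    and D: "D = subset_diffeology (manifold_diffeology X) Y"
    and basic: "\<And>n U P Q u vs. D n U P \<Longrightarrow> D n U Q \<Longrightarrow> (\<And>v. v \<in> U \<Longrightarrow> \<pi> (P v) = \<pi> (Q v)) \<Longrightarrow> u \<in> U \<Longrightarrow>
        length vs = k \<Longrightarrow> set vs \<subseteq> Rn n \<Longrightarrow> mform_pullback n X P \<omega> u vs = mform_pullback n X Q \<omega> u vs"
  shows "\<exists>\<beta>. diffeological_form k (quotient_diffeology D \<pi>) \<beta> \<and>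
     dform_eq k D (dform_pullback (\<lambda>x. x) (dform_of X \<omega>)) (dform_pullback \<pi> \<beta>)"
proof -
  note X' = smooth_manifold_charted[OF X]
  define lift where "lift n U P u c \<longleftrightarrow> opn n (fst c) \<and> u \<in> fst c \<and> fst c \<subseteq> U \<and> D n (fst c) (snd c) \<and>
      (\<forall>v\<in>fst c. P v = \<pi> (snd c v))" for n U P u and c :: "rvec set \<times> (rvec \<Rightarrow> 'a)"
  \<comment> \<open>A lift is chosen for each point \<open>u\<close> separately, so nothing relates
    the choices at neighbouring points. Smoothness comes from \<open>basic\<close>, which allows
    replacing all of them near \<open>u\<close> by one lift.\<close>
  define \<beta> where "\<beta> n U P u vs = mform_pullback n X (snd (SOME c. lift n U P u c)) \<omega> u vs"
    for n U and P :: "rvec \<Rightarrow> 'b" and u vs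
  have Dplot: "plot X n U P" "P ` U \<subseteq> Y" if "D n U P" for n U P
    using that by (simp_all add: D subset_diffeology_def)
  have Dr: "D n V P" if "D n U P" "opn n V" "V \<subseteq> U" for n U V P
    using plot_restrict[OF X' Dplot(1)[OF that(1)] that(2,3)] Dplot(2)[OF that(1)] that(3)
    by (auto simp: D subset_diffeology_def)
  have \<beta>: "\<beta> n U P u vs = mform_pullback n X Q \<omega> u vs"
    if c: "lift n U P u (V, Q)" and vs: "length vs = k" "set vs \<subseteq> Rn n" for n U P u V Q vs
  proof -
    define c' where "c' = (SOME c. lift n U P u c)"
    have c': "lift n U P u c'" unfolding c'_def by (rule someI[where P="lift n U P u", OF c])
    define W where "W = V \<inter> fst c'"
    have W: "opn n W" "u \<in> W" using c c' by (auto simp: lift_def W_def)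
    have "mform_pullback n X (snd c') \<omega> u vs = mform_pullback n X Q \<omega> u vs"
    proof (rule basic[OF _ _ _ W(2) vs])
      show "D n W (snd c')" by (rule Dr[OF _ W(1)]) (use c' in \<open>auto simp: lift_def W_def\<close>)
      show "D n W Q" by (rule Dr[OF _ W(1)]) (use c in \<open>auto simp: lift_def W_def\<close>)
      fix v assume v: "v \<in> W"
      have "P v = \<pi> (snd c' v)" using c' v by (simp add: lift_def W_def)
      moreover have "P v = \<pi> (Q v)" using c v by (simp add: lift_def W_def)
      ultimately show "\<pi> (snd c' v) = \<pi> (Q v)" by simp
    qed
    then show ?thesis by (simp add: \<beta>_def c'_def)
  qed
  have lift_ex: "\<exists>V Q. lift n U P u (V, Q)" if "quotient_diffeology D \<pi> n U P" "u \<in> U" for n U P u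
    using that unfolding quotient_diffeology_def lift_def by (metis fst_conv snd_conv)
  have "diffeological_form k (quotient_diffeology D \<pi>) \<beta>"
    unfolding diffeological_form_def
  proof (intro conjI allI impI)
    fix n U P assume P: "quotient_diffeology D \<pi> n U P"
    then have U: "opn n U" by (simp add: quotient_diffeology_def)
    show "euclidean_form k n U (\<beta> n U P)"
      unfolding euclidean_form_def
    proof (intro conjI ballI allI impI)
      fix u assume u: "u \<in> U"
      obtain V Q where c: "lift n U P u (V, Q)" using lift_ex[OF P u] by blast
      have "alternating_form k (Rn n) (mform_pullback n X Q \<omega> u)"
        by (rule mform_pullback_alternating[OF X \<omega> Dplot(1)]) (use c in \<open>auto simp: lift_def\<close>)
      moreover have "\<beta> n U P u vs = mform_pullback n X Q \<omega> u vs" if "length vs = k" "set vs \<subseteq> Rn n" for vs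
        by (rule \<beta>[OF c that])
      moreover have "set (vs[i := v]) \<subseteq> Rn n" if "set vs \<subseteq> Rn n" "v \<in> Rn n" for vs i and v :: rvec
        using that set_update_subset_insert by fastforce
      moreover have "(\<lambda>j. a * v j + b * w j) \<in> Rn n" if "v \<in> Rn n" "w \<in> Rn n" for v w and a b :: real
        using that by (simp add: Rn_iff)
      ultimately show "alternating_form k (Rn n) (\<beta> n U P u)"
        unfolding alternating_form_def by auto
    next
      fix vs :: "rvec list" assume vs: "length vs = k \<and> set vs \<subseteq> Rn n"
      show "Cinf_on n U (\<lambda>x. \<beta> n U P x vs)"
      proof (rule Cinf_on_local[OF U])
        fix u assume u: "u \<in> U"
        obtain V Q where c: "lift n U P u (V, Q)" using lift_ex[OF P u] by blast
        then have V: "opn n V" "u \<in> V" "D n V Q" by (auto simp: lift_def)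
        have "lift n U P x (V, Q)" if "x \<in> V" for x using c that by (auto simp: lift_def)
        then have "\<beta> n U P x vs = mform_pullback n X Q \<omega> x vs" if "x \<in> V" for x using \<beta> vs that by blast
        moreover have "Cinf_on n V (\<lambda>x. mform_pullback n X Q \<omega> x vs)"
          using mform_pullback_euclidean[OF X \<omega> Dplot(1)[OF V(3)]] vs unfolding euclidean_form_def by blast
        ultimately have "Cinf_on n V (\<lambda>x. \<beta> n U P x vs)"
          using Cinf_on_cong[OF V(1), of "\<lambda>x. \<beta> n U P x vs" "\<lambda>x. mform_pullback n X Q \<omega> x vs"] by blast
        then show "\<exists>V. opn n V \<and> u \<in> V \<and> Cinf_on n V (\<lambda>x. \<beta> n U P x vs)" using V by blast
      qed
    qed
  next
    fix n U P m V f Q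
    assume as: "quotient_diffeology D \<pi> n U P \<and> opn m V \<and>
       smooth_map (euclidean_open m V) (euclidean_open n U) f \<and> quotient_diffeology D \<pi> m V Q \<and> (\<forall>v\<in>V. Q v = P (f v))"
    then have P: "quotient_diffeology D \<pi> n U P" and V: "opn m V"
      and f: "smooth_map (euclidean_open m V) (euclidean_open n U) f" and Q: "\<And>v. v \<in> V \<Longrightarrow> Q v = P (f v)" by auto
    note fU = smooth_map_euclidean_open[OF V f]
    have U: "opn n U" using P by (simp add: quotient_diffeology_def)
    show "eform_eq k m V (\<beta> m V Q) (eform_pullback m n f (\<beta> n U P))"
      unfolding eform_eq_def eform_pullback_def
    proof (intro ballI allI impI)
      fix x vs assume x: "x \<in> V" and vs: "length vs = k \<and> set vs \<subseteq> Rn m"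
      obtain W R where c: "lift n U P (f x) (W, R)" using lift_ex[OF P fU(1)[OF x]] by blast
      then have W: "opn n W" "f x \<in> W" "W \<subseteq> U" "D n W R" "\<And>v. v \<in> W \<Longrightarrow> P v = \<pi> (R v)" by (auto simp: lift_def)
      define W' where "W' = V \<inter> f -` W"
      have W'o: "opn m W'" unfolding W'_def
        by (rule openin_sub_preimage[OF V _ W(1)])
           (use Cinf_continuous_map[OF V U fU] in \<open>simp add: continuous_map_in_subtopology\<close>)
      have xW': "x \<in> W'" unfolding W'_def using x W(2) by blast
      have fW: "Cinf_on m W' (\<lambda>x. f x i)" if "i < n" for i
        by (rule Cinf_on_subset[OF fU(2)[OF that]]) (auto simp: W'_def)
      have fW': "f v \<in> W" if "v \<in> W'" for v using that by (simp add: W'_def)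
      have "plot X m W' (\<lambda>v. R (f v))"
        \<comment> \<open>A lift of \<open>P\<close> composed with \<open>f\<close> is a lift of
          \<open>Q\<close>.\<close>
        by (rule plot_compose[OF X' Dplot(1)[OF W(4)] W'o fW' fW])
      then have "D m W' (\<lambda>v. R (f v))"
        using Dplot(2)[OF W(4)] by (auto simp: D subset_diffeology_def W'_def)
      then have "lift m V Q x (W', \<lambda>v. R (f v))"
        using W'o xW' W(5) Q by (auto simp: lift_def W'_def)
      then have "\<beta> m V Q x vs = mform_pullback m X (\<lambda>v. R (f v)) \<omega> x vs" using \<beta> vs by blast
      also have "\<dots> = mform_pullback n X R \<omega> (f x) (map (jacobian m n f x) vs)"
        by (rule mform_pullback_compose[OF X' Dplot(1)[OF W(4)] W'o fW' fW xW'])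
      also have "\<dots> = \<beta> n U P (f x) (map (jacobian m n f x) vs)"
        by (rule \<beta>[OF c, symmetric]) (use vs jacobian_Rn in auto)
      finally show "\<beta> m V Q x vs = \<beta> n U P (f x) (map (jacobian m n f x) vs)" .
    qed
  qed
  moreover have "dform_eq k D (dform_pullback (\<lambda>x. x) (dform_of X \<omega>)) (dform_pullback \<pi> \<beta>)"
    unfolding dform_eq_def eform_eq_def dform_pullback_def dform_of_def
  proof (intro allI impI ballI)
    fix n U P u vs assume P: "D n U P" and u: "u \<in> U" and vs: "length vs = k \<and> set vs \<subseteq> Rn n"
    have "lift n U (\<pi> \<circ> P) u (U, P)" using P u plot_opn[OF Dplot(1)[OF P]] by (simp add: lift_def)
    then have "\<beta> n U (\<pi> \<circ> P) u vs = mform_pullback n X P \<omega> u vs" using \<beta> vs by blast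
    then show "mform_pullback n X ((\<lambda>x. x) \<circ> P) \<omega> u vs = \<beta> n U (\<pi> \<circ> P) u vs" by (simp add: o_def)
  qed
  ultimately show ?thesis by blast
qed

section \<open>Ordinary differential equations and local inversion\<close>

lemma C1_lipschitz:
  assumes U: "opn n U" and F: "\<And>i. i < n \<Longrightarrow> Ck_on 1 n U (F i)" and e: "e \<in> U"
  shows "\<exists>r>0. \<exists>L\<ge>0. cube n e r \<subseteq> U \<and>
    (\<forall>i<n. \<forall>y\<in>cube n e r. \<forall>z\<in>cube n e r. \<bar>F i y - F i z\<bar> \<le> L * (\<Sum>j<n. \<bar>y j - z j\<bar>))"
proof -
  obtain r where r: "r > 0" "cube n e r \<subseteq> U"
    and d: "\<And>i y z. i < n \<Longrightarrow> y \<in> cube n e r \<Longrightarrow> z \<in> cube n e r \<Longrightarrow>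
      \<bar>F i y - F i z - (\<Sum>j<n. pd j (F i) e * (y j - z j))\<bar> \<le> 1 * (\<Sum>j<n. \<bar>y j - z j\<bar>)"
    using strict_diff_family[where f=F and d=n and e=1, OF U F e] by auto
  \<comment> \<open>The double sum bounds every partial derivative at \<open>e\<close>; the summand
    1 pays for the error term of strict differentiability.\<close>
  define L where "L = (\<Sum>i<n. \<Sum>j<n. \<bar>pd j (F i) e\<bar>) + 1"
  have L: "L \<ge> 0" unfolding L_def by (intro add_nonneg_nonneg sum_nonneg) auto
  have Lij: "\<bar>pd j (F i) e\<bar> \<le> L - 1" if "i < n" "j < n" for i j
  proof -
    have "\<bar>pd j (F i) e\<bar> \<le> (\<Sum>j<n. \<bar>pd j (F i) e\<bar>)" by (rule member_le_sum) (use that in auto)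
    also have "\<dots> \<le> (\<Sum>i<n. \<Sum>j<n. \<bar>pd j (F i) e\<bar>)"
      using member_le_sum[of i "{..<n}" "\<lambda>i. \<Sum>j<n. \<bar>pd j (F i) e\<bar>"] that by (simp add: sum_nonneg)
    finally show ?thesis by (simp add: L_def)
  qed
  have "\<bar>F i y - F i z\<bar> \<le> L * (\<Sum>j<n. \<bar>y j - z j\<bar>)"
    if i: "i < n" and y: "y \<in> cube n e r" and z: "z \<in> cube n e r" for i y z
  proof -
    have "\<bar>\<Sum>j<n. pd j (F i) e * (y j - z j)\<bar> \<le> (\<Sum>j<n. (L - 1) * \<bar>y j - z j\<bar>)"
      by (rule order_trans[OF sum_abs sum_mono]) (use Lij[OF i] in \<open>auto simp: abs_mult intro: mult_right_mono\<close>)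
    then have "\<bar>\<Sum>j<n. pd j (F i) e * (y j - z j)\<bar> \<le> (L - 1) * (\<Sum>j<n. \<bar>y j - z j\<bar>)"
      by (simp add: sum_distrib_left)
    moreover have "\<bar>F i y - F i z - (\<Sum>j<n. pd j (F i) e * (y j - z j))\<bar> \<le> (\<Sum>j<n. \<bar>y j - z j\<bar>)"
      using d[OF i y z] by simp
    ultimately show ?thesis by (simp add: left_diff_distrib)
  qed
  then show ?thesis using r L by blast
qed

text \<open>The proof bounds the maximum \<open>D\<close> of the distance of the two solutions by \<open>n L \<tau> D\<close>.\<close>

lemma ode_unique:
  assumes S: "S \<subseteq> Rn n" and L: "L \<ge> 0" "real n * L * \<tau> < 1" and \<tau>: "\<tau> > 0"
    and lip: "\<And>i y z. i < n \<Longrightarrow> y \<in> S \<Longrightarrow> z \<in> S \<Longrightarrow> \<bar>F i y - F i z\<bar> \<le> L * (\<Sum>j<n. \<bar>y j - z j\<bar>)"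
    and aS: "\<And>t. \<bar>t\<bar> \<le> \<tau> \<Longrightarrow> a t \<in> S" and bS: "\<And>t. \<bar>t\<bar> \<le> \<tau> \<Longrightarrow> b t \<in> S"
    and a: "\<And>t i. \<bar>t\<bar> \<le> \<tau> \<Longrightarrow> i < n \<Longrightarrow> ((\<lambda>s. a s i) has_real_derivative F i (a t)) (at t)"
    and b: "\<And>t i. \<bar>t\<bar> \<le> \<tau> \<Longrightarrow> i < n \<Longrightarrow> ((\<lambda>s. b s i) has_real_derivative F i (b t)) (at t)"
    and ab: "a 0 = b 0" and t: "\<bar>t\<bar> \<le> \<tau>"
  shows "a t = b t"
proof -
  define D where "D t = (\<Sum>i<n. \<bar>a t i - b t i\<bar>)" for t
  have "continuous_on {-\<tau>..\<tau>} D"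
    unfolding D_def
    by (intro continuous_on_sum continuous_on_rabs continuous_on_diff continuous_at_imp_continuous_on ballI
        DERIV_isCont[OF a] DERIV_isCont[OF b]) auto
  moreover have "{-\<tau>..\<tau>} \<noteq> {}" using \<tau> by simp
  ultimately obtain m where m: "m \<in> {-\<tau>..\<tau>}" "\<And>s. s \<in> {-\<tau>..\<tau>} \<Longrightarrow> D s \<le> D m"
    using continuous_attains_sup[of "{-\<tau>..\<tau>}" D] by auto
  have "\<bar>a m i - b m i\<bar> \<le> L * D m * \<tau>" if i: "i < n" for i
  proof -
    have "norm ((a m i - b m i) - (a 0 i - b 0 i)) \<le> L * D m * norm (m - 0)"
    proof (rule field_differentiable_bound[of "{-\<tau>..\<tau>}" "\<lambda>s. a s i - b s i" "\<lambda>s. F i (a s) - F i (b s)"])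
      fix s assume s: "s \<in> {-\<tau>..\<tau>}"
      then have s': "\<bar>s\<bar> \<le> \<tau>" by auto
      show "((\<lambda>s. a s i - b s i) has_field_derivative F i (a s) - F i (b s)) (at s within {-\<tau>..\<tau>})"
        by (rule has_field_derivative_at_within[OF DERIV_diff[OF a[OF s' i] b[OF s' i]]])
      have "\<bar>F i (a s) - F i (b s)\<bar> \<le> L * D s"
        unfolding D_def by (rule lip[OF i aS[OF s'] bS[OF s']])
      also have "\<dots> \<le> L * D m" by (rule mult_left_mono[OF m(2)[OF s] L(1)])
      finally show "norm (F i (a s) - F i (b s)) \<le> L * D m" by simp
    qed (use m \<tau> in auto)
    also have "\<dots> \<le> L * D m * \<tau>"
      using m(1) L(1) by (intro mult_left_mono) (auto simp: D_def intro!: mult_nonneg_nonneg sum_nonneg)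
    finally show ?thesis using ab by simp
  qed
  then have "D m \<le> (\<Sum>i<n. L * D m * \<tau>)" unfolding D_def by (intro sum_mono) (simp add: D_def)
  then have "D m \<le> (real n * L * \<tau>) * D m" by (simp add: mult_ac)
  moreover have "D m \<ge> 0" by (simp add: D_def sum_nonneg)
  ultimately have "D m = 0"
    using mult_strict_right_mono[OF L(2), of "D m"] by linarith
  then have "D t \<le> 0" using m(2)[of t] t by (simp add: abs_le_iff)
  then have "D t = 0" by (simp add: D_def order_antisym sum_nonneg)
  then have "\<forall>i<n. a t i = b t i" unfolding D_def by (subst (asm) sum_nonneg_eq_0_iff) auto
  then show ?thesis using aS[OF t] bS[OF t] S Rn_eqI by blast
qed

text \<open>Retraction onto the closed cube of radius \<open>r\<close> about \<open>e\<close>.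
  Composing with it makes a map given on the cube defined everywhere, so that a fixed point theorem
  for a whole Banach space applies.\<close>

definition clampv :: "nat \<Rightarrow> rvec \<Rightarrow> real \<Rightarrow> rvec \<Rightarrow> rvec" where
  "clampv n e r x = (\<lambda>i. if i < n then max (e i - r) (min (e i + r) (x i)) else 0)"

lemma clampv_Rn: "clampv n e r x \<in> Rn n"
  by (simp add: clampv_def Rn_iff)

lemma clampv_bound: "0 \<le> r \<Longrightarrow> i < n \<Longrightarrow> \<bar>clampv n e r x i - e i\<bar> \<le> r"
  by (auto simp: clampv_def)

lemma clampv_cube: "0 \<le> r \<Longrightarrow> r < s \<Longrightarrow> clampv n e r x \<in> cube n e s"
  using clampv_bound[of r _ n e x] by (force simp: cube_def clampv_Rn)

lemma clampv_lipschitz: "\<bar>clampv n e r x i - clampv n e r y i\<bar> \<le> \<bar>x i - y i\<bar>"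
  by (auto simp: clampv_def)

lemma clampv_id: "x \<in> Rn n \<Longrightarrow> (\<And>i. i < n \<Longrightarrow> \<bar>x i - e i\<bar> \<le> r) \<Longrightarrow> clampv n e r x = x"
  by (rule Rn_eqI[of _ n]) (fastforce simp: clampv_Rn, assumption, force simp: clampv_def abs_le_iff)

text \<open>The slices over the points of a discrete space are open, so joint continuity can be
  checked slice by slice.\<close>

lemma continuous_on_nat_param:
  fixes G :: "real \<times> nat discrete \<Rightarrow> real"
  assumes "\<And>i. continuous_on UNIV (\<lambda>t. G (t, i))"
  shows "continuous_on UNIV G"
proof -
  have "continuous_on (\<Union>i\<in>UNIV. UNIV \<times> {i}) G"
  proof (rule continuous_on_open_UN)
    fix i :: "nat discrete"
    show "open (UNIV \<times> {i} :: (real \<times> nat discrete) set)" by (intro open_Times) (auto simp: Discrete_Topology.open_discrete)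
    have "continuous_on (UNIV \<times> {i}) (\<lambda>p. G (fst p, i))"
      by (rule continuous_on_compose2[OF assms continuous_on_fst]) (auto intro: continuous_on_id)
    then show "continuous_on (UNIV \<times> {i}) G" by (rule continuous_on_cong[THEN iffD1, rotated 2]) auto
  qed
  moreover have "(\<Union>i\<in>UNIV. UNIV \<times> {i}) = (UNIV :: (real \<times> nat discrete) set)" by auto
  ultimately show ?thesis by simp
qed

text \<open>Picard iteration in the Banach space of bounded continuous functions of \<open>(t, i)\<close>, where \<open>i\<close> is
  the number of the coordinate.\<close>

lemma ode_exists:
  assumes U: "opn n U" and F: "\<And>i. i < n \<Longrightarrow> Ck_on 1 n U (F i)" and e: "e \<in> U"
  shows "\<exists>\<tau>>0. \<exists>a. a 0 = e \<and> (\<forall>t. a t \<in> Rn n) \<and>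
     (\<forall>t. \<bar>t\<bar> < \<tau> \<longrightarrow> a t \<in> U \<and> (\<forall>i<n. ((\<lambda>s. a s i) has_real_derivative F i (a t)) (at t)))"
proof -
  obtain r L where r: "r > 0" "cube n e r \<subseteq> U" and L: "L \<ge> 0"
    and lip: "\<And>i y z. i < n \<Longrightarrow> y \<in> cube n e r \<Longrightarrow> z \<in> cube n e r \<Longrightarrow> \<bar>F i y - F i z\<bar> \<le> L * (\<Sum>j<n. \<bar>y j - z j\<bar>)"
    using C1_lipschitz[where F=F, OF U F e] by blast
  have eR: "e \<in> Rn n" using e opn_subset[OF U] by blast
  \<comment> \<open>Less than \<open>r\<close>, because the clamp maps onto a closed cube and the
    Lipschitz estimate holds on an open one.\<close>
  define \<rho> where "\<rho> = r / 2"
  have \<rho>: "\<rho> > 0" "\<rho> < r" using r(1) by (auto simp: \<rho>_def)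
  define c where "c = clampv n e \<rho>"
  have cc: "c x \<in> cube n e r" for x unfolding c_def by (rule clampv_cube) (use \<rho> in auto)
  \<comment> \<open>Bound for the clamped field: its values at \<open>e\<close> plus the Lipschitz
    variation over a distance of at most \<open>\<rho>\<close> in each coordinate.\<close>
  define B where "B = (\<Sum>i<n. \<bar>F i e\<bar>) + L * (real n * \<rho>)"
  have B: "B \<ge> 0" unfolding B_def using L \<rho> by (intro add_nonneg_nonneg sum_nonneg mult_nonneg_nonneg) auto
  have FB: "\<bar>F i (c x)\<bar> \<le> B" if i: "i < n" for i x
  proof -
    have "\<bar>F i (c x) - F i e\<bar> \<le> L * (\<Sum>j<n. \<bar>c x j - e j\<bar>)"
      by (rule lip[OF i cc cube_self[OF eR r(1)]])
    also have "\<dots> \<le> L * (\<Sum>j<n. \<rho>)"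
      by (intro mult_left_mono sum_mono L) (use clampv_bound \<rho> in \<open>auto simp: c_def\<close>)
    finally have "\<bar>F i (c x) - F i e\<bar> \<le> L * (real n * \<rho>)" by simp
    moreover have "\<bar>F i e\<bar> \<le> (\<Sum>i<n. \<bar>F i e\<bar>)" by (rule member_le_sum) (use i in auto)
    ultimately show ?thesis by (simp add: B_def)
  qed
  have Fl: "\<bar>F i (c x) - F i (c y)\<bar> \<le> L * (\<Sum>j<n. \<bar>x j - y j\<bar>)" if i: "i < n" for i x y
  proof -
    have "\<bar>F i (c x) - F i (c y)\<bar> \<le> L * (\<Sum>j<n. \<bar>c x j - c y j\<bar>)" by (rule lip[OF i cc cc])
    also have "\<dots> \<le> L * (\<Sum>j<n. \<bar>x j - y j\<bar>)"
      by (intro mult_left_mono sum_mono L) (simp add: c_def clampv_lipschitz)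
    finally show ?thesis .
  qed
  \<comment> \<open>The first bound makes the Picard operator a contraction with constant 1/2. The
    second keeps its values within \<open>\<rho>\<close> of \<open>e\<close>, so that in the end the
    clamp does nothing. The summands 1 keep the denominators positive.\<close>
  define \<tau> where "\<tau> = min (1 / (2 * (L * real n + 1))) (\<rho> / (B + 1))"
  have Ln: "L * real n \<ge> 0" using L by simp
  have \<tau>: "\<tau> > 0" unfolding \<tau>_def using Ln B \<rho> by auto
  have \<tau>1: "L * real n * \<tau> \<le> 1 / 2"
  proof -
    have "L * real n * \<tau> \<le> L * real n * (1 / (2 * (L * real n + 1)))"
      by (intro mult_left_mono Ln) (simp add: \<tau>_def)
    also have "\<dots> \<le> 1 / 2" using Ln by (simp add: field_simps)
    finally show ?thesis .
  qed
  have \<tau>2: "B * \<tau> \<le> \<rho>"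
  proof -
    have "B * \<tau> \<le> B * (\<rho> / (B + 1))" by (intro mult_left_mono B) (simp add: \<tau>_def)
    also have "\<dots> \<le> \<rho>" using B \<rho> by (simp add: field_simps)
    finally show ?thesis .
  qed
  define g where "g f i s = F i (c (\<lambda>j. apply_bcontfun f (s, discrete j)))" for f :: "(real \<times> nat discrete) \<Rightarrow>\<^sub>C real" and i s
  have fc: "continuous (at s) (\<lambda>s. apply_bcontfun f (s, discrete j))" for f :: "(real \<times> nat discrete) \<Rightarrow>\<^sub>C real" and s j
  proof -
    have "continuous_on UNIV (\<lambda>s. apply_bcontfun f (s, discrete j))"
      by (rule continuous_on_compose2[OF continuous_on_apply_bcontfun[of UNIV]]) (auto intro!: continuous_intros)
    then show ?thesis by (simp add: continuous_on_eq_continuous_at)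
  qed
  have gc: "continuous_on {-\<tau>..\<tau>} (g f i)" if i: "i < n" for f i
  proof (rule continuous_at_imp_continuous_on, rule ballI)
    fix s
    have "((\<lambda>x. L * (\<Sum>j<n. \<bar>apply_bcontfun f (x, discrete j) - apply_bcontfun f (s, discrete j)\<bar>)) \<longlongrightarrow>
        L * (\<Sum>j<n. \<bar>apply_bcontfun f (s, discrete j) - apply_bcontfun f (s, discrete j)\<bar>)) (at s)"
      by (intro tendsto_intros fc[unfolded continuous_at])
    then have z: "((\<lambda>x. L * (\<Sum>j<n. \<bar>apply_bcontfun f (x, discrete j) - apply_bcontfun f (s, discrete j)\<bar>)) \<longlongrightarrow> 0) (at s)" by simp
    have "((\<lambda>x. g f i x - g f i s) \<longlongrightarrow> 0) (at s)"
      by (rule Lim_null_comparison[OF _ z]) (use Fl[OF i] in \<open>auto simp: g_def\<close>)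
    then show "isCont (g f i) s" by (simp add: isCont_def LIM_zero_iff)
  qed
  \<comment> \<open>Integrating from \<open>-\<tau>\<close> and subtracting the value at 0 treats
    both signs of \<open>t\<close> alike.\<close>
  define I where "I f i t = integral {-\<tau>..t} (g f i)" for f i t
  have Id: "(I f i has_real_derivative g f i t) (at t within {-\<tau>..\<tau>})" if "i < n" "t \<in> {-\<tau>..\<tau>}" for f i t
    unfolding I_def[abs_def] by (rule integral_has_real_derivative[OF gc that(2)]) (rule that(1))
  \<comment> \<open>Time is clamped as well, since the functions of the Banach space live on the
    whole line.\<close>
  define ct where "ct t = max (-\<tau>) (min \<tau> t)" for t
  have ct: "ct t \<in> {-\<tau>..\<tau>}" "\<bar>ct t\<bar> \<le> \<tau>" for t using \<tau> by (auto simp: ct_def)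
  define T where "T f = (\<lambda>(t, d). let i = of_discrete d in if i < n then e i + (I f i (ct t) - I f i 0) else 0)" for f
  have IB: "\<bar>I f i t - I f i 0\<bar> \<le> B * \<bar>t\<bar>" if i: "i < n" and t: "t \<in> {-\<tau>..\<tau>}" for f i t
  proof -
    have "norm (I f i t - I f i 0) \<le> B * norm (t - 0)"
      by (rule field_differentiable_bound[of "{-\<tau>..\<tau>}", OF _ Id]) (use i t \<tau> FB in \<open>auto simp: g_def\<close>)
    then show ?thesis by simp
  qed
  have Tb: "T f \<in> bcontfun" for f
  proof (rule bcontfun_normI[where b="(\<Sum>i<n. \<bar>e i\<bar>) + \<rho>"])
    show "continuous_on UNIV (T f)"
    proof (rule continuous_on_nat_param)
      fix d :: "nat discrete"
      obtain i where d: "d = discrete i" by (metis of_discrete_inverse)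
      show "continuous_on UNIV (\<lambda>t. T f (t, d))"
      proof (cases "i < n")
        case True
        have "continuous_on {-\<tau>..\<tau>} (I f i)"
          by (rule DERIV_continuous_on) (rule Id[OF True])
        then have "continuous_on UNIV (\<lambda>t. I f i (ct t))"
          by (rule continuous_on_compose2) (use ct in \<open>auto simp: ct_def intro!: continuous_intros\<close>)
        then show ?thesis using True by (auto simp: T_def d discrete_inverse intro!: continuous_intros)
      next
        case False
        then show ?thesis by (simp add: T_def d discrete_inverse)
      qed
    qed
    fix p :: "real \<times> nat discrete"
    obtain t i where p: "p = (t, discrete i)" by (metis surj_pair of_discrete_inverse)
    show "norm (T f p) \<le> (\<Sum>i<n. \<bar>e i\<bar>) + \<rho>"
    proof (cases "i < n")
      case True
      have "\<bar>I f i (ct t) - I f i 0\<bar> \<le> B * \<bar>ct t\<bar>" by (rule IB[OF True ct(1)])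
      also have "\<dots> \<le> B * \<tau>" by (intro mult_left_mono ct B)
      finally have "\<bar>I f i (ct t) - I f i 0\<bar> \<le> \<rho>" using \<tau>2 by simp
      moreover have "\<bar>e i\<bar> \<le> (\<Sum>i<n. \<bar>e i\<bar>)" by (rule member_le_sum) (use True in auto)
      ultimately show ?thesis using True by (auto simp: T_def p discrete_inverse)
    next
      case False
      then show ?thesis using \<rho> by (simp add: T_def p discrete_inverse sum_nonneg add_nonneg_nonneg)
    qed
  qed
  have Tapp: "apply_bcontfun (Bcontfun (T f)) = T f" for f by (rule Bcontfun_inverse[OF Tb])
  have contr: "dist (Bcontfun (T f)) (Bcontfun (T h)) \<le> 1/2 * dist f h" for f h
  proof (rule dist_bound)
    fix p :: "real \<times> nat discrete"
    obtain t i where p: "p = (t, discrete i)" by (metis surj_pair of_discrete_inverse)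
    show "dist (apply_bcontfun (Bcontfun (T f)) p) (apply_bcontfun (Bcontfun (T h)) p) \<le> 1/2 * dist f h"
    proof (cases "i < n")
      case True
      have gd: "\<bar>g f i s - g h i s\<bar> \<le> L * real n * dist f h" for s
      proof -
        have "\<bar>g f i s - g h i s\<bar> \<le> L * (\<Sum>j<n. \<bar>apply_bcontfun f (s, discrete j) - apply_bcontfun h (s, discrete j)\<bar>)"
          unfolding g_def by (rule Fl[OF True])
        also have "\<dots> \<le> L * (\<Sum>j<n. dist f h)"
          by (intro mult_left_mono sum_mono L) (use dist_bounded[of f _ h] in \<open>simp add: dist_real_def\<close>)
        finally show ?thesis by simp
      qed
      have "norm ((I f i (ct t) - I h i (ct t)) - (I f i 0 - I h i 0)) \<le> (L * real n * dist f h) * norm (ct t - 0)"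
        by (rule field_differentiable_bound[of "{-\<tau>..\<tau>}" "\<lambda>s. I f i s - I h i s", OF _ DERIV_diff[OF Id Id]])
           (use True ct \<tau> gd in auto)
      also have "\<dots> \<le> (L * real n * dist f h) * \<tau>"
        using ct(2) Ln by (intro mult_left_mono) auto
      also have "\<dots> = (L * real n * \<tau>) * dist f h" by simp
      also have "\<dots> \<le> 1/2 * dist f h" by (rule mult_right_mono[OF \<tau>1]) simp
      finally show ?thesis unfolding Tapp p using True by (simp add: T_def discrete_inverse dist_real_def algebra_simps)
    next
      case False
      then show ?thesis unfolding Tapp p by (simp add: T_def discrete_inverse)
    qed
  qed
  have "\<exists>!f. Bcontfun (T f) = f"
    by (rule banach_fix_type[of "1/2"]) (use contr in auto)
  then obtain f where f: "Bcontfun (T f) = f" by blast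
  define a where "a t = (\<lambda>i. apply_bcontfun f (t, discrete i))" for t
  have af: "apply_bcontfun f = T f" using Tapp[of f] unfolding f .
  have aT: "a t i = (if i < n then e i + (I f i (ct t) - I f i 0) else 0)" for t i
    unfolding a_def af by (simp add: T_def discrete_inverse)
  have "ct 0 = 0" using \<tau> by (simp add: ct_def)
  then have "a 0 = e" using eR by (auto simp: fun_eq_iff aT Rn_iff)
  moreover have aR: "a t \<in> Rn n" for t by (simp add: Rn_iff aT)
  moreover have "a t \<in> U \<and> (\<forall>i<n. ((\<lambda>s. a s i) has_real_derivative F i (a t)) (at t))" if t: "\<bar>t\<bar> < \<tau>" for t
  proof -
    have tt: "t \<in> {-\<tau>..\<tau>}" "t \<in> {-\<tau><..<\<tau>}" "ct t = t" using t by (auto simp: ct_def)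
    have "\<bar>a t i - e i\<bar> \<le> \<rho>" if "i < n" for i
    proof -
      have "\<bar>a t i - e i\<bar> \<le> B * \<bar>t\<bar>" using IB[OF that tt(1)] that by (simp add: aT tt(3))
      also have "\<dots> \<le> B * \<tau>" using t B by (intro mult_left_mono) auto
      finally show ?thesis using \<tau>2 by simp
    qed
    \<comment> \<open>The fixed point stays in the cube on which the clamp is the identity, so it
      solves the original equation.\<close>
    then have ca: "c (a t) = a t" unfolding c_def by (intro clampv_id aR)
    have "((\<lambda>s. a s i) has_real_derivative F i (a t)) (at t)" if i: "i < n" for i
    proof -
      have "(I f i has_real_derivative g f i t) (at t within {-\<tau><..<\<tau>})"
        by (rule DERIV_subset[OF Id[OF i tt(1)]]) auto
      then have "(I f i has_real_derivative g f i t) (at t)" by (simp only: at_within_open[OF tt(2) open_greaterThanLessThan])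
      then have d: "((\<lambda>s. e i + (I f i s - I f i 0)) has_real_derivative g f i t) (at t)"
        by (auto intro!: derivative_eq_intros)
      have ev: "\<forall>\<^sub>F s in nhds t. e i + (I f i s - I f i 0) = a s i"
      proof (rule eventually_mono)
        show "\<forall>\<^sub>F s in nhds t. s \<in> {-\<tau><..<\<tau>}" by (rule eventually_nhds_in_open) (use tt in auto)
        fix s assume "s \<in> {-\<tau><..<\<tau>}"
        then have "ct s = s" by (auto simp: ct_def)
        then show "e i + (I f i s - I f i 0) = a s i" using i by (simp add: aT)
      qed
      have "g f i t = F i (a t)" using ca by (simp add: g_def a_def)
      then show ?thesis using DERIV_transfer[OF d ev] by simp
    qed
    moreover have "a t \<in> U" using cc[of "a t"] ca r(2) by auto
    ultimately show ?thesis by blast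
  qed
  ultimately show ?thesis using \<tau> by blast
qed

lemma cube1: "x \<in> cube 1 (\<lambda>_. 0) r \<longleftrightarrow> x \<in> Rn 1 \<and> \<bar>x 0\<bar> < r"
  by (auto simp: cube_def)

text \<open>Bootstrapping: once all coordinates of \<open>a\<close> are C^k, so are their
  derivatives \<open>F i (a t)\<close>, and hence the coordinates are C^(k+1).\<close>

lemma ode_smooth:
  assumes U: "opn n U" and F: "\<And>i. i < n \<Longrightarrow> Cinf_on n U (F i)"
    and a: "\<And>t. \<bar>t\<bar> < \<tau> \<Longrightarrow> a t \<in> U"
      "\<And>t i. \<bar>t\<bar> < \<tau> \<Longrightarrow> i < n \<Longrightarrow> ((\<lambda>s. a s i) has_real_derivative F i (a t)) (at t)"
    and i: "i < n"
  shows "Cinf_on 1 (cube 1 (\<lambda>_. 0) \<tau>) (\<lambda>x. a (x 0) i)"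
proof -
  let ?I = "cube 1 (\<lambda>_. 0) \<tau>"
  have I: "opn 1 ?I" by (rule openin_cube)
  have c: "continuous_map (subtopology (Euclidean_space 1) ?I) euclideanreal (\<lambda>x. a (x 0) i)" if i: "i < n" for i
  proof -
    have x0: "continuous_map (subtopology (Euclidean_space 1) ?I) (top_of_set {-\<tau><..<\<tau>}) (\<lambda>x. x 0)"
      unfolding continuous_map_in_subtopology using cont_coord[of 1 ?I 0] by (auto simp: cube1 abs_less_iff simp del: One_nat_def)
    have "continuous_on {-\<tau><..<\<tau>} (\<lambda>t. a t i)"
      by (intro continuous_at_imp_continuous_on ballI DERIV_isCont[OF a(2)]) (use i in auto)
    then have "continuous_map (top_of_set {-\<tau><..<\<tau>}) euclideanreal (\<lambda>t. a t i)" by simp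
    from continuous_map_compose[OF x0 this] show ?thesis by (simp add: o_def)
  qed
  have "\<forall>i<n. Ck_on k 1 ?I (\<lambda>x. a (x 0) i)" for k
  proof (induction k)
    case 0
    then show ?case using c by simp
  next
    case (Suc k)
    show ?case
    proof (intro allI impI)
      fix i assume i: "i < n"
      show "Ck_on (Suc k) 1 ?I (\<lambda>x. a (x 0) i)"
      proof (rule Ck_on_SucI[OF I c[OF i], where D="\<lambda>j x. F i (a (x 0))"])
        fix j x assume "j < (1::nat)" "x \<in> ?I"
        then show "((\<lambda>t. a ((x(j := t)) 0) i) has_real_derivative F i (a (x 0))) (at (x j))"
          using a(2)[OF _ i, of "x 0"] by (auto simp: cube1 simp del: One_nat_def)
      next
        show "Ck_on k 1 ?I (\<lambda>x. F i (a (x 0)))"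
          by (rule Ck_on_compose[OF I U, where h="\<lambda>x. a (x 0)"])
             (use a(1) Suc Cinf_Ck[OF F[OF i]] in \<open>auto simp: cube1 simp del: One_nat_def\<close>)
      qed
    qed
  qed
  then show ?thesis using i by (simp add: Cinf_on_def)
qed

text \<open>The surjective half of the inverse function theorem. As the derivative at
  \<open>c\<close> is the identity, \<open>a \<mapsto> a - H a + w\<close> is a contraction near
  \<open>c\<close>, and its fixed points solve \<open>H a = w\<close>.\<close>

lemma local_surj:
  assumes W: "opn n W" and c: "c \<in> W" and H: "\<And>i. i < n \<Longrightarrow> Ck_on 1 n W (H i)"
    and pdH: "\<And>i j. i < n \<Longrightarrow> j < n \<Longrightarrow> pd j (H i) c = (if i = j then 1 else 0)" and \<eta>: "\<eta> > 0"
  shows "\<exists>\<rho>>0. \<forall>w. (\<forall>i<n. \<bar>w i - H i c\<bar> < \<rho>) \<longrightarrow> (\<exists>a\<in>cube n c \<eta>. a \<in> W \<and> (\<forall>i<n. H i a = w i))"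
proof -
  \<comment> \<open>Summed over \<open>n\<close> coordinates, the deviation of \<open>H\<close> from
    the identity then contributes at most 1/2, the contraction constant.\<close>
  define \<epsilon> where "\<epsilon> = 1 / (2 * (real n + 1))"
  have \<epsilon>: "\<epsilon> > 0" "\<epsilon> * real n \<le> 1 / 2" by (auto simp: \<epsilon>_def field_simps)
  have cR: "c \<in> Rn n" using c opn_subset[OF W] by blast
  obtain r0 where r0: "r0 > 0" "cube n c r0 \<subseteq> W"
    and d: "\<And>i y z. i < n \<Longrightarrow> y \<in> cube n c r0 \<Longrightarrow> z \<in> cube n c r0 \<Longrightarrow>
      \<bar>H i y - H i z - (\<Sum>j<n. pd j (H i) c * (y j - z j))\<bar> \<le> \<epsilon> * (\<Sum>j<n. \<bar>y j - z j\<bar>)"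
    using strict_diff_family[where f=H and d=n, OF W H c \<epsilon>(1)] by blast
  define r where "r = min r0 \<eta>"
  have r: "r > 0" using r0(1) \<eta> by (simp add: r_def)
  have r': "cube n c r \<subseteq> cube n c r0" "cube n c r \<subseteq> cube n c \<eta>" by (intro cube_mono; simp add: r_def)+
  have Hd: "\<bar>(y i - H i y) - (z i - H i z)\<bar> \<le> \<epsilon> * (\<Sum>j<n. \<bar>y j - z j\<bar>)"
    if i: "i < n" and y: "y \<in> cube n c r" and z: "z \<in> cube n c r" for i y z
  proof -
    have "(\<Sum>j<n. pd j (H i) c * (y j - z j)) = (\<Sum>j<n. if i = j then y j - z j else 0)"
      by (rule sum.cong) (use pdH[OF i] in auto)
    also have "\<dots> = y i - z i" using i by (subst sum.delta') auto
    finally have "\<bar>H i y - H i z - (y i - z i)\<bar> \<le> \<epsilon> * (\<Sum>j<n. \<bar>y j - z j\<bar>)"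
      using d[OF i, of y z] y z r' by auto
    then show ?thesis by (simp add: abs_minus_commute algebra_simps)
  qed
  define \<rho> where "\<rho> = r / 2"
  have \<rho>: "\<rho> > 0" "\<rho> < r" using r by (auto simp: \<rho>_def)
  let ?c = "clampv n c \<rho>"
  have cc: "?c x \<in> cube n c r" for x by (rule clampv_cube) (use \<rho> in auto)
  show ?thesis
  \<comment> \<open>Half of \<open>\<rho>\<close> is reserved for the displacement by
    \<open>w\<close>, the other half for the contraction, so \<open>K\<close> maps into the clamping
    cube.\<close>
  proof (intro exI[of _ "\<rho> / 2"] conjI allI impI)
    fix w assume w: "\<forall>i<n. \<bar>w i - H i c\<bar> < \<rho> / 2"
    define K where "K f = (\<lambda>i. if i < n then ?c f i - H i (?c f) + w i else 0)" for f :: rvec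
    have Kc: "\<bar>K f i - c i\<bar> \<le> \<rho>" if i: "i < n" for f i
    proof -
      have "\<bar>(?c f i - H i (?c f)) - (c i - H i c)\<bar> \<le> \<epsilon> * (\<Sum>j<n. \<bar>?c f j - c j\<bar>)"
        by (rule Hd[OF i cc cube_self[OF cR r]])
      also have "\<dots> \<le> \<epsilon> * (\<Sum>j<n. \<rho>)"
        by (intro mult_left_mono sum_mono) (use clampv_bound \<rho> \<epsilon> in auto)
      also have "\<dots> = (\<epsilon> * real n) * \<rho>" by simp
      also have "\<dots> \<le> 1/2 * \<rho>" by (rule mult_right_mono[OF \<epsilon>(2)]) (use \<rho> in simp)
      finally show ?thesis using w i unfolding K_def by (auto simp: abs_le_iff abs_less_iff) (smt (verit))+
    qed
    \<comment> \<open>\<open>Rn n\<close> is not a type, so the fixed point is sought among the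
      bounded functions on a discrete copy of \<open>nat\<close>.\<close>
    define KD where "KD f d = K f (of_discrete d)" for f d
    define app where "app f i = apply_bcontfun f (discrete i)" for f :: "nat discrete \<Rightarrow>\<^sub>C real" and i
    have Kb: "KD f \<in> bcontfun" for f
    proof (rule bcontfun_normI[where b="(\<Sum>i<n. \<bar>c i\<bar>) + \<rho>"])
      show "continuous_on UNIV (KD f)"
        unfolding continuous_on_open_invariant by (auto intro: Discrete_Topology.open_discrete)
      fix d :: "nat discrete"
      define i where "i = of_discrete d"
      show "norm (KD f d) \<le> (\<Sum>i<n. \<bar>c i\<bar>) + \<rho>"
      proof (cases "i < n")
        case True
        then have "\<bar>c i\<bar> \<le> (\<Sum>i<n. \<bar>c i\<bar>)" by (intro member_le_sum) auto
        then show ?thesis using Kc[OF True, of f] by (simp add: KD_def i_def)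
      next
        case False
        then show ?thesis using \<rho> by (simp add: KD_def i_def K_def sum_nonneg add_nonneg_nonneg)
      qed
    qed
    define KK where "KK f = Bcontfun (KD (app f))" for f :: "nat discrete \<Rightarrow>\<^sub>C real"
    have Kapp: "apply_bcontfun (KK f) = KD (app f)" for f unfolding KK_def by (rule Bcontfun_inverse[OF Kb])
    have contr: "dist (KK f) (KK h) \<le> 1/2 * dist f h" for f h
    proof (rule dist_bound)
      fix d :: "nat discrete"
      define i where "i = of_discrete d"
      show "dist (apply_bcontfun (KK f) d) (apply_bcontfun (KK h) d) \<le> 1/2 * dist f h"
      proof (cases "i < n")
        case True
        let ?f = "app f" and ?h = "app h"
        have "\<bar>(?c ?f i - H i (?c ?f)) - (?c ?h i - H i (?c ?h))\<bar> \<le> \<epsilon> * (\<Sum>j<n. \<bar>?c ?f j - ?c ?h j\<bar>)"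
          by (rule Hd[OF True cc cc])
        also have "\<dots> \<le> \<epsilon> * (\<Sum>j<n. dist f h)"
        proof (intro mult_left_mono sum_mono)
          fix j
          show "\<bar>?c ?f j - ?c ?h j\<bar> \<le> dist f h"
            using clampv_lipschitz[of n c \<rho> ?f j ?h] dist_bounded[of f "discrete j" h] by (simp add: dist_real_def app_def)
        qed (use \<epsilon> in auto)
        also have "\<dots> = (\<epsilon> * real n) * dist f h" by simp
        also have "\<dots> \<le> 1/2 * dist f h" by (rule mult_right_mono[OF \<epsilon>(2)]) simp
        finally show ?thesis using True by (simp add: Kapp KD_def i_def[symmetric] K_def dist_real_def)
      next
        case False
        then show ?thesis by (simp add: Kapp KD_def i_def[symmetric] K_def)
      qed
    qed
    have "\<exists>!f. KK f = f"
      by (rule banach_fix_type[of "1/2"]) (use contr in auto)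
    then obtain f where f: "KK f = f" by blast
    define a where "a = app f"
    have aK: "a = K a"
    proof
      fix i
      have "a i = apply_bcontfun (KK f) (discrete i)" unfolding f a_def app_def ..
      also have "\<dots> = K a i" unfolding Kapp KD_def a_def by (simp only: discrete_inverse UNIV_I)
      finally show "a i = K a i" .
    qed
    have aR: "a \<in> Rn n" by (subst aK) (simp add: K_def Rn_iff)
    have ac: "\<bar>a i - c i\<bar> \<le> \<rho>" if "i < n" for i by (subst aK) (rule Kc[OF that])
    have ca: "?c a = a" by (rule clampv_id[OF aR ac])
    have "H i a = w i" if "i < n" for i
    proof -
      have "a i = K a i" using aK by metis
      then show ?thesis using that by (simp add: K_def ca)
    qed
    moreover have "a \<in> cube n c r" using cc[of a] ca by simp
    then have "a \<in> cube n c \<eta>" "a \<in> W" using r' r0(2) by auto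
    ultimately show "\<exists>a\<in>cube n c \<eta>. a \<in> W \<and> (\<forall>i<n. H i a = w i)" by blast
  qed (use \<rho> in auto)
qed

section \<open>Smooth bump functions and velocities of curves\<close>

text \<open>The family of these functions, \<open>p\<close> running through all polynomials, is
  closed under differentiation. So the smoothness of all its members is a single induction.\<close>

definition flat :: "real poly \<Rightarrow> real \<Rightarrow> real" where
  "flat p t = (if t \<le> 0 then 0 else poly p (1 / t) * exp (- (1 / t)))"

lemma poly_exp_lim: "((\<lambda>x::real. poly p x * exp (- x)) \<longlongrightarrow> 0) at_top"
proof -
  have "((\<lambda>x::real. \<Sum>i\<le>degree p. coeff p i * (x ^ i / exp x)) \<longlongrightarrow> (\<Sum>i\<le>degree p. coeff p i * 0)) at_top"
    by (intro tendsto_sum tendsto_mult tendsto_const tendsto_power_div_exp_0)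
  moreover have "(\<lambda>x::real. \<Sum>i\<le>degree p. coeff p i * (x ^ i / exp x)) = (\<lambda>x. poly p x * exp (- x))"
    by (simp add: poly_altdef sum_distrib_right sum_divide_distrib exp_minus field_simps)
  ultimately show ?thesis by simp
qed

lemma flat_lim: "(flat p \<longlongrightarrow> 0) (at_right 0)"
proof -
  have "((\<lambda>t. poly p (inverse t) * exp (- inverse t)) \<longlongrightarrow> 0) (at_right 0)"
    by (rule filterlim_compose[OF poly_exp_lim filterlim_inverse_at_top_right])
  then show ?thesis
    by (rule Lim_transform_eventually)
       (auto simp: eventually_at_filter flat_def inverse_eq_divide)
qed

text \<open>For \<open>t > 0\<close> and x = 1/t the derivative is x^2 (p(x) - p'(x)) exp(-x), which
  explains the polynomial.\<close>

lemma flat_deriv: "(flat p has_real_derivative flat ([:0, 0, 1:] * (p - pderiv p)) t) (at t)"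
proof -
  consider "t > 0" | "t < 0" | "t = 0" by linarith
  then show ?thesis
  proof cases
    case 1
    have d: "((\<lambda>s. poly p (1 / s) * exp (- (1 / s))) has_real_derivative flat ([:0, 0, 1:] * (p - pderiv p)) t) (at t)"
      using 1 by (auto intro!: derivative_eq_intros simp: flat_def) (simp add: field_simps power2_eq_square)
    have ev: "\<forall>\<^sub>F s in nhds t. poly p (1 / s) * exp (- (1 / s)) = flat p s"
    proof (rule eventually_mono)
      show "\<forall>\<^sub>F s in nhds t. s \<in> {0<..}" by (rule eventually_nhds_in_open) (use 1 in auto)
    qed (simp add: flat_def)
    show ?thesis by (rule DERIV_transfer[OF d ev])
  next
    case 2
    have ev: "\<forall>\<^sub>F s in nhds t. 0 = flat p s"
    proof (rule eventually_mono)
      show "\<forall>\<^sub>F s in nhds t. s \<in> {..<0}" by (rule eventually_nhds_in_open) (use 2 in auto)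
    qed (simp add: flat_def)
    have "((\<lambda>s. 0) has_real_derivative flat ([:0, 0, 1:] * (p - pderiv p)) t) (at t)"
      using 2 by (simp add: flat_def)
    then show ?thesis by (rule DERIV_transfer[OF _ ev])
  next
    case 3
    have "((\<lambda>y. flat p y / y) \<longlongrightarrow> 0) (at_left 0)"
    proof (rule Lim_transform_eventually[OF tendsto_const])
      show "\<forall>\<^sub>F y in at_left 0. 0 = flat p y / y"
        by (auto simp: eventually_at_filter flat_def)
    qed
    moreover have "((\<lambda>y. flat p y / y) \<longlongrightarrow> 0) (at_right 0)"
    \<comment> \<open>Dividing by \<open>y\<close> multiplies \<open>p\<close> by its variable, so
      the difference quotient at 0 is again in the family and tends to 0.\<close>
    proof (rule Lim_transform_eventually[OF flat_lim[of "pCons 0 p"]])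
      show "\<forall>\<^sub>F y in at_right 0. flat (pCons 0 p) y = flat p y / y"
        by (auto simp: eventually_at_filter flat_def)
    qed
    ultimately have "((\<lambda>y. flat p y / y) \<longlongrightarrow> 0) (at 0)" by (rule filterlim_split_at)
    then show ?thesis using 3 by (simp add: has_field_derivative_iff flat_def)
  qed
qed

lemma Cinf_flat: "Cinf_on 1 (Rn 1) (\<lambda>x. flat p (x 0))"
proof -
  have c: "continuous_map (subtopology (Euclidean_space 1) (Rn 1)) euclideanreal (\<lambda>x. flat p (x 0))" for p
  proof -
    have "continuous_on UNIV (flat p)"
      by (intro continuous_at_imp_continuous_on ballI DERIV_isCont[OF flat_deriv])
    then have "continuous_map euclideanreal euclideanreal (flat p)" by simp
    from continuous_map_compose[OF cont_coord[of 1 "Rn 1" 0] this] show ?thesis by (simp add: o_def)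
  qed
  have "Ck_on k 1 (Rn 1) (\<lambda>x. flat p (x 0))" for k
  proof (induction k arbitrary: p)
    case 0
    then show ?case using c by simp
  next
    case (Suc k)
    show ?case
    proof (rule Ck_on_SucI[OF opn_Rn c, where D="\<lambda>j x. flat ([:0, 0, 1:] * (p - pderiv p)) (x 0)"])
      fix j x assume "j < (1::nat)"
      then show "((\<lambda>t. flat p ((x(j := t)) 0)) has_real_derivative flat ([:0, 0, 1:] * (p - pderiv p)) (x 0)) (at (x j))"
        using flat_deriv[of p "x 0"] by simp
    qed (rule Suc)
  qed
  then show ?thesis by (simp add: Cinf_on_def)
qed

text \<open>The function exp(-1/q) with q = r^2 - |y - c|^2 vanishes off the Euclidean ball of
  radius \<open>r\<close>, in particular off the cube around it.\<close>

lemma smooth_bump: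
  assumes "r > 0"
  shows "\<exists>\<xi>. Cinf_on n (Rn n) \<xi> \<and> \<xi> c > 0 \<and> (\<forall>y. (\<exists>j<n. \<bar>y j - c j\<bar> > r) \<longrightarrow> \<xi> y = 0)"
proof (intro exI conjI allI impI)
  \<comment> \<open>Spelled with sums and products only, to fit the closure rules of
    \<open>Cinf_on\<close>.\<close>
  let ?q = "\<lambda>y::rvec. r\<^sup>2 + (\<Sum>j<n. - 1 * ((y j + - c j) * (y j + - c j)))"
  let ?\<xi> = "\<lambda>y. flat 1 (?q y)"
  have q: "Cinf_on n (Rn n) ?q"
    by (intro Cinf_on_add Cinf_on_sum Cinf_on_mult Cinf_on_const Cinf_on_coord opn_Rn)
  define h where "h y = (\<lambda>i::nat. if i = 0 then ?q y else 0)" for y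
  have "Cinf_on n (Rn n) (\<lambda>y. flat 1 (h y 0))"
    by (rule Cinf_on_compose[OF opn_Rn opn_Rn[of 1] _ _ Cinf_flat]) (use q in \<open>auto simp: Rn_iff h_def\<close>)
  then show "Cinf_on n (Rn n) ?\<xi>" by (simp add: h_def)
  show "?\<xi> c > 0" using assms by (simp add: flat_def)
  fix y assume "\<exists>j<n. \<bar>y j - c j\<bar> > r"
  then obtain j where j: "j < n" "\<bar>y j - c j\<bar> > r" by blast
  have "r\<^sup>2 < (y j - c j)\<^sup>2" using j(2) assms power_strict_mono[of r "\<bar>y j - c j\<bar>" 2] by simp
  also have "(y j - c j)\<^sup>2 \<le> (\<Sum>j<n. (y j - c j)\<^sup>2)" by (rule member_le_sum) (use j in auto)
  finally have "?q y \<le> 0" by (simp add: sum_negf power2_eq_square)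
  then show "?\<xi> y = 0" by (simp add: flat_def)
qed

text \<open>By Tychonoff: a product of compact intervals, and of points 0 from index
  \<open>n\<close> on.\<close>

lemma compactin_closed_cube: "compactin (Euclidean_space n) {z \<in> Rn n. \<forall>j<n. \<bar>z j - c j\<bar> \<le> r}"
proof -
  let ?S = "\<lambda>j::nat. if j < n then {c j - r..c j + r} else {0::real}"
  have "compactin (powertop_real UNIV) (PiE UNIV ?S)"
    unfolding compactin_PiE by auto
  moreover have "PiE UNIV ?S = {z \<in> Rn n. \<forall>j<n. \<bar>z j - c j\<bar> \<le> r}"
  proof (rule Set.set_eqI)
    fix z :: rvec
    have "z \<in> PiE UNIV ?S \<longleftrightarrow> (\<forall>j. z j \<in> ?S j)" by (auto simp: PiE_iff)
    also have "\<dots> \<longleftrightarrow> z \<in> {z \<in> Rn n. \<forall>j<n. \<bar>z j - c j\<bar> \<le> r}"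
    proof
      assume S: "\<forall>j. z j \<in> ?S j"
      have "z j = 0" if "j \<ge> n" for j using S[rule_format, of j] that by simp
      moreover have "\<bar>z j - c j\<bar> \<le> r" if "j < n" for j using S[rule_format, of j] that by (simp add: abs_le_iff)
      ultimately show "z \<in> {z \<in> Rn n. \<forall>j<n. \<bar>z j - c j\<bar> \<le> r}" by (simp add: Rn_iff)
    next
      assume z: "z \<in> {z \<in> Rn n. \<forall>j<n. \<bar>z j - c j\<bar> \<le> r}"
      show "\<forall>j. z j \<in> ?S j"
      proof
        fix j
        show "z j \<in> ?S j"
        proof (cases "j < n")
          case True
          then have "\<bar>z j - c j\<bar> \<le> r" using z by simp
          then show ?thesis using True by (simp add: abs_le_iff)
        next
          case False
          then show ?thesis using z by (simp add: Rn_iff)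
        qed
      qed
    qed
    finally show "z \<in> PiE UNIV ?S \<longleftrightarrow> z \<in> {z \<in> Rn n. \<forall>j<n. \<bar>z j - c j\<bar> \<le> r}" .
  qed
  ultimately show ?thesis
    unfolding Euclidean_space_def compactin_subtopology by (auto simp: topspace_Euclidean_space)
qed

text \<open>Multiplication by a bump function makes a function on a chart global. The bump is only
  known to be positive at \<open>p\<close>, not constant near \<open>p\<close>; this does no harm in
  the application, where \<open>F\<close> vanishes at \<open>\<psi> p\<close>.\<close>

lemma smooth_extension:
  assumes M: "smooth_manifold M" and V: "(V, \<psi>) \<in> charts M" and p: "p \<in> V"
    and F: "Cinf_on (mdim M) (\<psi> ` V) F"
  shows "\<exists>f\<in>smooth_fun M. \<exists>\<xi>. Cinf_on (mdim M) (\<psi> ` V) \<xi> \<and> \<xi> (\<psi> p) > 0 \<and>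
    (\<forall>q\<in>V. f q = F (\<psi> q) * \<xi> (\<psi> q))"
proof -
  let ?d = "mdim M"
  note M' = smooth_manifold_charted[OF M]
  have o: "opn ?d (\<psi> ` V)" by (rule chart_image_open[OF M' V])
  obtain r0 where r0: "r0 > 0" "cube ?d (\<psi> p) r0 \<subseteq> \<psi> ` V" using opn_cube[OF o] p by blast
  define r where "r = r0 / 2"
  have r: "r > 0" "r < r0" using r0 by (auto simp: r_def)
  obtain \<xi> where \<xi>: "Cinf_on ?d (Rn ?d) \<xi>" "\<xi> (\<psi> p) > 0" "\<And>y j. j < ?d \<Longrightarrow> \<bar>y j - \<psi> p j\<bar> > r \<Longrightarrow> \<xi> y = 0"
    using smooth_bump[OF r(1), of ?d "\<psi> p"] by blast
  have \<xi>V: "Cinf_on ?d (\<psi> ` V) \<xi>" by (rule Cinf_on_subset[OF \<xi>(1) opn_subset[OF o]])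
  define f where "f q = (if q \<in> V then F (\<psi> q) * \<xi> (\<psi> q) else 0)" for q
  let ?K0 = "{z \<in> Rn ?d. \<forall>j<?d. \<bar>z j - \<psi> p j\<bar> \<le> r}"
  \<comment> \<open>\<open>f\<close> is supported in \<open>K\<close>, which is compact and hence
    closed in a Hausdorff space. So each point outside \<open>V\<close> has a neighbourhood on which
    \<open>f\<close> is 0.\<close>
  define K where "K = inv_into V \<psi> ` ?K0"
  have K0: "?K0 \<subseteq> \<psi> ` V" using r0(2) r(2) by (force simp: cube_def)
  have "compactin (subtopology (Euclidean_space ?d) (\<psi> ` V)) ?K0"
    unfolding compactin_subtopology by (intro conjI compactin_closed_cube K0)
  then have "compactin (mtop M) K" unfolding K_def by (rule image_compactin[OF _ chart_inv_cont[OF M' V]])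
  moreover have "Hausdorff_space (mtop M)" using M by (simp add: smooth_manifold_def)
  ultimately have "closedin (mtop M) K" by (metis compactin_imp_closedin)
  then have Ko: "openin (mtop M) (mspace M - K)" by blast
  have f0: "f q = 0" if "q \<notin> K" for q
  proof (cases "q \<in> V")
    case True
    have "\<psi> q \<notin> ?K0" using that True chart_inv[OF M' V True] unfolding K_def by (metis (no_types, lifting) image_eqI)
    then obtain j where "j < ?d" "\<bar>\<psi> q j - \<psi> p j\<bar> > r" using chart_Rn[OF M' V True] by (auto simp: not_le)
    then show ?thesis using \<xi>(3) by (simp add: f_def)
  qed (simp add: f_def)
  have "f \<in> smooth_fun M"
  proof (rule smooth_funI[OF M'])
    fix W \<kappa> assume W: "(W, \<kappa>) \<in> charts M"
    note ip = plot_chart_inv[OF M W]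
    show "Cinf_on ?d (\<kappa> ` W) (\<lambda>y. f (inv_into W \<kappa> y))"
    proof (rule Cinf_on_local[OF chart_image_open[OF M' W]])
      fix y assume y: "y \<in> \<kappa> ` W"
      show "\<exists>T. opn ?d T \<and> y \<in> T \<and> Cinf_on ?d T (\<lambda>y. f (inv_into W \<kappa> y))"
      proof (cases "inv_into W \<kappa> y \<in> V")
        case True
        let ?T = "\<kappa> ` W \<inter> inv_into W \<kappa> -` V"
        have T: "opn ?d ?T" by (rule plot_preimage[OF ip chart_open[OF M' V]])
        have "Cinf_on ?d ?T (\<lambda>y. (\<lambda>z. F z * \<xi> z) (\<psi> (inv_into W \<kappa> y)))"
          by (rule Cinf_on_compose[OF T o _ _ Cinf_on_mult[OF o F \<xi>V]]) (auto intro: plot_coord[OF M' ip V])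
        then have "Cinf_on ?d ?T (\<lambda>y. f (inv_into W \<kappa> y))"
          using Cinf_on_cong[OF T, of "\<lambda>y. (\<lambda>z. F z * \<xi> z) (\<psi> (inv_into W \<kappa> y))" "\<lambda>y. f (inv_into W \<kappa> y)"]
          by (simp add: f_def)
        then show ?thesis using T y True by blast
      next
        case False
        let ?T = "\<kappa> ` W \<inter> inv_into W \<kappa> -` (mspace M - K)"
        have T: "opn ?d ?T" by (rule plot_preimage[OF ip Ko])
        have "K \<subseteq> V" unfolding K_def using K0 inv_into_into[of _ \<psi> V] by blast
        then have "y \<in> ?T" using y False plot_in[OF ip y] by blast
        moreover have "Cinf_on ?d ?T (\<lambda>y. f (inv_into W \<kappa> y))"
          using Cinf_on_cong[OF T, of "\<lambda>_. 0" "\<lambda>y. f (inv_into W \<kappa> y)"] Cinf_on_const[OF T] f0 by auto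
        ultimately show ?thesis using T by blast
      qed
    qed
  qed
  then show ?thesis using \<xi>V \<xi>(2) by (intro bexI[of _ f] exI[of _ \<xi>]) (auto simp: f_def)
qed

section \<open>Velocities of curves\<close>

definition pt :: "real \<Rightarrow> rvec" where
  "pt t = (\<lambda>i. if i = 0 then t else 0)"

lemma pt_0 [simp]: "pt t 0 = t" by (simp add: pt_def)

lemma pt_Rn: "pt t \<in> Rn 1" by (simp add: pt_def Rn_iff)

lemma pt_cube: "pt t \<in> cube 1 (\<lambda>_. 0) r \<longleftrightarrow> \<bar>t\<bar> < r"
  using pt_Rn by (simp add: cube1 del: One_nat_def)

lemma curve_deriv:
  assumes "Cinf_on 1 I (\<lambda>x. g (x 0))" "pt t \<in> I"
  shows "(g has_real_derivative pd 0 (\<lambda>x. g (x 0)) (pt t)) (at t)"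
  using Cinf_on_has_pd[OF assms(1) _ assms(2), of 0] by simp

lemma velocity_plot_tangent: "velocity M \<gamma> t = plot_tangent 1 M (\<lambda>x. \<gamma> (x 0)) (pt t) (ev 0)"
  by (simp add: velocity_def plot_tangent_def dir_deriv_def pd_def ev_def fun_eq_iff)

lemma velocity_in:
  assumes "smooth_manifold M" "plot M 1 I (\<lambda>x. \<gamma> (x 0))" "pt t \<in> I"
  shows "velocity M \<gamma> t \<in> tangent_space M (\<gamma> t)"
  using plot_tangent_in[OF assms, of "ev 0"] by (simp add: velocity_plot_tangent)

lemma smooth_map_real_line:
  assumes N: "charted N" and \<gamma>: "plot N 1 (Rn 1) (\<lambda>x. \<gamma> (x 0))"
  shows "smooth_map real_line N \<gamma>"
proof (rule smooth_map_of_plots[OF charted_real_line N])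
  fix W \<psi> assume "(W, \<psi>) \<in> charts real_line"
  then have W: "W = UNIV" "\<psi> = (\<lambda>t i. if i = 0 then t else 0)" by (auto simp: real_line_def)
  have "inj \<psi>" unfolding W by (rule injI) metis
  then have "inv_into W \<psi> y = y 0" if "y \<in> \<psi> ` W" for y
    using that inv_into_f_f[of \<psi> W] by (auto simp: W)
  then have "\<gamma> (x 0) = \<gamma> (inv_into W \<psi> x)" if "x \<in> Rn 1" for x
    using that Rn1_range by (simp add: W)
  then have "plot N 1 (Rn 1) (\<lambda>y. \<gamma> (inv_into W \<psi> y))" by (rule plot_cong[OF N \<gamma>])
  then show "plot N (mdim real_line) (\<psi> ` W) (\<lambda>y. \<gamma> (inv_into W \<psi> y))"
    using Rn1_range by (simp add: real_line_def W)
qed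

lemma smooth_curve_plot:
  assumes "charted M" "smooth_map real_line M \<gamma>"
  shows "plot M 1 (Rn 1) (\<lambda>x. \<gamma> (x 0))"
  by (rule smooth_map_plot[OF charted_real_line assms]) (simp add: plot_real_line Cinf_on_coord)

lemma curve_ev_in:
  assumes "plot M 1 I (\<lambda>x. \<gamma> (x 0))" "pt t \<in> I" "openin (mtop M) V" "\<gamma> t \<in> V"
  shows "\<forall>\<^sub>F s in nhds t. \<gamma> s \<in> V"
proof -
  have "opn 1 (I \<inter> (\<lambda>x. \<gamma> (x 0)) -` V)" by (rule plot_preimage[OF assms(1,3)])
  from line_eventually[OF this, of "pt t" 0] assms(2,4)
  have "\<forall>\<^sub>F s in nhds t. (pt t)(0 := s) \<in> I \<inter> (\<lambda>x. \<gamma> (x 0)) -` V" by simp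
  then show ?thesis by eventually_elim simp
qed

lemma curve_coord_deriv:
  assumes M: "charted M" and \<gamma>: "plot M 1 I (\<lambda>x. \<gamma> (x 0))" "pt t \<in> I"
    and V: "(V, \<psi>) \<in> charts M" "\<gamma> t \<in> V" and i: "i < mdim M"
  shows "\<exists>d. ((\<lambda>s. \<psi> (\<gamma> s) i) has_real_derivative d) (at t)"
proof -
  have "Cinf_on 1 (I \<inter> (\<lambda>x. \<gamma> (x 0)) -` V) (\<lambda>x. \<psi> (\<gamma> (x 0)) i)"
    by (rule plot_coord[OF M \<gamma>(1) V(1) i]) auto
  from curve_deriv[OF this, of t] show ?thesis using \<gamma>(2) V(2) by auto
qed

text \<open>Velocities are derivations on global functions, so a coordinate has to be tested through
  a global function. The test function \<open>(\<psi> q i - \<psi> p i) * \<xi> (\<psi> q)\<close>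
  has derivative \<open>\<xi> (\<psi> p)\<close> times that of the coordinate, because its first
  factor vanishes at \<open>p\<close>.\<close>

lemma velocity_coord_unique:
  assumes M: "smooth_manifold M" and V: "(V, \<psi>) \<in> charts M" and p: "p \<in> V" and i: "i < mdim M"
    and \<gamma>: "plot M 1 I (\<lambda>x. \<gamma> (x 0))" "pt 0 \<in> I" "\<gamma> 0 = p"
    and \<beta>: "plot M 1 J (\<lambda>x. \<beta> (x 0))" "pt 0 \<in> J" "\<beta> 0 = p"
    and vel: "velocity M \<gamma> 0 = velocity M \<beta> 0"
    and d: "((\<lambda>s. \<psi> (\<gamma> s) i) has_real_derivative d) (at 0)" "((\<lambda>s. \<psi> (\<beta> s) i) has_real_derivative d') (at 0)"
  shows "d = d'"
proof -
  note M' = smooth_manifold_charted[OF M]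
  have o: "opn (mdim M) (\<psi> ` V)" by (rule chart_image_open[OF M' V])
  have "Cinf_on (mdim M) (\<psi> ` V) (\<lambda>y. y i + - \<psi> p i)"
    by (intro Cinf_on_add Cinf_on_coord Cinf_on_const o)
  from smooth_extension[OF M V p this] obtain f \<xi> where f: "f \<in> smooth_fun M"
    and \<xi>: "Cinf_on (mdim M) (\<psi> ` V) \<xi>" "\<xi> (\<psi> p) > 0" and eq: "\<And>q. q \<in> V \<Longrightarrow> f q = (\<psi> q i - \<psi> p i) * \<xi> (\<psi> q)"
    by auto
  have key: "deriv (\<lambda>s. f (\<alpha> s)) 0 = c * \<xi> (\<psi> p)"
    if \<alpha>: "plot M 1 K (\<lambda>x. \<alpha> (x 0))" "pt 0 \<in> K" "\<alpha> 0 = p"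
      and c: "((\<lambda>s. \<psi> (\<alpha> s) i) has_real_derivative c) (at 0)" for \<alpha> K c
  proof -
    let ?J = "K \<inter> (\<lambda>x. \<alpha> (x 0)) -` V"
    have J: "opn 1 ?J" by (rule plot_preimage[OF \<alpha>(1) chart_open[OF M' V]])
    have \<psi>\<alpha>: "Cinf_on 1 ?J (\<lambda>x. \<psi> (\<alpha> (x 0)) i)" if "i < mdim M" for i
      by (rule plot_coord[OF M' \<alpha>(1) V that]) auto
    have "Cinf_on 1 ?J (\<lambda>x. \<xi> (\<psi> (\<alpha> (x 0))))"
      by (rule Cinf_on_compose[OF J o _ _ \<xi>(1), of "\<lambda>x. \<psi> (\<alpha> (x 0))"]) (use \<psi>\<alpha> in auto)
    from curve_deriv[OF this, of 0] \<alpha>(2,3) p obtain c' where c': "((\<lambda>s. \<xi> (\<psi> (\<alpha> s))) has_real_derivative c') (at 0)" by auto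
    have "((\<lambda>s. (\<psi> (\<alpha> s) i - \<psi> p i) * \<xi> (\<psi> (\<alpha> s))) has_real_derivative c * \<xi> (\<psi> p)) (at 0)"
      by (rule derivative_eq_intros c c' refl)+ (simp add: \<alpha>(3))
    moreover have "\<forall>\<^sub>F s in nhds 0. (\<psi> (\<alpha> s) i - \<psi> p i) * \<xi> (\<psi> (\<alpha> s)) = f (\<alpha> s)"
      by (rule eventually_mono[OF curve_ev_in[OF \<alpha>(1,2) chart_open[OF M' V]]]) (use \<alpha>(3) p eq in auto)
    ultimately have "((\<lambda>s. f (\<alpha> s)) has_real_derivative c * \<xi> (\<psi> p)) (at 0)"
      by (rule DERIV_transfer)
    then show ?thesis by (rule DERIV_imp_deriv)
  qed
  have "deriv (\<lambda>s. f (\<gamma> s)) 0 = deriv (\<lambda>s. f (\<beta> s)) 0"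
    using fun_cong[OF vel, of f] f by (simp add: velocity_def)
  then show ?thesis using key[OF \<gamma> d(1)] key[OF \<beta> d(2)] \<xi>(2) by simp
qed

text \<open>The extension at \<open>t\<close> is the \<open>n\<close>-th power of
  \<open>\<gamma> (t / n)\<close>, for any \<open>n\<close> with
  \<open>\<bar>t\<bar> < n * \<delta>\<close>. Two such exponents agree with their product, and
  \<open>\<gamma> (s / n)\<close> and \<open>\<gamma> (t / n)\<close> commute because addition
  does.\<close>

lemma local_hom_extend:
  fixes G :: "('g, 'm) monoid_scheme" and \<gamma> :: "real \<Rightarrow> 'g"
  assumes G: "group G" and \<delta>: "\<delta> > 0"
    and car: "\<And>t. \<bar>t\<bar> < \<delta> \<Longrightarrow> \<gamma> t \<in> carrier G"
    and hom: "\<And>s t. \<bar>s\<bar> < \<delta> \<Longrightarrow> \<bar>t\<bar> < \<delta> \<Longrightarrow> \<gamma> (s + t) = \<gamma> s \<otimes>\<^bsub>G\<^esub> \<gamma> t"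
  shows "\<exists>\<Gamma>. (\<forall>t. \<Gamma> t \<in> carrier G) \<and> (\<forall>s t. \<Gamma> (s + t) = \<Gamma> s \<otimes>\<^bsub>G\<^esub> \<Gamma> t) \<and> (\<forall>t. \<bar>t\<bar> < \<delta> \<longrightarrow> \<Gamma> t = \<gamma> t)"
proof -
  interpret group G by (rule G)
  have g0: "\<gamma> 0 = \<one>\<^bsub>G\<^esub>" using hom[of 0 0] car[of 0] \<delta> by simp
  have A: "\<gamma> (t / real n) [^]\<^bsub>G\<^esub> n = \<gamma> t" if t: "\<bar>t\<bar> < \<delta>" and n: "n > 0" for t and n :: nat
  proof -
    have "\<gamma> (real k * (t / real n)) = \<gamma> (t / real n) [^]\<^bsub>G\<^esub> k" if "k \<le> n" for k
      using that
    proof (induction k)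
      case 0
      then show ?case using g0 by simp
    next
      case (Suc k)
      have le: "\<bar>real j * (t / real n)\<bar> < \<delta>" if "j \<le> n" for j :: nat
      proof -
        have "\<bar>real j * (t / real n)\<bar> = (real j / real n) * \<bar>t\<bar>" by (simp add: abs_mult)
        also have "\<dots> \<le> 1 * \<bar>t\<bar>" by (rule mult_right_mono) (use that n in auto)
        finally show ?thesis using t by simp
      qed
      have "\<gamma> (real (Suc k) * (t / real n)) = \<gamma> (real k * (t / real n) + t / real n)"
        by (rule arg_cong[where f=\<gamma>]) (simp add: algebra_simps add_divide_distrib)
      also have "\<dots> = \<gamma> (real k * (t / real n)) \<otimes>\<^bsub>G\<^esub> \<gamma> (t / real n)"
        by (rule hom) (use le[of k] le[of 1] Suc.prems in auto)
      finally show ?case using Suc by simp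
    qed
    from this[of n] show ?thesis using n by simp
  qed
  define P where "P n t = \<gamma> (t / real n) [^]\<^bsub>G\<^esub> n" for n :: nat and t
  have div: "\<bar>t / real n\<bar> < \<delta>" if "\<bar>t\<bar> < real n * \<delta>" "n > 0" for t and n :: nat
    using that by (simp add: abs_divide divide_less_eq mult.commute)
  have B: "P (n * m) t = P n t" if "\<bar>t\<bar> < real n * \<delta>" "n > 0" "m > 0" for n m t
  proof -
    have d: "\<bar>t / real n\<bar> < \<delta>" by (rule div[OF that(1,2)])
    have "\<bar>y / real m\<bar> \<le> \<bar>y\<bar>" for y
      using that(3) mult_left_mono[of 1 "real m" "\<bar>y\<bar>"] by (simp add: divide_le_eq)
    from this[of "t / real n"]
    have c: "\<gamma> (t / real n / real m) \<in> carrier G" using d by (intro car) linarith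
    have "P (n * m) t = (\<gamma> (t / real n / real m) [^]\<^bsub>G\<^esub> m) [^]\<^bsub>G\<^esub> n"
      unfolding P_def using nat_pow_pow[OF c, of m n] by (simp add: mult.commute)
    then show ?thesis using A[OF d that(3)] by (simp add: P_def)
  qed
  have C: "P n t = P m t" if "\<bar>t\<bar> < real n * \<delta>" "n > 0" "\<bar>t\<bar> < real m * \<delta>" "m > 0" for n m t
    using B[OF that(1,2,4)] B[OF that(3,4,2)] by (simp add: mult.commute)
  \<comment> \<open>The successor provides the strict inequality
    \<open>\<bar>t\<bar> < N t * \<delta>\<close>.\<close>
  define N where "N t = Suc (nat \<lceil>\<bar>t\<bar> / \<delta>\<rceil>)" for t
  have N: "\<bar>t\<bar> < real (N t) * \<delta>" "N t > 0" for t
  proof -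
    have "\<bar>t\<bar> / \<delta> < real (N t)" unfolding N_def by linarith
    then show "\<bar>t\<bar> < real (N t) * \<delta>" using \<delta> by (simp add: divide_less_eq)
  qed (simp add: N_def)
  define \<Gamma> where "\<Gamma> t = P (N t) t" for t
  have \<Gamma>: "\<Gamma> t = P n t" if "\<bar>t\<bar> < real n * \<delta>" "n > 0" for n t
    unfolding \<Gamma>_def by (rule C[OF N that])
  have Pc: "P n t \<in> carrier G" if "\<bar>t\<bar> < real n * \<delta>" "n > 0" for n t
    unfolding P_def by (intro nat_pow_closed car div that)
  show ?thesis
  proof (intro exI conjI allI impI)
    fix s t
    show "\<Gamma> t \<in> carrier G" unfolding \<Gamma>_def by (rule Pc[OF N])
    \<comment> \<open>One exponent serving \<open>s\<close>, \<open>t\<close> and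
      \<open>s + t\<close>.\<close>
    define n where "n = N (\<bar>s\<bar> + \<bar>t\<bar>)"
    have n: "n > 0" "\<bar>s\<bar> < real n * \<delta>" "\<bar>t\<bar> < real n * \<delta>" "\<bar>s + t\<bar> < real n * \<delta>"
      using N[of "\<bar>s\<bar> + \<bar>t\<bar>"] unfolding n_def by linarith+
    note d = div[OF n(2,1)] div[OF n(3,1)]
    have st: "\<gamma> ((s + t) / real n) = \<gamma> (s / real n) \<otimes>\<^bsub>G\<^esub> \<gamma> (t / real n)"
      using hom[OF d] by (simp add: add_divide_distrib)
    also have "\<gamma> (s / real n) \<otimes>\<^bsub>G\<^esub> \<gamma> (t / real n) = \<gamma> (t / real n) \<otimes>\<^bsub>G\<^esub> \<gamma> (s / real n)"
      using hom[OF d] hom[OF d(2,1)] by (simp add: add.commute)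
    finally have comm: "\<gamma> (s / real n) \<otimes>\<^bsub>G\<^esub> \<gamma> (t / real n) = \<gamma> (t / real n) \<otimes>\<^bsub>G\<^esub> \<gamma> (s / real n)"
      using st by simp
    have "P n (s + t) = P n s \<otimes>\<^bsub>G\<^esub> P n t"
      unfolding P_def st by (rule pow_mult_distrib[OF comm car[OF d(1)] car[OF d(2)]])
    then show "\<Gamma> (s + t) = \<Gamma> s \<otimes>\<^bsub>G\<^esub> \<Gamma> t" using \<Gamma> n by simp
    assume t: "\<bar>t\<bar> < \<delta>"
    then have "\<Gamma> t = P 1 t" by (intro \<Gamma>) auto
    then show "\<Gamma> t = \<gamma> t" using car[OF t] by (simp add: P_def)
  qed
qed

section \<open>One-parameter subgroups\<close>

locale lie_chart =
  fixes G :: "'g lie_struct" and V \<phi>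
  assumes lie: "lie_group G" and chart: "(V, \<phi>) \<in> charts (mfd G)" and oneV: "\<one>\<^bsub>G\<^esub> \<in> V"
begin

abbreviation "n \<equiv> mdim (mfd G)"
abbreviation "e \<equiv> \<phi> \<one>\<^bsub>G\<^esub>"
abbreviation "iv \<equiv> inv_into V \<phi>"

lemma grp: "group G" and mfd: "smooth_manifold (mfd G)" and space: "mspace (mfd G) = carrier G"
  and mult: "smooth_map (prod_manifold (mfd G) (mfd G)) (mfd G) (\<lambda>(g, h). g \<otimes>\<^bsub>G\<^esub> h)"
  using lie by (simp_all add: lie_group_def)

lemma chd: "charted (mfd G)" by (rule smooth_manifold_charted[OF mfd])

lemmas ivl = chart_inv[OF chd chart]
lemmas Vopen = chart_open[OF chd chart]
lemmas imopen = chart_image_open[OF chd chart]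

lemma V_carrier: "p \<in> V \<Longrightarrow> p \<in> carrier G"
  using openin_subset[OF Vopen] space by blast

lemma iv_V: "y \<in> \<phi> ` V \<Longrightarrow> iv y \<in> V" "y \<in> \<phi> ` V \<Longrightarrow> \<phi> (iv y) = y"
  by (auto simp: inv_into_into f_inv_into_f)

lemma phiR: "p \<in> V \<Longrightarrow> \<phi> p \<in> Rn n"
  by (rule chart_Rn[OF chd chart])

lemma eV: "e \<in> \<phi> ` V" using oneV by blast

lemma eR: "e \<in> Rn n" by (rule phiR[OF oneV])

lemma plot_mult: "plot (mfd G) m U P \<Longrightarrow> plot (mfd G) m U Q \<Longrightarrow> plot (mfd G) m U (\<lambda>x. P x \<otimes>\<^bsub>G\<^esub> Q x)"
  by (rule plot_smooth_map2[OF chd chd chd mult])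

text \<open>Concatenated coordinates of pairs of elements of \<open>V\<close>, the domain of
  multiplication in coordinates; \<open>O3\<close> below consists of the pairs whose product lies in
  \<open>V\<close> as well.\<close>

definition O2 :: "rvec set" where
  "O2 = (Rn (n + n) \<inter> lo n -` (\<phi> ` V)) \<inter> (Rn (n + n) \<inter> hi n n -` (\<phi> ` V))"

definition mu :: "rvec \<Rightarrow> 'g" where
  "mu z = iv (lo n z) \<otimes>\<^bsub>G\<^esub> iv (hi n n z)"

lemma O2_open: "opn (n + n) O2"
  unfolding O2_def
  by (intro openin_Int openin_sub_preimage[OF _ _ imopen]) (simp_all add: continuous_map_lo continuous_map_hi)

lemma Cinf_lo: "opn m U \<Longrightarrow> Cinf_on m U (\<lambda>z. lo k z i)"
  by (cases "i < k") (simp_all add: lo_def Cinf_on_coord Cinf_on_const)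

lemma Cinf_hi: "opn m U \<Longrightarrow> Cinf_on m U (\<lambda>z. hi j k z i)"
  by (cases "i < k") (simp_all add: hi_def Cinf_on_coord Cinf_on_const)

lemma plot_mu: "plot (mfd G) (n + n) O2 mu"
  unfolding mu_def[abs_def]
  by (intro plot_mult plot_of_chart[OF mfd chart O2_open] Cinf_lo Cinf_hi O2_open) (auto simp: O2_def)

definition O3 :: "rvec set" where
  "O3 = O2 \<inter> mu -` V"

lemma O3_open: "opn (n + n) O3"
  unfolding O3_def by (rule plot_preimage[OF plot_mu Vopen])

lemma Cinf_mu: "i < n \<Longrightarrow> Cinf_on (n + n) O3 (\<lambda>z. \<phi> (mu z) i)"
  by (rule plot_coord[OF chd plot_mu chart]) (auto simp: O3_def)

lemma cat_O3:
  assumes "p \<in> V" "q \<in> V" "p \<otimes>\<^bsub>G\<^esub> q \<in> V"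
  shows "cat n (\<phi> p) (\<phi> q) \<in> O3" "mu (cat n (\<phi> p) (\<phi> q)) = p \<otimes>\<^bsub>G\<^esub> q"
proof -
  have l: "lo n (cat n (\<phi> p) (\<phi> q)) = \<phi> p" "hi n n (cat n (\<phi> p) (\<phi> q)) = \<phi> q"
    using phiR assms by (simp_all add: lo_cat hi_cat)
  then show m: "mu (cat n (\<phi> p) (\<phi> q)) = p \<otimes>\<^bsub>G\<^esub> q" using assms by (simp add: mu_def ivl)
  show "cat n (\<phi> p) (\<phi> q) \<in> O3"
    using l m assms phiR by (simp add: O3_def O2_def cat_Rn)
qed

text \<open>The left-invariant vector field with value \<open>z\<close> at \<open>1\<close>.\<close>

definition F :: "rvec \<Rightarrow> nat \<Rightarrow> rvec \<Rightarrow> real" where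
  "F z i a = (\<Sum>j<n. pd (n + j) (\<lambda>w. \<phi> (mu w) i) (cat n a e) * z j)"

lemma cat_e: "a \<in> \<phi> ` V \<Longrightarrow> cat n a e \<in> O3"
proof -
  assume "a \<in> \<phi> ` V"
  then obtain p where "p \<in> V" "a = \<phi> p" by blast
  then show ?thesis
    using cat_O3(1)[of p "\<one>\<^bsub>G\<^esub>"] oneV V_carrier group.is_monoid[OF grp] monoid.r_one by fastforce
qed

lemma Cinf_F: "i < n \<Longrightarrow> Cinf_on n (\<phi> ` V) (F z i)"
  unfolding F_def[abs_def]
proof (intro Cinf_on_sum Cinf_on_mult Cinf_on_const imopen)
  fix j assume i: "i < n" and j: "j \<in> {..<n}"
  show "Cinf_on n (\<phi> ` V) (\<lambda>a. pd (n + j) (\<lambda>w. \<phi> (mu w) i) (cat n a e))"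
  proof (rule Cinf_on_compose[OF imopen O3_open cat_e])
    show "Cinf_on (n + n) O3 (pd (n + j) (\<lambda>w. \<phi> (mu w) i))"
      by (rule Cinf_on_pd[OF Cinf_mu[OF i]]) (use j in simp)
    fix k
    show "Cinf_on n (\<phi> ` V) (\<lambda>a. cat n a e k)"
      by (cases "k < n") (simp_all add: cat_def Cinf_on_coord Cinf_on_const imopen)
  qed
qed

lemma sum_split: "(\<Sum>i<m + k. f i) = (\<Sum>i<m. f i) + (\<Sum>j<k. f (m + j :: nat))" for f :: "nat \<Rightarrow> real"
  by (induction k) (simp_all add: add.assoc)

lemma C1_mu: "i < n \<Longrightarrow> Ck_on 1 (n + n) O3 (\<lambda>z. \<phi> (mu z) i)"
  by (rule Cinf_Ck[OF Cinf_mu])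

lemma mult_deriv2:
  assumes \<alpha>: "\<forall>\<^sub>F s in nhds 0. \<alpha> s \<in> V" and \<beta>: "\<forall>\<^sub>F s in nhds 0. \<beta> s \<in> V"
    and p: "\<alpha> 0 = p" "\<beta> 0 = q" and V: "p \<in> V" "q \<in> V" "p \<otimes>\<^bsub>G\<^esub> q \<in> V" and i: "i < n"
    and \<alpha>d: "\<And>j. j < n \<Longrightarrow> ((\<lambda>s. \<phi> (\<alpha> s) j) has_real_derivative y j) (at 0)"
    and \<beta>d: "\<And>j. j < n \<Longrightarrow> ((\<lambda>s. \<phi> (\<beta> s) j) has_real_derivative z j) (at 0)"
  shows "((\<lambda>s. \<phi> (\<alpha> s \<otimes>\<^bsub>G\<^esub> \<beta> s) i) has_real_derivative
     (\<Sum>j<n. pd j (\<lambda>w. \<phi> (mu w) i) (cat n (\<phi> p) (\<phi> q)) * y j) +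
     (\<Sum>j<n. pd (n + j) (\<lambda>w. \<phi> (mu w) i) (cat n (\<phi> p) (\<phi> q)) * z j)) (at 0)"
proof -
  let ?h = "\<lambda>s. cat n (\<phi> (\<alpha> s)) (\<phi> (\<beta> s))"
  have "((\<lambda>s. \<phi> (mu (?h s)) i) has_real_derivative
      (\<Sum>k<n + n. pd k (\<lambda>w. \<phi> (mu w) i) (?h 0) * (if k < n then y k else z (k - n)))) (at 0)"
  proof (rule C1_curve[OF O3_open C1_mu[OF i]])
    show "?h 0 \<in> O3" using cat_O3(1)[OF V] p by simp
    show "\<forall>\<^sub>F s in nhds 0. ?h s \<in> Rn (n + n)"
      using \<beta> by eventually_elim (auto intro: cat_Rn phiR)
    show "((\<lambda>s. ?h s k) has_real_derivative (if k < n then y k else z (k - n))) (at 0)" if "k < n + n" for k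
      using \<alpha>d[of k] \<beta>d[of "k - n"] that by (cases "k < n") (simp_all add: cat_def)
  qed
  moreover have "\<forall>\<^sub>F s in nhds 0. \<phi> (mu (?h s)) i = \<phi> (\<alpha> s \<otimes>\<^bsub>G\<^esub> \<beta> s) i"
    using \<alpha> \<beta> by eventually_elim (simp add: mu_def lo_cat hi_cat phiR ivl)
  ultimately show ?thesis
    unfolding sum_split p using DERIV_cong_ev[OF refl, of "\<lambda>s. \<phi> (mu (?h s)) i" "\<lambda>s. \<phi> (\<alpha> s \<otimes>\<^bsub>G\<^esub> \<beta> s) i" 0] by simp
qed

text \<open>The field \<open>F\<close> arises by differentiating right multiplication by a curve
  through 1.\<close>

lemma mult_deriv:
  assumes \<beta>: "\<forall>\<^sub>F s in nhds 0. \<beta> s \<in> V" "\<beta> 0 = \<one>\<^bsub>G\<^esub>" and g: "g \<in> V" and i: "i < n"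
    and \<beta>d: "\<And>j. j < n \<Longrightarrow> ((\<lambda>s. \<phi> (\<beta> s) j) has_real_derivative z j) (at 0)"
  shows "((\<lambda>s. \<phi> (g \<otimes>\<^bsub>G\<^esub> \<beta> s) i) has_real_derivative F z i (\<phi> g)) (at 0)"
proof -
  have g1: "g \<otimes>\<^bsub>G\<^esub> \<one>\<^bsub>G\<^esub> = g" using V_carrier[OF g] monoid.r_one[OF group.is_monoid[OF grp]] by blast
  have "((\<lambda>s. \<phi> ((\<lambda>_. g) s \<otimes>\<^bsub>G\<^esub> \<beta> s) i) has_real_derivative
     (\<Sum>j<n. pd j (\<lambda>w. \<phi> (mu w) i) (cat n (\<phi> g) e) * 0) +
     (\<Sum>j<n. pd (n + j) (\<lambda>w. \<phi> (mu w) i) (cat n (\<phi> g) e) * z j)) (at 0)"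
    by (rule mult_deriv2[OF _ \<beta>(1) _ \<beta>(2)]) (use g oneV i \<beta>d g1 in auto)
  then show ?thesis by (simp add: F_def)
qed

text \<open>A curve through 1 that is straight in coordinates. It provides a prescribed velocity
  before one-parameter subgroups are available.\<close>

lemma line_curve:
  obtains \<beta> where "\<forall>\<^sub>F s in nhds 0. \<beta> s \<in> V" "\<beta> 0 = \<one>\<^bsub>G\<^esub>"
    "\<And>j. j < n \<Longrightarrow> ((\<lambda>s. \<phi> (\<beta> s) j) has_real_derivative z j) (at (0::real))"
    "\<forall>\<^sub>F s in nhds 0. \<phi> (\<beta> s) = (\<lambda>i. e i + s * lo n z i)"
proof
  define h where "h s = (\<lambda>i. e i + s * lo n z i)" for s
  define \<beta> where "\<beta> s = iv (h s)" for s
  obtain r where r: "r > 0" "cube n e r \<subseteq> \<phi> ` V" using opn_cube[OF imopen eV] by blast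
  have hR: "h s \<in> Rn n" for s using eR by (simp add: h_def Rn_iff lo_def)
  have "\<forall>\<^sub>F s in nhds 0. \<forall>i\<in>{..<n}. \<bar>h s i - e i\<bar> < r"
  proof (intro eventually_ball_finite ballI)
    fix i
    have "((\<lambda>s. \<bar>h s i - e i\<bar>) \<longlongrightarrow> \<bar>h 0 i - e i\<bar>) (nhds 0)"
      unfolding h_def by (intro tendsto_intros filterlim_ident)
    then show "\<forall>\<^sub>F s in nhds 0. \<bar>h s i - e i\<bar> < r"
      by (rule order_tendstoD) (simp add: h_def r)
  qed simp
  then have ev: "\<forall>\<^sub>F s in nhds 0. h s \<in> \<phi> ` V"
    by eventually_elim (use r hR in \<open>auto simp: cube_def\<close>)
  then show "\<forall>\<^sub>F s in nhds 0. \<beta> s \<in> V" by eventually_elim (simp add: \<beta>_def iv_V)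
  show "\<beta> 0 = \<one>\<^bsub>G\<^esub>" by (simp add: \<beta>_def h_def ivl oneV)
  show eq: "\<forall>\<^sub>F s in nhds 0. \<phi> (\<beta> s) = (\<lambda>i. e i + s * lo n z i)"
    using ev by eventually_elim (simp add: \<beta>_def iv_V, simp add: h_def)
  fix j assume j: "j < n"
  have "((\<lambda>s. e j + s * lo n z j) has_real_derivative z j) (at 0)"
    using j by (auto intro!: derivative_eq_intros simp: lo_def)
  moreover have "\<forall>\<^sub>F s in nhds 0. e j + s * lo n z j = \<phi> (\<beta> s) j" using eq by eventually_elim simp
  ultimately show "((\<lambda>s. \<phi> (\<beta> s) j) has_real_derivative z j) (at 0)"
    by (rule DERIV_transfer)
qed

text \<open>Multiplying a curve by 1 does not change its derivative.\<close>

lemma F_one: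
  assumes j: "j < n"
  shows "F z j e = z j"
proof -
  obtain \<beta> where \<beta>: "\<forall>\<^sub>F s in nhds 0. \<beta> s \<in> V" "\<beta> 0 = \<one>\<^bsub>G\<^esub>"
    "\<And>j. j < n \<Longrightarrow> ((\<lambda>s. \<phi> (\<beta> s) j) has_real_derivative z j) (at 0)"
    by (rule line_curve[of z]) blast
  have "((\<lambda>s. \<phi> (\<one>\<^bsub>G\<^esub> \<otimes>\<^bsub>G\<^esub> \<beta> s) j) has_real_derivative F z j e) (at 0)"
    by (rule mult_deriv[OF \<beta>(1,2) oneV j \<beta>(3)])
  moreover have "\<forall>\<^sub>F s in nhds 0. \<phi> (\<one>\<^bsub>G\<^esub> \<otimes>\<^bsub>G\<^esub> \<beta> s) j = \<phi> (\<beta> s) j"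
    using \<beta>(1) by eventually_elim (use monoid.l_one[OF group.is_monoid[OF grp]] V_carrier in simp)
  ultimately have "((\<lambda>s. \<phi> (\<beta> s) j) has_real_derivative F z j e) (at 0)"
    by (rule DERIV_transfer)
  then show ?thesis using \<beta>(3)[OF j] by (rule DERIV_unique)
qed

section \<open>One-parameter subgroups and the exponential map\<close>

lemma one_param_one: "one_param_subgroup G \<Gamma> \<Longrightarrow> \<Gamma> 0 = \<one>\<^bsub>G\<^esub>"
proof -
  assume \<Gamma>: "one_param_subgroup G \<Gamma>"
  interpret group G by (rule grp)
  have "\<Gamma> 0 \<in> carrier G"
    using \<Gamma> space by (auto simp: one_param_subgroup_def smooth_map_def continuous_map_def real_line_def)
  moreover have "\<Gamma> 0 = \<Gamma> 0 \<otimes>\<^bsub>G\<^esub> \<Gamma> 0" using \<Gamma> unfolding one_param_subgroup_def by (metis add.right_neutral)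
  ultimately show ?thesis by simp
qed

lemma one_param_plot: "one_param_subgroup G \<Gamma> \<Longrightarrow> plot (mfd G) 1 (Rn 1) (\<lambda>x. \<Gamma> (x 0))"
  by (rule smooth_curve_plot[OF chd]) (simp add: one_param_subgroup_def)

lemma one_param_carrier: "one_param_subgroup G \<Gamma> \<Longrightarrow> \<Gamma> t \<in> carrier G"
  using plot_in[OF one_param_plot pt_Rn, of \<Gamma> t] space by simp

lemma one_param_near: "one_param_subgroup G \<Gamma> \<Longrightarrow> openin (mtop (mfd G)) W \<Longrightarrow> \<Gamma> t \<in> W \<Longrightarrow> \<forall>\<^sub>F s in nhds t. \<Gamma> s \<in> W"
  by (rule curve_ev_in[OF one_param_plot pt_Rn])

text \<open>Differentiation of \<open>\<Gamma> (s + t) = \<Gamma> t \<otimes> \<Gamma> s\<close> at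
  \<open>s = 0\<close>.\<close>

lemma one_param_ode:
  assumes \<Gamma>: "one_param_subgroup G \<Gamma>" and t: "\<Gamma> t \<in> V" and i: "i < n"
    and z: "\<And>j. j < n \<Longrightarrow> ((\<lambda>s. \<phi> (\<Gamma> s) j) has_real_derivative z j) (at 0)"
  shows "((\<lambda>s. \<phi> (\<Gamma> s) i) has_real_derivative F z i (\<phi> (\<Gamma> t))) (at t)"
proof -
  have "((\<lambda>s. \<phi> (\<Gamma> t \<otimes>\<^bsub>G\<^esub> \<Gamma> s) i) has_real_derivative F z i (\<phi> (\<Gamma> t))) (at 0)"
    using one_param_one[OF \<Gamma>] oneV
    by (intro mult_deriv one_param_near[OF \<Gamma> Vopen] t i z) auto
  moreover have "\<Gamma> t \<otimes>\<^bsub>G\<^esub> \<Gamma> s = \<Gamma> (s + t)" for s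
    using \<Gamma> unfolding one_param_subgroup_def by (metis add.commute)
  ultimately show ?thesis using DERIV_shift[of "\<lambda>s. \<phi> (\<Gamma> s) i" "F z i (\<phi> (\<Gamma> t))" 0 t] by simp
qed

lemma one_param_pow:
  assumes "one_param_subgroup G \<Gamma>"
  shows "\<Gamma> (real k * t) = \<Gamma> t [^]\<^bsub>G\<^esub> k"
proof (induction k)
  case 0
  then show ?case using one_param_one[OF assms] by simp
next
  case (Suc k)
  have "\<Gamma> (real (Suc k) * t) = \<Gamma> (real k * t + t)" by (rule arg_cong[where f=\<Gamma>]) (simp add: algebra_simps)
  then show ?case using assms Suc unfolding one_param_subgroup_def by simp
qed

lemma lip_constants:
  obtains r L \<tau> where "r > 0" "L \<ge> 0" "\<tau> > 0" "cube n e r \<subseteq> \<phi> ` V" "real n * L * \<tau> < 1"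
    "\<And>i y w. i < n \<Longrightarrow> y \<in> cube n e r \<Longrightarrow> w \<in> cube n e r \<Longrightarrow> \<bar>F z i y - F z i w\<bar> \<le> L * (\<Sum>j<n. \<bar>y j - w j\<bar>)"
proof -
  obtain r L where r: "r > 0" "L \<ge> 0" "cube n e r \<subseteq> \<phi> ` V"
    "\<And>i y w. i < n \<Longrightarrow> y \<in> cube n e r \<Longrightarrow> w \<in> cube n e r \<Longrightarrow> \<bar>F z i y - F z i w\<bar> \<le> L * (\<Sum>j<n. \<bar>y j - w j\<bar>)"
    using C1_lipschitz[where F="F z", OF imopen Cinf_Ck[OF Cinf_F] eV] by blast
  have "real n * L * (1 / (real n * L + 1)) < 1" using r(2) by (simp add: add_nonneg_pos)
  then show thesis using that[of r L "1 / (real n * L + 1)"] r by (simp add: add_nonneg_pos)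
qed

text \<open>The differential equation lives in the chart and gives equality near 0 only; from there,
  \<open>\<Gamma> t\<close> is a power of \<open>\<Gamma> (t / k)\<close>.\<close>

lemma one_param_unique:
  assumes \<Gamma>: "one_param_subgroup G \<Gamma>" and \<Delta>: "one_param_subgroup G \<Delta>"
    and z: "\<And>j. j < n \<Longrightarrow> ((\<lambda>s. \<phi> (\<Gamma> s) j) has_real_derivative z j) (at 0)"
      "\<And>j. j < n \<Longrightarrow> ((\<lambda>s. \<phi> (\<Delta> s) j) has_real_derivative z j) (at 0)"
  shows "\<Gamma> = \<Delta>"
proof
  fix t
  obtain r L \<tau> where r: "r > 0" "L \<ge> 0" "\<tau> > 0" "cube n e r \<subseteq> \<phi> ` V" "real n * L * \<tau> < 1"
    "\<And>i y w. i < n \<Longrightarrow> y \<in> cube n e r \<Longrightarrow> w \<in> cube n e r \<Longrightarrow> \<bar>F z i y - F z i w\<bar> \<le> L * (\<Sum>j<n. \<bar>y j - w j\<bar>)"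
    by (rule lip_constants[of z]) blast
  define W where "W = V \<inter> \<phi> -` cube n e r"
  have W: "openin (mtop (mfd G)) W" "\<one>\<^bsub>G\<^esub> \<in> W"
    unfolding W_def using openin_sub_preimage[OF Vopen chart_cont[OF chd chart] openin_cube] oneV cube_self[OF eR r(1)] by auto
  have "\<forall>\<^sub>F s in nhds 0. \<Gamma> s \<in> W \<and> \<Delta> s \<in> W"
    using one_param_near[OF \<Gamma> W(1), of 0] one_param_near[OF \<Delta> W(1), of 0] W(2)
      one_param_one[OF \<Gamma>] one_param_one[OF \<Delta>] by (simp add: eventually_conj)
  then obtain d where d: "d > 0" "\<And>s. \<bar>s\<bar> < d \<Longrightarrow> \<Gamma> s \<in> W \<and> \<Delta> s \<in> W"
    unfolding eventually_nhds_metric by (auto simp: dist_real_def)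
  define \<sigma> where "\<sigma> = min \<tau> (d / 2)"
  have \<sigma>: "\<sigma> > 0" "\<sigma> \<le> \<tau>" "\<sigma> < d" using d r by (auto simp: \<sigma>_def)
  have near: "\<Gamma> s = \<Delta> s" if s: "\<bar>s\<bar> \<le> \<sigma>" for s
  proof -
    have "\<phi> (\<Gamma> s) = \<phi> (\<Delta> s)"
    proof (rule ode_unique[where S="cube n e r" and n=n and L=L and \<tau>=\<sigma> and F="F z"
          and a="\<lambda>s. \<phi> (\<Gamma> s)" and b="\<lambda>s. \<phi> (\<Delta> s)"])
      have "real n * L * \<sigma> \<le> real n * L * \<tau>" using r \<sigma> by (intro mult_left_mono) auto
      then show "real n * L * \<sigma> < 1" using r(5) by linarith
    qed (use d \<sigma> s r one_param_one[OF \<Gamma>] one_param_one[OF \<Delta>] in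
          \<open>auto simp: W_def cube_def intro!: one_param_ode[OF \<Gamma> _ _ z(1)] one_param_ode[OF \<Delta> _ _ z(2)]\<close>)
    then show ?thesis using d(2)[of s] s \<sigma> chart_inj[OF chd chart] by (auto simp: W_def inj_on_def)
  qed
  obtain k :: nat where k: "\<bar>t\<bar> / \<sigma> < real k" using reals_Archimedean2 by blast
  then have k0: "real k > 0" using \<sigma>(1) by (smt (verit) divide_nonneg_pos)
  have "\<bar>t / real k\<bar> \<le> \<sigma>" using k k0 \<sigma>(1) by (simp add: abs_divide field_simps)
  then have "\<Gamma> (t / real k) = \<Delta> (t / real k)" by (rule near)
  then show "\<Gamma> t = \<Delta> t"
    using one_param_pow[OF \<Gamma>, of k "t / real k"] one_param_pow[OF \<Delta>, of k "t / real k"] k0 by simp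
qed

text \<open>The solution through 1 is a local homomorphism: for fixed \<open>s\<close> both
  \<open>t \<mapsto> \<gamma> (s + t)\<close> and
  \<open>t \<mapsto> \<gamma> s \<otimes> \<gamma> t\<close> solve the equation with the same
  initial value. It then extends to the line by powers.\<close>

lemma one_param_exists:
  obtains \<Gamma> where "one_param_subgroup G \<Gamma>" "\<And>j. j < n \<Longrightarrow> ((\<lambda>s. \<phi> (\<Gamma> s) j) has_real_derivative z j) (at 0)"
proof -
  interpret group G by (rule grp)
  obtain r L \<tau>1 where r: "r > 0" "L \<ge> 0" "\<tau>1 > 0" "cube n e r \<subseteq> \<phi> ` V" "real n * L * \<tau>1 < 1"
    "\<And>i y w. i < n \<Longrightarrow> y \<in> cube n e r \<Longrightarrow> w \<in> cube n e r \<Longrightarrow> \<bar>F z i y - F z i w\<bar> \<le> L * (\<Sum>j<n. \<bar>y j - w j\<bar>)"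
    by (rule lip_constants[of z]) blast
  obtain \<tau> a where \<tau>: "\<tau> > 0" and a0: "a 0 = e" and aR: "\<And>t. a t \<in> Rn n"
    and aV: "\<And>t. \<bar>t\<bar> < \<tau> \<Longrightarrow> a t \<in> \<phi> ` V"
    and ad: "\<And>t i. \<bar>t\<bar> < \<tau> \<Longrightarrow> i < n \<Longrightarrow> ((\<lambda>s. a s i) has_real_derivative F z i (a t)) (at t)"
    using ode_exists[where F="F z", OF imopen Cinf_Ck[OF Cinf_F] eV] by blast
  define \<gamma> where "\<gamma> t = iv (a t)" for t
  have \<gamma>V: "\<gamma> t \<in> V" "\<phi> (\<gamma> t) = a t" if "\<bar>t\<bar> < \<tau>" for t
    using iv_V[OF aV[OF that]] by (simp_all add: \<gamma>_def)
  have \<gamma>0: "\<gamma> 0 = \<one>\<^bsub>G\<^esub>" by (simp add: \<gamma>_def a0 ivl oneV)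
  have \<gamma>plot: "plot (mfd G) 1 (cube 1 (\<lambda>_. 0) \<tau>) (\<lambda>x. \<gamma> (x 0))"
    unfolding \<gamma>_def
    by (rule plot_of_chart[OF mfd chart openin_cube])
       (use aV ode_smooth[where F="F z", OF imopen Cinf_F aV ad] in \<open>auto simp: cube1 simp del: One_nat_def\<close>)
  text \<open>Left translates of solutions are solutions: both sides are compared with the derivative of
    \<open>g \<gamma>(t) \<beta>(s)\<close> at \<open>s = 0\<close> for a curve \<open>\<beta>\<close> with velocity \<open>z\<close> at \<open>1\<close>.\<close>
  have trans: "((\<lambda>s. \<phi> (g \<otimes>\<^bsub>G\<^esub> \<gamma> s) i) has_real_derivative F z i (\<phi> (g \<otimes>\<^bsub>G\<^esub> \<gamma> t))) (at t)"
    if g: "g \<in> carrier G" and t: "\<bar>t\<bar> < \<tau>" and gt: "g \<otimes>\<^bsub>G\<^esub> \<gamma> t \<in> V" and i: "i < n" for g t i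
  proof -
    obtain \<beta> where \<beta>: "\<forall>\<^sub>F s in nhds 0. \<beta> s \<in> V" "\<beta> 0 = \<one>\<^bsub>G\<^esub>"
      "\<And>j. j < n \<Longrightarrow> ((\<lambda>s. \<phi> (\<beta> s) j) has_real_derivative z j) (at 0)"
      by (rule line_curve[of z]) blast
    let ?P = "\<lambda>y. g \<otimes>\<^bsub>G\<^esub> iv y"
    have P: "plot (mfd G) n (\<phi> ` V) ?P"
      by (intro plot_mult plot_const[OF chd _ imopen] plot_chart_inv[OF mfd chart]) (use g space in auto)
    let ?D = "\<phi> ` V \<inter> ?P -` V"
    have D: "opn n ?D" by (rule plot_preimage[OF P Vopen])
    have C: "Ck_on 1 n ?D (\<lambda>y. \<phi> (?P y) i)"
      by (rule Cinf_Ck, rule plot_coord[OF chd P chart i]) auto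
    have inD: "a t \<in> ?D" using aV[OF t] gt by (simp add: \<gamma>_def)
    have 1: "((\<lambda>s. \<phi> (?P (a s)) i) has_real_derivative (\<Sum>k<n. pd k (\<lambda>y. \<phi> (?P y) i) (a t) * F z k (a t))) (at t)"
      by (rule C1_curve[where h=a and t=t, OF D C inD]) (use aR ad[OF t] in auto)
    have c: "\<gamma> t \<in> carrier G" using V_carrier \<gamma>V(1)[OF t] by blast
    have \<gamma>\<beta>: "\<forall>\<^sub>F s in nhds 0. \<gamma> t \<otimes>\<^bsub>G\<^esub> \<beta> s \<in> V"
    proof -
      let ?Q = "\<lambda>y. \<gamma> t \<otimes>\<^bsub>G\<^esub> iv y"
      have Q: "plot (mfd G) n (\<phi> ` V) ?Q"
        by (intro plot_mult plot_const[OF chd _ imopen] plot_chart_inv[OF mfd chart]) (use c space in auto)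
      have QD: "opn n (\<phi> ` V \<inter> ?Q -` V)" by (rule plot_preimage[OF Q Vopen])
      have "e \<in> \<phi> ` V \<inter> ?Q -` V" using oneV c \<gamma>V(1)[OF t] by (simp add: ivl)
      then obtain \<rho> where \<rho>: "\<rho> > 0" "cube n e \<rho> \<subseteq> \<phi> ` V \<inter> ?Q -` V" using opn_cube[OF QD] by blast
      have "\<forall>\<^sub>F s in nhds 0. \<forall>j\<in>{..<n}. \<bar>\<phi> (\<beta> s) j - e j\<bar> < \<rho>"
        using coords_near[where h="\<lambda>s. \<phi> (\<beta> s)", OF \<beta>(3) \<rho>(1)] \<beta>(2) by simp
      with \<beta>(1) show ?thesis
      proof eventually_elim
        case (elim s)
        then have "\<phi> (\<beta> s) \<in> cube n e \<rho>" using phiR by (auto simp: cube_def)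
        then show ?case using \<rho>(2) elim(1) by (auto simp: ivl)
      qed
    qed
    have d\<beta>: "((\<lambda>s. \<phi> (\<gamma> t \<otimes>\<^bsub>G\<^esub> \<beta> s) k) has_real_derivative F z k (a t)) (at 0)" if "k < n" for k
      using mult_deriv[OF \<beta>(1,2) \<gamma>V(1)[OF t] that \<beta>(3)] \<gamma>V(2)[OF t] by simp
    have 2: "((\<lambda>s. \<phi> (?P (\<phi> (\<gamma> t \<otimes>\<^bsub>G\<^esub> \<beta> s))) i) has_real_derivative
        (\<Sum>k<n. pd k (\<lambda>y. \<phi> (?P y) i) (\<phi> (\<gamma> t \<otimes>\<^bsub>G\<^esub> \<beta> 0)) * F z k (a t))) (at 0)"
    proof (rule C1_curve[where h="\<lambda>s. \<phi> (\<gamma> t \<otimes>\<^bsub>G\<^esub> \<beta> s)" and t=0, OF D C])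
      show "\<phi> (\<gamma> t \<otimes>\<^bsub>G\<^esub> \<beta> 0) \<in> ?D" using inD \<beta>(2) c \<gamma>V(2)[OF t] by simp
      show "\<forall>\<^sub>F s in nhds 0. \<phi> (\<gamma> t \<otimes>\<^bsub>G\<^esub> \<beta> s) \<in> Rn n" using \<gamma>\<beta> by eventually_elim (rule phiR)
    qed (rule d\<beta>)
    have "\<forall>\<^sub>F s in nhds 0. \<phi> (?P (\<phi> (\<gamma> t \<otimes>\<^bsub>G\<^esub> \<beta> s))) i = \<phi> ((g \<otimes>\<^bsub>G\<^esub> \<gamma> t) \<otimes>\<^bsub>G\<^esub> \<beta> s) i"
      using \<gamma>\<beta> \<beta>(1) by eventually_elim (use g c V_carrier in \<open>simp add: ivl m_assoc\<close>)
    then have "((\<lambda>s. \<phi> ((g \<otimes>\<^bsub>G\<^esub> \<gamma> t) \<otimes>\<^bsub>G\<^esub> \<beta> s) i) has_real_derivative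
        (\<Sum>k<n. pd k (\<lambda>y. \<phi> (?P y) i) (a t) * F z k (a t))) (at 0)"
      using 2 \<gamma>V(2)[OF t] \<beta>(2) c
        DERIV_cong_ev[OF refl, of "\<lambda>s. \<phi> (?P (\<phi> (\<gamma> t \<otimes>\<^bsub>G\<^esub> \<beta> s))) i" "\<lambda>s. \<phi> ((g \<otimes>\<^bsub>G\<^esub> \<gamma> t) \<otimes>\<^bsub>G\<^esub> \<beta> s) i" 0] by simp
    moreover have "((\<lambda>s. \<phi> ((g \<otimes>\<^bsub>G\<^esub> \<gamma> t) \<otimes>\<^bsub>G\<^esub> \<beta> s) i) has_real_derivative F z i (\<phi> (g \<otimes>\<^bsub>G\<^esub> \<gamma> t))) (at 0)"
      by (rule mult_deriv[OF \<beta>(1,2) gt i \<beta>(3)])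
    ultimately have "(\<Sum>k<n. pd k (\<lambda>y. \<phi> (?P y) i) (a t) * F z k (a t)) = F z i (\<phi> (g \<otimes>\<^bsub>G\<^esub> \<gamma> t))"
      by (rule DERIV_unique)
    then show ?thesis using 1 by (simp add: \<gamma>_def)
  qed
  \<comment> \<open>Uniqueness is applied in the cube where the field is Lipschitz, so products of
    small elements have to stay in its preimage \<open>W\<close>.\<close>
  define W where "W = V \<inter> \<phi> -` cube n e r"
  have Wo: "openin (mtop (mfd G)) W"
    unfolding W_def by (rule openin_sub_preimage[OF Vopen chart_cont[OF chd chart] openin_cube])
  have W1: "\<one>\<^bsub>G\<^esub> \<in> W" using oneV cube_self[OF eR r(1)] by (simp add: W_def)
  have o: "opn (n + n) (O2 \<inter> mu -` W)" by (rule plot_preimage[OF plot_mu Wo])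
  have "cat n e e \<in> O2 \<inter> mu -` W"
    using cat_O3[of "\<one>\<^bsub>G\<^esub>" "\<one>\<^bsub>G\<^esub>"] oneV W1 by (simp add: O3_def)
  then obtain \<rho> where \<rho>: "\<rho> > 0" "cube (n + n) (cat n e e) \<rho> \<subseteq> O2 \<inter> mu -` W" using opn_cube[OF o] by blast
  have "\<forall>\<^sub>F s in nhds 0. \<forall>j\<in>{..<n}. \<bar>a s j - e j\<bar> < min \<rho> r"
    using coords_near[where h=a and t=0 and z="\<lambda>j. F z j (a 0)" and n=n and r="min \<rho> r", OF ad] \<tau> \<rho>(1) r(1) a0 by simp
  then obtain d where d: "d > 0" "\<And>s j. \<bar>s\<bar> < d \<Longrightarrow> j < n \<Longrightarrow> \<bar>a s j - e j\<bar> < min \<rho> r"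
    unfolding eventually_nhds_metric by (auto simp: dist_real_def)
  \<comment> \<open>Both \<open>s\<close> and \<open>t\<close> may reach \<open>\<delta>\<close>,
    and \<open>s + t\<close> still has to be covered by \<open>\<tau>\<close> and \<open>d\<close>;
    hence the halves.\<close>
  define \<delta> where "\<delta> = min \<tau>1 (min (\<tau> / 2) (d / 2)) / 2"
  have \<delta>: "\<delta> > 0" "\<delta> \<le> \<tau>1" "\<delta> < \<tau> / 2" "\<delta> < d / 2" using r \<tau> d by (auto simp: \<delta>_def min_def)
  have prodW: "\<gamma> s \<otimes>\<^bsub>G\<^esub> \<gamma> t \<in> W" if "\<bar>s\<bar> \<le> \<delta>" "\<bar>t\<bar> \<le> \<delta>" for s t
  proof -
    have "cat n (a s) (a t) \<in> cube (n + n) (cat n e e) \<rho>"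
    proof (rule cubeI)
      show "cat n (a s) (a t) \<in> Rn (n + n)" by (rule cat_Rn[OF aR])
      fix i assume "i < n + n"
      then show "\<bar>cat n (a s) (a t) i - cat n e e i\<bar> < \<rho>"
        using d(2)[of s i] d(2)[of t "i - n"] that \<delta> d(1) by (auto simp: cat_def)
    qed
    then have "mu (cat n (a s) (a t)) \<in> W" using \<rho>(2) by blast
    then show ?thesis by (simp add: mu_def lo_cat hi_cat aR \<gamma>_def)
  qed
  have lhom: "\<gamma> (s + t) = \<gamma> s \<otimes>\<^bsub>G\<^esub> \<gamma> t" if s: "\<bar>s\<bar> < \<delta>" and t: "\<bar>t\<bar> < \<delta>" for s t
  proof -
    have sc: "\<gamma> s \<in> carrier G" using V_carrier \<gamma>V(1)[of s] s \<delta> by auto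
    have "a (s + t) = \<phi> (\<gamma> s \<otimes>\<^bsub>G\<^esub> \<gamma> t)"
    proof (rule ode_unique[where S="cube n e r" and n=n and L=L and \<tau>=\<delta> and F="F z"
          and a="\<lambda>t. a (s + t)" and b="\<lambda>t. \<phi> (\<gamma> s \<otimes>\<^bsub>G\<^esub> \<gamma> t)"])
      have "real n * L * \<delta> \<le> real n * L * \<tau>1" using r \<delta> by (intro mult_left_mono) auto
      then show "real n * L * \<delta> < 1" using r(5) by linarith
      show "cube n e r \<subseteq> Rn n" by (auto simp: cube_def)
      show "a (s + 0) = \<phi> (\<gamma> s \<otimes>\<^bsub>G\<^esub> \<gamma> 0)" using \<gamma>0 sc \<gamma>V(2)[of s] s \<delta> by simp
      show "\<bar>t\<bar> \<le> \<delta>" using t by simp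
      fix u assume u: "\<bar>u\<bar> \<le> \<delta>"
      have su: "\<bar>s + u\<bar> < d" "\<bar>s + u\<bar> < \<tau>" "\<bar>u\<bar> < \<tau>" using s u \<delta> by linarith+
      show "a (s + u) \<in> cube n e r" using d(2)[OF su(1)] aR by (auto simp: cube_def)
      have pW: "\<gamma> s \<otimes>\<^bsub>G\<^esub> \<gamma> u \<in> W" using prodW s u by simp
      then show "\<phi> (\<gamma> s \<otimes>\<^bsub>G\<^esub> \<gamma> u) \<in> cube n e r" by (simp add: W_def)
      fix i assume i: "i < n"
      show "((\<lambda>t. a (s + t) i) has_real_derivative F z i (a (s + u))) (at u)"
        using ad[OF su(2) i] DERIV_shift[of "\<lambda>x. a x i" _ u s] by (simp add: add.commute)
      show "((\<lambda>t. \<phi> (\<gamma> s \<otimes>\<^bsub>G\<^esub> \<gamma> t) i) has_real_derivative F z i (\<phi> (\<gamma> s \<otimes>\<^bsub>G\<^esub> \<gamma> u))) (at u)"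
        by (rule trans[OF sc su(3) _ i]) (use pW in \<open>simp add: W_def\<close>)
    qed (use r \<delta> in auto)
    then have "iv (a (s + t)) = iv (\<phi> (\<gamma> s \<otimes>\<^bsub>G\<^esub> \<gamma> t))" by simp
    then show ?thesis using prodW[of s t] s t by (simp add: \<gamma>_def[of "s + t"] W_def ivl)
  qed
  obtain \<Gamma> where \<Gamma>: "\<And>t. \<Gamma> t \<in> carrier G" "\<And>s t. \<Gamma> (s + t) = \<Gamma> s \<otimes>\<^bsub>G\<^esub> \<Gamma> t" "\<And>t. \<bar>t\<bar> < \<delta> \<Longrightarrow> \<Gamma> t = \<gamma> t"
    using local_hom_extend[OF grp \<delta>(1), of \<gamma>] lhom V_carrier \<gamma>V(1) \<delta> by (auto; smt (verit))
  \<comment> \<open>Smoothness near \<open>u\<close> is carried over from 0 by translation, as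
    \<open>\<Gamma> t = \<Gamma> u \<otimes> \<gamma> (t - u)\<close> for \<open>t\<close> near
    \<open>u\<close>.\<close>
  have "plot (mfd G) 1 (Rn 1) (\<lambda>x. \<Gamma> (x 0))"
  proof (rule plot_local[OF chd opn_Rn])
    fix u assume u: "u \<in> Rn 1"
    let ?c = "cube 1 u \<delta>"
    have "Cinf_on 1 ?c (\<lambda>x. x 0 + - u 0)"
      by (intro Cinf_on_add Cinf_on_coord Cinf_on_const openin_cube)
    then have "plot (mfd G) 1 ?c (\<lambda>x. \<gamma> (pt (x 0 - u 0) 0))"
      using \<delta> \<tau> by (intro plot_compose[OF chd \<gamma>plot openin_cube, where h="\<lambda>x. pt (x 0 - u 0)"])
        (auto simp: pt_cube pt_Rn[unfolded One_nat_def] pt_Rn cube_def simp del: One_nat_def)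
    then have "plot (mfd G) 1 ?c (\<lambda>x. \<gamma> (x 0 - u 0))" by simp
    then have "plot (mfd G) 1 ?c (\<lambda>x. \<Gamma> (u 0) \<otimes>\<^bsub>G\<^esub> \<gamma> (x 0 - u 0))"
      using \<Gamma>(1) space by (intro plot_mult plot_const[OF chd _ openin_cube]) auto
    then have "plot (mfd G) 1 ?c (\<lambda>x. \<Gamma> (x 0))"
    proof (rule plot_cong[OF chd])
      fix x assume "x \<in> ?c"
      then have "\<bar>x 0 - u 0\<bar> < \<delta>" by (auto simp: cube_def)
      then show "\<Gamma> (u 0) \<otimes>\<^bsub>G\<^esub> \<gamma> (x 0 - u 0) = \<Gamma> (x 0)" using \<Gamma>(3)[of "x 0 - u 0"] \<Gamma>(2)[of "u 0" "x 0 - u 0"] by simp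
    qed
    then show "\<exists>V. u \<in> V \<and> plot (mfd G) 1 V (\<lambda>x. \<Gamma> (x 0))" using cube_self[OF u \<delta>(1)] by blast
  qed
  from smooth_map_real_line[OF chd this] have "smooth_map real_line (mfd G) \<Gamma>" .
  then have op: "one_param_subgroup G \<Gamma>" using \<Gamma>(2) by (simp add: one_param_subgroup_def)
  have "F z j e = z j" if "j < n" for j by (rule F_one[OF that])
  moreover have "((\<lambda>s. \<phi> (\<Gamma> s) j) has_real_derivative F z j e) (at 0)" if j: "j < n" for j
  proof -
    have "\<forall>\<^sub>F s in nhds 0. \<bar>s\<bar> < \<delta>" using \<delta>(1) by (auto simp: eventually_nhds_metric dist_real_def)
    then have "\<forall>\<^sub>F s in nhds 0. a s j = \<phi> (\<Gamma> s) j"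
      by eventually_elim (use \<Gamma>(3) \<gamma>V(2) \<delta> in auto)
    then show ?thesis
      using ad[of 0 j] \<tau> j a0 DERIV_cong_ev[OF refl, of "\<lambda>s. a s j" "\<lambda>s. \<phi> (\<Gamma> s) j" 0] by simp
  qed
  ultimately show thesis using that op by metis
qed

text \<open>\<open>s \<mapsto> \<Gamma> (t * s)\<close> is the only one-parameter subgroup with the
  scaled velocity, so the description in \<open>lie_exp\<close> denotes it, and its value at 1 is
  \<open>\<Gamma> t\<close>.\<close>

lemma lie_exp_one_param:
  assumes \<Gamma>: "one_param_subgroup G \<Gamma>"
  shows "lie_exp G (\<lambda>f. t * velocity (mfd G) \<Gamma> 0 f) = \<Gamma> t"
proof -
  let ?\<Delta> = "\<lambda>s. \<Gamma> (t * s)"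
  have plt: "plot (mfd G) 1 (Rn 1) (\<lambda>x. \<Gamma> (t * x 0))"
  proof -
    have "Cinf_on 1 (Rn 1) (\<lambda>x. t * x 0)" by (intro Cinf_on_mult Cinf_on_const Cinf_on_coord opn_Rn)
    then show ?thesis
      using plot_compose[OF chd one_param_plot[OF \<Gamma>] opn_Rn[of 1], of "\<lambda>x. pt (t * x 0)"] pt_Rn
      by (simp add: pt_def)
  qed
  have op: "one_param_subgroup G ?\<Delta>"
    using smooth_map_real_line[OF chd plt] \<Gamma> by (simp add: one_param_subgroup_def distrib_left)
  have vel: "velocity (mfd G) ?\<Delta> 0 = (\<lambda>f. t * velocity (mfd G) \<Gamma> 0 f)"
  proof
    fix f
    show "velocity (mfd G) ?\<Delta> 0 f = t * velocity (mfd G) \<Gamma> 0 f"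
    proof (cases "f \<in> smooth_fun (mfd G)")
      case True
      have "Cinf_on 1 (Rn 1) (\<lambda>x. f (\<Gamma> (x 0)))" by (rule smooth_fun_plot[OF chd True one_param_plot[OF \<Gamma>]])
      from curve_deriv[OF this pt_Rn, of 0]
      obtain d where d: "((\<lambda>s. f (\<Gamma> s)) has_real_derivative d) (at 0)" by blast
      then have "((\<lambda>s. f (\<Gamma> s)) has_real_derivative d) (at (t * 0))" by simp
      from DERIV_chain2[where f="\<lambda>s. f (\<Gamma> s)" and g="\<lambda>s. t * s" and x=0 and s=UNIV and Db=t, OF this]
      have "((\<lambda>s. f (\<Gamma> (t * s))) has_real_derivative d * t) (at 0)"
        by (auto intro!: derivative_eq_intros)
      then show ?thesis using d True by (simp add: velocity_def DERIV_imp_deriv)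
    qed (simp add: velocity_def)
  qed
  \<comment> \<open>Equal velocities are equal derivations; they have to be turned into equal
    coordinate derivatives before the differential equation can be used.\<close>
  have uniq: "\<Delta> = ?\<Delta>" if \<Delta>: "one_param_subgroup G \<Delta>" and v: "velocity (mfd G) \<Delta> 0 = velocity (mfd G) ?\<Delta> 0" for \<Delta>
  proof -
    have ex: "\<exists>d. ((\<lambda>s. \<phi> (\<Theta> s) j) has_real_derivative d) (at 0)" if "one_param_subgroup G \<Theta>" "j < n" for \<Theta> j
      by (rule curve_coord_deriv[OF chd one_param_plot[OF that(1)] pt_Rn chart]) (use that one_param_one oneV in auto)
    define z where "z j = (SOME d. ((\<lambda>s. \<phi> (\<Delta> s) j) has_real_derivative d) (at 0))" for j
    have z: "((\<lambda>s. \<phi> (\<Delta> s) j) has_real_derivative z j) (at 0)" if "j < n" for j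
      unfolding z_def by (rule someI_ex[OF ex[OF \<Delta> that]])
    have "((\<lambda>s. \<phi> (?\<Delta> s) j) has_real_derivative z j) (at 0)" if jn: "j < n" for j
    proof -
      obtain d where d: "((\<lambda>s. \<phi> (?\<Delta> s) j) has_real_derivative d) (at 0)" using ex[OF op jn] by blast
      have "z j = d"
        by (rule velocity_coord_unique[OF mfd chart oneV jn one_param_plot[OF \<Delta>] pt_Rn one_param_one[OF \<Delta>]
              one_param_plot[OF op] pt_Rn one_param_one[OF op] v z[OF jn] d])
      then show ?thesis using d by simp
    qed
    note zz = this
    show ?thesis by (rule one_param_unique[OF \<Delta> op, of z]) (fact z, fact zz)
  qed
  have "(THE \<gamma>. one_param_subgroup G \<gamma> \<and> velocity (mfd G) \<gamma> 0 = (\<lambda>f. t * velocity (mfd G) \<Gamma> 0 f)) = ?\<Delta>"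
  proof (rule the_equality)
    show "one_param_subgroup G ?\<Delta> \<and> velocity (mfd G) ?\<Delta> 0 = (\<lambda>f. t * velocity (mfd G) \<Gamma> 0 f)"
      using op vel by blast
    fix \<gamma> assume "one_param_subgroup G \<gamma> \<and> velocity (mfd G) \<gamma> 0 = (\<lambda>f. t * velocity (mfd G) \<Gamma> 0 f)"
    then show "\<gamma> = ?\<Delta>" unfolding vel[symmetric] by (blast intro: uniq)
  qed
  then show ?thesis by (simp add: lie_exp_def)
qed

lemma velocity_lie_algebra: "one_param_subgroup G \<Gamma> \<Longrightarrow> velocity (mfd G) \<Gamma> 0 \<in> lie_algebra G"
  using velocity_in[OF mfd, of "Rn 1" \<Gamma> 0] one_param_plot pt_Rn one_param_one
  by (simp add: lie_algebra_def)

lemma inf_action_one_param: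
  "one_param_subgroup G \<Gamma> \<Longrightarrow> inf_action G X act (velocity (mfd G) \<Gamma> 0) x = velocity X (\<lambda>t. act (\<Gamma> t) x) 0"
  by (simp add: inf_action_def lie_exp_one_param)

end

section \<open>Orbit maps\<close>

text \<open>A linear map \<open>f\<close> has a linear right inverse \<open>g\<close> on its range,
  so that \<open>f (g (f v)) = f v\<close>. For matrices this is \<open>L s L = L\<close>, and it
  holds whatever the rank of \<open>L\<close>, that is, whatever the dimension of the orbit.\<close>

lemma generalized_inverse:
  fixes L :: "nat \<Rightarrow> nat \<Rightarrow> real"
  shows "\<exists>s. \<forall>i<d. \<forall>l<n. (\<Sum>j<n. L i j * (\<Sum>k<d. s j k * L k l)) = L i l"
proof -
  let ?sc = "\<lambda>(c::real) (f::nat \<Rightarrow> real). (\<lambda>i. c * f i)"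
  interpret vs: vector_space ?sc
    by unfold_locales (auto simp: fun_eq_iff algebra_simps)
  interpret vp: vector_space_pair ?sc ?sc by unfold_locales
  define f where "f v = (\<lambda>i. if i < d then \<Sum>j<n. L i j * v j else 0)" for v :: rvec
  have "Vector_Spaces.linear ?sc ?sc f"
    unfolding Vector_Spaces.linear_def module_hom_def module_hom_axioms_def
    using vs.vector_space_axioms vs.module_axioms
    by (auto simp: f_def fun_eq_iff distrib_left sum.distrib sum_distrib_left mult_ac intro!: sum.cong)
  from vp.linear_exists_right_inverse_on[OF this vs.subspace_UNIV]
  obtain g where g: "Vector_Spaces.linear ?sc ?sc g" "\<And>v. f (g (f v)) = f v" by auto
  interpret g: Vector_Spaces.linear ?sc ?sc g by (rule g(1))
  have gs: "g w j = (\<Sum>k<d. w k * g (ev k) j)" if "w \<in> Rn d" for w j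
  proof (rule linear_on_Rn_expand[where l="\<lambda>v. g v j", OF _ that])
    fix v w :: rvec and a b :: real
    have "(\<lambda>j. a * v j + b * w j) = ?sc a v + ?sc b w" by (simp add: fun_eq_iff)
    then show "g (\<lambda>j. a * v j + b * w j) j = a * g v j + b * g w j"
      by (simp add: g.add g.scale)
  qed
  show ?thesis
  proof (intro exI allI impI)
    fix i l assume i: "i < d" and l: "l < n"
    have fev: "f (ev l) k = (if k < d then L k l else 0)" for k
    proof -
      have "(\<Sum>j<n. L k j * ev l j) = (\<Sum>j<n. if l = j then L k j else 0)"
        by (rule sum.cong) (auto simp: ev_def)
      then show ?thesis using l by (simp add: f_def)
    qed
    have "f (ev l) \<in> Rn d" by (simp add: f_def Rn_iff)
    note gs[OF this]
    then have "g (f (ev l)) j = (\<Sum>k<d. g (ev k) j * L k l)" for j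
      by (simp add: fev mult.commute)
    moreover have "f (g (f (ev l))) i = L i l" using g(2)[of "ev l"] fev[of i] i by simp
    ultimately show "(\<Sum>j<n. L i j * (\<Sum>k<d. g (ev k) j * L k l)) = L i l"
      using i by (simp add: f_def)
  qed
qed

text \<open>Here \<open>q\<close> stands for the projection onto the tangent space of an orbit.\<close>

lemma derivative_in_fixed_space:
  fixes q :: "nat \<Rightarrow> nat \<Rightarrow> real"
  assumes \<delta>: "\<And>i. i < d \<Longrightarrow> (\<delta> i has_real_derivative w i) (at 0)" "\<And>i. i < d \<Longrightarrow> \<delta> i 0 = 0"
    and E: "\<And>k. k < d \<Longrightarrow> (E k has_real_derivative w' k) (at 0)" "\<And>k. k < d \<Longrightarrow> E k 0 = 0" and C: "C \<ge> 0"
    and approx: "\<And>\<epsilon>. \<epsilon> > 0 \<Longrightarrow> \<forall>\<^sub>F t in nhds 0. \<exists>l. (\<forall>i<d. (\<Sum>k<d. q i k * l k) = l i) \<and>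
      (\<forall>i<d. \<bar>\<delta> i t - l i\<bar> \<le> \<epsilon> * ((\<Sum>k<d. \<bar>E k t\<bar>) + C * (\<Sum>k<d. \<bar>l k\<bar>)))"
    and i: "i < d"
  shows "(\<Sum>k<d. q i k * w k) = w i"
proof -
  \<comment> \<open>\<open>T\<close> measures the failure of a vector to be fixed by
    \<open>q\<close> in coordinate \<open>i\<close>. It is linear, so \<open>T w\<close> is the
    limit of \<open>T\<close> on the difference quotients of \<open>\<delta>\<close>.\<close>
  define T where "T v = (\<Sum>k<d. q i k * v k) - v i" for v :: rvec
  define Q where "Q = (\<Sum>k<d. \<bar>q i k\<bar>) + 1"
  have Q: "Q > 0" unfolding Q_def by (intro add_nonneg_pos sum_nonneg) auto
  define B where "B = (\<Sum>k<d. \<bar>w k\<bar>) + 1"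
  define B' where "B' = (\<Sum>k<d. \<bar>w' k\<bar>) + 1"
  have B: "B > 0" "B' > 0" unfolding B_def B'_def by (intro add_nonneg_pos sum_nonneg; simp)+
  have tq: "((\<lambda>t. f t / t) \<longlongrightarrow> c) (at 0)" if "(f has_real_derivative c) (at 0)" "f 0 = 0" for f c
    using that by (simp add: has_field_derivative_iff)
  have bnd: "\<forall>\<^sub>F t in at 0. (\<Sum>k<d. \<bar>f k t\<bar>) \<le> ((\<Sum>k<d. \<bar>c k\<bar>) + 1) * \<bar>t\<bar>"
    if "\<And>k. k < d \<Longrightarrow> (f k has_real_derivative c k) (at 0)" "\<And>k. k < d \<Longrightarrow> f k 0 = 0" for f c
  proof -
    have "((\<lambda>t. \<Sum>k<d. \<bar>f k t / t\<bar>) \<longlongrightarrow> (\<Sum>k<d. \<bar>c k\<bar>)) (at 0)"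
      by (intro tendsto_sum tendsto_rabs tq that) auto
    then have "\<forall>\<^sub>F t in at 0. (\<Sum>k<d. \<bar>f k t / t\<bar>) < (\<Sum>k<d. \<bar>c k\<bar>) + 1" by (rule order_tendstoD) simp
    moreover have "\<forall>\<^sub>F t in at 0. t \<noteq> (0::real)" by (simp add: eventually_at_filter)
    ultimately show ?thesis
    proof eventually_elim
      case (elim t)
      have "(\<Sum>k<d. \<bar>f k t\<bar>) = (\<Sum>k<d. \<bar>f k t / t\<bar>) * \<bar>t\<bar>" using elim(2) by (simp add: sum_distrib_right abs_divide)
      also have "\<dots> \<le> ((\<Sum>k<d. \<bar>c k\<bar>) + 1) * \<bar>t\<bar>" using elim(1) by (intro mult_right_mono) auto
      finally show ?case .
    qed
  qed
  \<comment> \<open>From \<open>e + C * S \<le> 2 * C * D + 2 * e\<close> below, with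
    \<open>D \<le> B * \<bar>t\<bar>\<close> and \<open>e \<le> B' * \<bar>t\<bar>\<close>.\<close>
  define B2 where "B2 = B' + 2 * C * B + B'"
  have Tw: "((\<lambda>t. T (\<lambda>k. \<delta> k t / t)) \<longlongrightarrow> T w) (at 0)"
    unfolding T_def by (intro tendsto_intros tq \<delta> i) auto
  have key: "\<bar>T w\<bar> \<le> \<epsilon> * (Q * B2)" if \<epsilon>: "\<epsilon> > 0" "2 * (\<epsilon> * C * real d) \<le> 1" for \<epsilon>
  proof (rule tendsto_upperbound[OF tendsto_rabs[OF Tw]])
    have "\<forall>\<^sub>F t in at 0. \<exists>l. (\<forall>i<d. (\<Sum>k<d. q i k * l k) = l i) \<and>
      (\<forall>i<d. \<bar>\<delta> i t - l i\<bar> \<le> \<epsilon> * ((\<Sum>k<d. \<bar>E k t\<bar>) + C * (\<Sum>k<d. \<bar>l k\<bar>)))"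
      using approx[OF \<epsilon>(1)] unfolding eventually_at_filter by eventually_elim blast
    moreover have "\<forall>\<^sub>F t in at 0. t \<noteq> (0::real)" by (simp add: eventually_at_filter)
    moreover have "\<forall>\<^sub>F t in at 0. (\<Sum>k<d. \<bar>\<delta> k t\<bar>) \<le> B * \<bar>t\<bar>"
      unfolding B_def by (rule bnd) (use \<delta> in auto)
    moreover have "\<forall>\<^sub>F t in at 0. (\<Sum>k<d. \<bar>E k t\<bar>) \<le> B' * \<bar>t\<bar>"
      unfolding B'_def by (rule bnd) (use E in auto)
    ultimately show "\<forall>\<^sub>F t in at 0. \<bar>T (\<lambda>k. \<delta> k t / t)\<bar> \<le> \<epsilon> * (Q * B2)"
    proof eventually_elim
      case (elim t)
      then obtain l where l: "\<And>i. i < d \<Longrightarrow> (\<Sum>k<d. q i k * l k) = l i"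
        "\<And>i. i < d \<Longrightarrow> \<bar>\<delta> i t - l i\<bar> \<le> \<epsilon> * ((\<Sum>k<d. \<bar>E k t\<bar>) + C * (\<Sum>k<d. \<bar>l k\<bar>))" by blast
      define S where "S = (\<Sum>k<d. \<bar>l k\<bar>)"
      define e where "e = (\<Sum>k<d. \<bar>E k t\<bar>)"
      define D where "D = (\<Sum>k<d. \<bar>\<delta> k t\<bar>)"
      have pos: "S \<ge> 0" "e \<ge> 0" "D \<ge> 0" by (simp_all add: S_def e_def D_def sum_nonneg)
      have "S \<le> (\<Sum>k<d. \<bar>\<delta> k t\<bar> + \<epsilon> * (e + C * S))"
        unfolding S_def
      proof (rule sum_mono)
        fix k assume "k \<in> {..<d}"
        then show "\<bar>l k\<bar> \<le> \<bar>\<delta> k t\<bar> + \<epsilon> * (e + C * (\<Sum>k<d. \<bar>l k\<bar>))"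
          using l(2)[of k] unfolding e_def by auto
      qed
      \<comment> \<open>\<open>S\<close> occurs on both sides; as its coefficient on the right is at
        most 1/2, it can be absorbed.\<close>
      then have S1: "S \<le> D + real d * \<epsilon> * e + (\<epsilon> * C * real d) * S"
        by (simp add: sum.distrib D_def algebra_simps)
      have "2 * (\<epsilon> * C * real d) * S \<le> 1 * S" by (rule mult_right_mono[OF \<epsilon>(2) pos(1)])
      then have S2: "S \<le> 2 * D + 2 * (real d * \<epsilon> * e)" using S1 by simp
      have "C * S \<le> C * (2 * D + 2 * (real d * \<epsilon> * e))" by (rule mult_left_mono[OF S2 C])
      also have "\<dots> = 2 * C * D + (2 * (\<epsilon> * C * real d)) * e" by (simp add: algebra_simps)
      also have "\<dots> \<le> 2 * C * D + 1 * e" by (intro add_left_mono mult_right_mono \<epsilon>(2) pos)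
      also have "2 * C * D \<le> 2 * C * (B * \<bar>t\<bar>)" using elim(3) C by (intro mult_left_mono) (auto simp: D_def B_def)
      finally have "e + C * S \<le> 2 * C * (B * \<bar>t\<bar>) + 2 * e" by simp
      also have "e \<le> B' * \<bar>t\<bar>" using elim(4) by (simp add: e_def B'_def)
      finally have S3: "e + C * S \<le> B2 * \<bar>t\<bar>" by (simp add: B2_def algebra_simps)
      have r: "\<bar>\<delta> k t - l k\<bar> \<le> \<epsilon> * (B2 * \<bar>t\<bar>)" if "k < d" for k
      proof -
        have "\<bar>\<delta> k t - l k\<bar> \<le> \<epsilon> * (e + C * S)" using l(2)[OF that] by (simp add: e_def S_def)
        also have "\<dots> \<le> \<epsilon> * (B2 * \<bar>t\<bar>)" using S3 \<epsilon>(1) by (intro mult_left_mono) auto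
        finally show ?thesis .
      qed
      have "T (\<lambda>k. \<delta> k t / t) * t = (\<Sum>k<d. q i k * \<delta> k t) - \<delta> i t"
        using elim(2) by (simp add: T_def left_diff_distrib sum_distrib_right)
      \<comment> \<open>\<open>l\<close> is fixed by \<open>q\<close>, so it may be subtracted
        inside \<open>T\<close>.\<close>
      also have "\<dots> = (\<Sum>k<d. q i k * (\<delta> k t - l k)) - (\<delta> i t - l i)"
        using l(1)[OF i] by (simp add: right_diff_distrib sum_subtractf)
      finally have "\<bar>T (\<lambda>k. \<delta> k t / t)\<bar> * \<bar>t\<bar> = \<bar>(\<Sum>k<d. q i k * (\<delta> k t - l k)) - (\<delta> i t - l i)\<bar>"
        by (simp add: abs_mult[symmetric])
      also have "\<dots> \<le> (\<Sum>k<d. \<bar>q i k\<bar> * (\<epsilon> * (B2 * \<bar>t\<bar>))) + \<epsilon> * (B2 * \<bar>t\<bar>)"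
      proof (rule order_trans[OF abs_triangle_ineq4 add_mono])
        show "\<bar>\<Sum>k<d. q i k * (\<delta> k t - l k)\<bar> \<le> (\<Sum>k<d. \<bar>q i k\<bar> * (\<epsilon> * (B2 * \<bar>t\<bar>)))"
          by (rule order_trans[OF sum_abs sum_mono]) (use r in \<open>auto simp: abs_mult intro: mult_left_mono\<close>)
      qed (rule r[OF i])
      also have "\<dots> = \<epsilon> * (Q * B2) * \<bar>t\<bar>" by (simp add: Q_def sum_distrib_left sum_distrib_right algebra_simps)
      finally show ?case using elim(2) by simp
    qed
  qed simp
  have "\<bar>T w\<bar> \<le> 0"
  proof (rule field_le_epsilon)
    fix r :: real assume r: "r > 0"
    \<comment> \<open>The first entry makes \<open>\<epsilon>\<close> admissible in
      \<open>key\<close>, the second makes the resulting bound at most \<open>r\<close>.\<close>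
    define \<epsilon> where "\<epsilon> = min (1 / (2 * (C * real d + 1))) (r / (Q * \<bar>B2\<bar> + 1))"
    have Cd: "C * real d \<ge> 0" using C by simp
    have QB: "Q * \<bar>B2\<bar> \<ge> 0" using Q by simp
    have \<epsilon>: "\<epsilon> > 0" unfolding \<epsilon>_def using Cd QB r by (auto intro!: divide_pos_pos add_nonneg_pos)
    have "2 * (C * real d) * \<epsilon> \<le> 2 * (C * real d) * (1 / (2 * (C * real d + 1)))"
      using Cd by (intro mult_left_mono) (auto simp: \<epsilon>_def)
    also have "\<dots> \<le> 1" using Cd by (simp add: divide_simps)
    finally have "\<bar>T w\<bar> \<le> \<epsilon> * (Q * B2)" by (intro key \<epsilon>) (simp add: mult_ac)
    also have "\<dots> \<le> \<epsilon> * (Q * \<bar>B2\<bar>)" using \<epsilon> Q by (intro mult_left_mono) auto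
    also have "\<dots> \<le> (r / (Q * \<bar>B2\<bar> + 1)) * (Q * \<bar>B2\<bar>)" using QB by (intro mult_right_mono) (auto simp: \<epsilon>_def)
    also have "\<dots> \<le> r" using QB r by (simp add: divide_simps)
    finally show "\<bar>T w\<bar> \<le> 0 + r" by simp
  qed
  then show ?thesis by (simp add: T_def)
qed

locale action_chart = lie_chart G V \<phi> for G :: "'g lie_struct" and V \<phi> +
  fixes X :: "'x manifold" and act and A \<psi> x
  assumes X: "smooth_manifold X" and sact: "smooth_action G X act"
    and chartX: "(A, \<psi>) \<in> charts X" and xA: "x \<in> A"
begin

abbreviation "d \<equiv> mdim X"
abbreviation "x0 \<equiv> \<psi> x"
abbreviation "iA \<equiv> inv_into A \<psi>"

lemma chdX: "charted X" by (rule smooth_manifold_charted[OF X])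

lemmas iAl = chart_inv[OF chdX chartX]
lemmas Aopen = chart_open[OF chdX chartX]
lemmas imopenX = chart_image_open[OF chdX chartX]

lemma A_space: "y \<in> A \<Longrightarrow> y \<in> mspace X"
  using openin_subset[OF Aopen] by blast

lemma ga: "group_action G (mspace X) act"
  and act_smooth: "smooth_map (prod_manifold (mfd G) X) X (\<lambda>(g, y). act g y)"
  using sact by (simp_all add: smooth_action_def)

lemma act_one: "y \<in> mspace X \<Longrightarrow> act \<one>\<^bsub>G\<^esub> y = y"
  using group_action.id_eq_one[OF ga] by (metis restrict_apply')

lemma act_mult: "y \<in> mspace X \<Longrightarrow> g \<in> carrier G \<Longrightarrow> h \<in> carrier G \<Longrightarrow> act (g \<otimes>\<^bsub>G\<^esub> h) y = act g (act h y)"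
  by (rule group_action.composition_rule[OF ga])

lemma plot_act: "plot (mfd G) m U P \<Longrightarrow> plot X m U Q \<Longrightarrow> plot X m U (\<lambda>u. act (P u) (Q u))"
  by (rule plot_smooth_map2[OF chd chdX chdX act_smooth])

definition DO :: "rvec set" where
  "DO = \<phi> ` V \<inter> (\<lambda>b. act (iv b) x) -` A"

definition orb :: "nat \<Rightarrow> rvec \<Rightarrow> real" where
  "orb i b = \<psi> (act (iv b) x) i"

text \<open>Derivative of the orbit map \<open>g \<mapsto> g x\<close> at 1: its kernel is the Lie
  algebra of the stabilizer of \<open>x\<close>, its image the tangent space of the orbit.\<close>

definition L :: "nat \<Rightarrow> nat \<Rightarrow> real" where
  "L i j = pd j (orb i) e"

lemma plot_orb: "plot X n (\<phi> ` V) (\<lambda>b. act (iv b) x)"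
  by (intro plot_act plot_chart_inv[OF mfd chart] plot_const[OF chdX A_space[OF xA] imopen])

lemma DO_open: "opn n DO"
  unfolding DO_def by (rule plot_preimage[OF plot_orb Aopen])

lemma e_DO: "e \<in> DO"
  using oneV xA by (simp add: DO_def ivl act_one A_space)

lemma Cinf_orb: "i < d \<Longrightarrow> Cinf_on n DO (orb i)"
  unfolding orb_def[abs_def] by (rule plot_coord[OF chdX plot_orb chartX]) (auto simp: DO_def)

lemma orb_e: "orb i e = x0 i"
  by (simp add: orb_def ivl oneV act_one A_space xA)

lemma orbit_curve_deriv:
  assumes \<Gamma>: "one_param_subgroup G \<Gamma>" and z: "\<And>j. j < n \<Longrightarrow> ((\<lambda>s. \<phi> (\<Gamma> s) j) has_real_derivative z j) (at 0)"
    and i: "i < d"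
  shows "((\<lambda>s. \<psi> (act (\<Gamma> s) x) i) has_real_derivative (\<Sum>j<n. L i j * z j)) (at 0)"
proof -
  have V: "\<forall>\<^sub>F s in nhds 0. \<Gamma> s \<in> V" by (rule one_param_near[OF \<Gamma> Vopen]) (simp add: one_param_one[OF \<Gamma>] oneV)
  have "((\<lambda>s. orb i (\<phi> (\<Gamma> s))) has_real_derivative (\<Sum>j<n. pd j (orb i) (\<phi> (\<Gamma> 0)) * z j)) (at 0)"
  proof (rule C1_curve[where h="\<lambda>s. \<phi> (\<Gamma> s)" and t=0, OF DO_open Cinf_Ck[OF Cinf_orb[OF i]]])
    show "\<forall>\<^sub>F s in nhds 0. \<phi> (\<Gamma> s) \<in> Rn n" using V by eventually_elim (rule phiR)
  qed (use one_param_one[OF \<Gamma>] e_DO z in auto)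
  moreover have "\<forall>\<^sub>F s in nhds 0. orb i (\<phi> (\<Gamma> s)) = \<psi> (act (\<Gamma> s) x) i"
    using V by eventually_elim (simp add: orb_def ivl)
  ultimately show ?thesis
    using DERIV_cong_ev[OF refl, of "\<lambda>s. orb i (\<phi> (\<Gamma> s))" "\<lambda>s. \<psi> (act (\<Gamma> s) x) i" 0]
    by (simp add: one_param_one[OF \<Gamma>] L_def)
qed

lemma orbit_curve_plot: "one_param_subgroup G \<Gamma> \<Longrightarrow> plot X 1 (Rn 1) (\<lambda>y. act (\<Gamma> (y 0)) x)"
  by (intro plot_act one_param_plot plot_const[OF chdX A_space[OF xA] opn_Rn])

text \<open>The velocity of the curve \<open>\<Gamma> t x\<close> at any time \<open>t\<close> is
  the image under \<open>\<Gamma> t\<close> of its velocity \<open>L z = 0\<close> at time 0, so the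
  curve is constant while it stays in the chart.\<close>

lemma one_param_stabilizes:
  assumes \<Gamma>: "one_param_subgroup G \<Gamma>" and z: "\<And>j. j < n \<Longrightarrow> ((\<lambda>s. \<phi> (\<Gamma> s) j) has_real_derivative z j) (at 0)"
    and ker: "\<And>i. i < d \<Longrightarrow> (\<Sum>j<n. L i j * z j) = 0"
  shows "\<exists>\<tau>>0. \<forall>t. \<bar>t\<bar> < \<tau> \<longrightarrow> act (\<Gamma> t) x = x"
proof -
  let ?y = "\<lambda>t. act (\<Gamma> t) x"
  note yp = orbit_curve_plot[OF \<Gamma>]
  have y0: "?y 0 = x" by (simp add: one_param_one[OF \<Gamma>] act_one A_space xA)
  have "\<forall>\<^sub>F t in nhds 0. ?y t \<in> A"
    by (rule curve_ev_in[OF yp pt_Rn Aopen]) (simp add: y0 xA)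
  then obtain \<tau> where \<tau>: "\<tau> > 0" "\<And>t. \<bar>t\<bar> < \<tau> \<Longrightarrow> ?y t \<in> A"
    unfolding eventually_nhds_metric by (auto simp: dist_real_def)
  have D0: "((\<lambda>s. \<psi> (?y s) i) has_real_derivative 0) (at t)" if t: "\<bar>t\<bar> < \<tau>" and i: "i < d" for t i
  proof -
    let ?g = "\<Gamma> t"
    have gc: "?g \<in> carrier G" by (rule one_param_carrier[OF \<Gamma>])
    let ?H = "\<lambda>w. act ?g (iA w)"
    have Hp: "plot X d (\<psi> ` A) ?H"
      by (intro plot_act plot_const[OF chd _ imopenX] plot_chart_inv[OF X chartX]) (use gc space in simp)
    let ?D = "\<psi> ` A \<inter> ?H -` A"
    have D: "opn d ?D" by (rule plot_preimage[OF Hp Aopen])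
    have C: "Ck_on 1 d ?D (\<lambda>w. \<psi> (?H w) i)" by (rule Cinf_Ck, rule plot_coord[OF chdX Hp chartX i]) auto
    have yA: "\<forall>\<^sub>F s in nhds 0. ?y s \<in> A"
      by (rule curve_ev_in[OF yp pt_Rn Aopen]) (simp add: y0 xA)
    have "((\<lambda>s. \<psi> (?H (\<psi> (?y s))) i) has_real_derivative (\<Sum>k<d. pd k (\<lambda>w. \<psi> (?H w) i) (\<psi> (?y 0)) * 0)) (at 0)"
    proof (rule C1_curve[where h="\<lambda>s. \<psi> (?y s)" and t=0, OF D C])
      show "\<psi> (?y 0) \<in> ?D" using y0 xA \<tau>(2)[OF t] by (simp add: iAl)
      show "\<forall>\<^sub>F s in nhds 0. \<psi> (?y s) \<in> Rn d" using yA by eventually_elim (rule chart_Rn[OF chdX chartX])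
      show "((\<lambda>s. \<psi> (?y s) k) has_real_derivative 0) (at 0)" if "k < d" for k
        using orbit_curve_deriv[OF \<Gamma> z that] ker[OF that] by simp
    qed
    moreover have "\<forall>\<^sub>F s in nhds 0. \<psi> (?H (\<psi> (?y s))) i = \<psi> (?y (s + t)) i"
    proof -
      have "\<Gamma> (s + t) = ?g \<otimes>\<^bsub>G\<^esub> \<Gamma> s" for s
        using \<Gamma> unfolding one_param_subgroup_def by (metis add.commute)
      then have "act ?g (?y s) = ?y (s + t)" for s
        using act_mult[OF A_space[OF xA] gc one_param_carrier[OF \<Gamma>]] by simp
      note aeq = this
      show ?thesis using yA by eventually_elim (simp add: iAl aeq)
    qed
    ultimately have "((\<lambda>s. \<psi> (?y (s + t)) i) has_real_derivative 0) (at 0)"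
      using DERIV_cong_ev[OF refl, of "\<lambda>s. \<psi> (?H (\<psi> (?y s))) i" "\<lambda>s. \<psi> (?y (s + t)) i" 0] by simp
    then show ?thesis using DERIV_shift[of "\<lambda>s. \<psi> (?y s) i" 0 0 t] by simp
  qed
  have "?y t = x" if t: "\<bar>t\<bar> < \<tau>" for t
  proof -
    have "\<psi> (?y t) i = x0 i" if i: "i < d" for i
    proof -
      have "norm (\<psi> (?y t) i - \<psi> (?y 0) i) \<le> 0 * norm (t - 0)"
        by (rule field_differentiable_bound[of "{-\<tau><..<\<tau>}" "\<lambda>s. \<psi> (?y s) i" "\<lambda>_. 0"])
           (use t \<tau> D0 i in \<open>auto intro: has_field_derivative_at_within\<close>)
      then show ?thesis using y0 by simp
    qed
    then have "\<psi> (?y t) = x0"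
      using chart_Rn[OF chdX chartX \<tau>(2)[OF t]] chart_Rn[OF chdX chartX xA] by (intro Rn_eqI) auto
    then show ?thesis using iAl[OF \<tau>(2)[OF t]] iAl[OF xA] by metis
  qed
  then show ?thesis using \<tau>(1) by blast
qed

end

text \<open>\<open>lo m v\<close> instead of \<open>v\<close> keeps the ray in \<open>Rn m\<close>
  for arbitrary \<open>v\<close>.\<close>

lemma ray_eventually:
  assumes W: "opn m W" and u: "u \<in> W"
  shows "\<forall>\<^sub>F t in nhds (0::real). (\<lambda>i. u i + t * lo m v i) \<in> W"
proof -
  obtain r where r: "r > 0" "cube m u r \<subseteq> W" using opn_cube[OF W u] by blast
  have uR: "u \<in> Rn m" using u opn_subset[OF W] by blast
  have "\<forall>\<^sub>F t in nhds (0::real). \<forall>i\<in>{..<m}. \<bar>(u i + t * lo m v i) - u i\<bar> < r"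
  proof (intro eventually_ball_finite ballI)
    fix i
    have "((\<lambda>t. \<bar>(u i + t * lo m v i) - u i\<bar>) \<longlongrightarrow> \<bar>(u i + 0 * lo m v i) - u i\<bar>) (nhds (0::real))"
      by (intro tendsto_intros filterlim_ident)
    then show "\<forall>\<^sub>F t in nhds (0::real). \<bar>(u i + t * lo m v i) - u i\<bar> < r"
      by (rule order_tendstoD) (simp add: r)
  qed simp
  then show ?thesis
  proof eventually_elim
    case (elim t)
    have "(\<lambda>i. u i + t * lo m v i) \<in> cube m u r"
      using elim uR by (intro cubeI) (auto simp: Rn_iff lo_def)
    then show ?case using r(2) by blast
  qed
qed

text \<open>The differential of multiplication at (1, 1) is addition. The part belonging to the
  first factor is computed by keeping the second equal to 1; the other part is
  \<open>F_one\<close>.\<close>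

lemma (in lie_chart) mult_deriv_one:
  assumes \<alpha>: "\<forall>\<^sub>F s in nhds 0. \<alpha> s \<in> V" "\<alpha> 0 = \<one>\<^bsub>G\<^esub>" and \<beta>: "\<forall>\<^sub>F s in nhds 0. \<beta> s \<in> V" "\<beta> 0 = \<one>\<^bsub>G\<^esub>"
    and i: "i < n"
    and y: "\<And>j. j < n \<Longrightarrow> ((\<lambda>s. \<phi> (\<alpha> s) j) has_real_derivative y j) (at 0)"
    and z: "\<And>j. j < n \<Longrightarrow> ((\<lambda>s. \<phi> (\<beta> s) j) has_real_derivative z j) (at 0)"
  shows "((\<lambda>s. \<phi> (\<alpha> s \<otimes>\<^bsub>G\<^esub> \<beta> s) i) has_real_derivative y i + z i) (at 0)"
proof -
  interpret group G by (rule grp)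
  let ?A = "(\<Sum>j<n. pd j (\<lambda>w. \<phi> (mu w) i) (cat n e e) * y j)"
  have one: "\<one>\<^bsub>G\<^esub> \<otimes>\<^bsub>G\<^esub> \<one>\<^bsub>G\<^esub> \<in> V" using oneV by simp
  have "((\<lambda>s. \<phi> (\<alpha> s \<otimes>\<^bsub>G\<^esub> (\<lambda>_. \<one>\<^bsub>G\<^esub>) s) i) has_real_derivative ?A +
      (\<Sum>j<n. pd (n + j) (\<lambda>w. \<phi> (mu w) i) (cat n e e) * 0)) (at 0)"
    by (rule mult_deriv2[OF \<alpha>(1) _ \<alpha>(2) _ oneV oneV one i y]) (use oneV in auto)
  moreover have "\<forall>\<^sub>F s in nhds 0. \<phi> (\<alpha> s \<otimes>\<^bsub>G\<^esub> (\<lambda>_. \<one>\<^bsub>G\<^esub>) s) i = \<phi> (\<alpha> s) i"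
    using \<alpha>(1) by eventually_elim (use V_carrier in simp)
  ultimately have "((\<lambda>s. \<phi> (\<alpha> s) i) has_real_derivative ?A) (at 0)"
    using DERIV_cong_ev[OF refl, of "\<lambda>s. \<phi> (\<alpha> s \<otimes>\<^bsub>G\<^esub> (\<lambda>_. \<one>\<^bsub>G\<^esub>) s) i" "\<lambda>s. \<phi> (\<alpha> s) i" 0] by simp
  then have A: "?A = y i" using y[OF i] by (rule DERIV_unique)
  have "((\<lambda>s. \<phi> (\<alpha> s \<otimes>\<^bsub>G\<^esub> \<beta> s) i) has_real_derivative ?A + F z i e) (at 0)"
    unfolding F_def by (rule mult_deriv2[OF \<alpha>(1) \<beta>(1) \<alpha>(2) \<beta>(2) oneV oneV one i y z])
  then show ?thesis by (simp add: A F_one[OF i])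
qed

context action_chart
begin

text \<open>Expansion in the coordinate basis. Together with \<open>inf_action_coords\<close> it
  reduces identities of derivations to identities of coefficients.\<close>

lemma tangent_coords:
  assumes P: "plot X m U P" and u: "u \<in> U" "P u = x" and f: "f \<in> smooth_fun X"
  shows "plot_tangent m X P u v f = (\<Sum>i<d. dir_deriv m (\<lambda>y. \<psi> (P y) i) u v * pd i (\<lambda>y. f (iA y)) x0)"
proof -
  let ?U = "U \<inter> P -` A"
  have U: "opn m ?U" by (rule plot_preimage[OF P Aopen])
  have uU: "u \<in> ?U" using u xA by simp
  have h: "Cinf_on m ?U (\<lambda>y. \<psi> (P y) i)" if "i < d" for i
    by (rule plot_coord[OF chdX P chartX that]) auto
  have "dir_deriv m (\<lambda>y. f (P y)) u v = dir_deriv m (\<lambda>y. f (iA (\<psi> (P y)))) u v"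
    by (rule dir_deriv_cong[OF U uU]) (simp add: iAl)
  also have "\<dots> = dir_deriv d (\<lambda>y. f (iA y)) (\<psi> (P u)) (jacobian m d (\<lambda>y. \<psi> (P y)) u v)"
    by (rule dir_deriv_compose[OF U imopenX _ h smooth_fun_chart[OF X f chartX] uU]) auto
  finally show ?thesis using f u(2) by (simp add: plot_tangent_def dir_deriv_def[of d] jacobian_def)
qed

lemma coord_ray_deriv:
  assumes P: "plot X m U P" and u: "u \<in> U" "P u = x" and i: "i < d"
  shows "((\<lambda>t. \<psi> (P (\<lambda>k. u k + t * lo m v k)) i) has_real_derivative dir_deriv m (\<lambda>y. \<psi> (P y) i) u v) (at 0)"
proof -
  let ?U = "U \<inter> P -` A"
  have U: "opn m ?U" by (rule plot_preimage[OF P Aopen])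
  have uU: "u \<in> ?U" using u xA by simp
  have C: "Ck_on 1 m ?U (\<lambda>y. \<psi> (P y) i)"
    by (rule Cinf_Ck, rule plot_coord[OF chdX P chartX i]) auto
  have "((\<lambda>t. \<psi> (P (\<lambda>k. u k + t * lo m v k)) i) has_real_derivative
      (\<Sum>k<m. pd k (\<lambda>y. \<psi> (P y) i) (\<lambda>k. u k + 0 * lo m v k) * lo m v k)) (at 0)"
  proof (rule C1_curve[where h="\<lambda>t k. u k + t * lo m v k" and t=0, OF U C])
    show "(\<lambda>k. u k + 0 * lo m v k) \<in> ?U" using uU by simp
    show "\<forall>\<^sub>F s in nhds 0. (\<lambda>k. u k + s * lo m v k) \<in> Rn m"
      using uU opn_subset[OF U] by (intro always_eventually) (auto simp: Rn_iff lo_def)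
  qed (auto intro!: derivative_eq_intros)
  moreover have "(\<Sum>k<m. pd k (\<lambda>y. \<psi> (P y) i) (\<lambda>k. u k + 0 * lo m v k) * lo m v k) = dir_deriv m (\<lambda>y. \<psi> (P y) i) u v"
    by (simp add: dir_deriv_def lo_def mult.commute)
  ultimately show ?thesis by simp
qed

lemma inf_action_coords:
  assumes \<Gamma>: "one_param_subgroup G \<Gamma>" and z: "\<And>j. j < n \<Longrightarrow> ((\<lambda>s. \<phi> (\<Gamma> s) j) has_real_derivative z j) (at 0)"
    and f: "f \<in> smooth_fun X"
  shows "inf_action G X act (velocity (mfd G) \<Gamma> 0) x f = (\<Sum>i<d. (\<Sum>j<n. L i j * z j) * pd i (\<lambda>y. f (iA y)) x0)"
proof -
  let ?y = "\<lambda>t. act (\<Gamma> t) x"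
  have y0: "?y 0 = x" by (simp add: one_param_one[OF \<Gamma>] act_one A_space xA)
  have yA: "\<forall>\<^sub>F t in nhds 0. ?y t \<in> A"
    by (rule curve_ev_in[OF orbit_curve_plot[OF \<Gamma>] pt_Rn Aopen]) (simp add: y0 xA)
  have "((\<lambda>t. f (iA (\<psi> (?y t)))) has_real_derivative
      (\<Sum>i<d. pd i (\<lambda>y. f (iA y)) (\<psi> (?y 0)) * (\<Sum>j<n. L i j * z j))) (at 0)"
  proof (rule C1_curve[where h="\<lambda>t. \<psi> (?y t)" and t=0, OF imopenX Cinf_Ck[OF smooth_fun_chart[OF X f chartX]]])
    show "\<psi> (?y 0) \<in> \<psi> ` A" using y0 xA by simp
    show "\<forall>\<^sub>F t in nhds 0. \<psi> (?y t) \<in> Rn d" using yA by eventually_elim (rule chart_Rn[OF chdX chartX])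
  qed (rule orbit_curve_deriv[OF \<Gamma> z])
  moreover have "\<forall>\<^sub>F t in nhds 0. f (iA (\<psi> (?y t))) = f (?y t)" using yA by eventually_elim (simp add: iAl)
  ultimately have "((\<lambda>t. f (?y t)) has_real_derivative (\<Sum>i<d. pd i (\<lambda>y. f (iA y)) x0 * (\<Sum>j<n. L i j * z j))) (at 0)"
    using DERIV_cong_ev[OF refl, of "\<lambda>t. f (iA (\<psi> (?y t)))" "\<lambda>t. f (?y t)" 0] y0 by simp
  then show ?thesis
    unfolding inf_action_one_param[OF \<Gamma>] using f by (simp add: velocity_def DERIV_imp_deriv mult.commute)
qed

text \<open>With a generalized inverse \<open>s\<close> of the derivative \<open>L\<close> of the orbit map and one-parameter subgroups
  \<open>\<Gamma>\<^sub>j\<close> in direction \<open>(1 - s L) e\<^sub>j \<in> ker L\<close>, the map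
  \<open>\<Psi>(a) = \<phi>\<^sup>-\<^sup>1(e + s L a) \<Gamma>\<^sub>0(a\<^sub>0) \<cdots> \<Gamma>\<^bsub>n-1\<^esub>(a\<^bsub>n-1\<^esub>)\<close> has derivative \<open>1\<close> at \<open>0\<close>, and its factors \<open>\<Gamma>\<^sub>j\<close> fix \<open>x\<close>.\<close>

lemma adapted_coordinates:
  assumes s: "\<And>i l. i < d \<Longrightarrow> l < n \<Longrightarrow> (\<Sum>j<n. L i j * (\<Sum>k<d. s j k * L k l)) = L i l"
  defines "T \<equiv> \<lambda>a j. if j < n then \<Sum>k<d. s j k * (\<Sum>l<n. L k l * a l) else 0"
  shows "\<exists>W \<Psi> \<tau>. opn n W \<and> (\<lambda>_. 0) \<in> W \<and> plot (mfd G) n W \<Psi> \<and> \<Psi> ` W \<subseteq> V \<and> \<Psi> (\<lambda>_. 0) = \<one>\<^bsub>G\<^esub> \<and> \<tau> > 0 \<and>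
     (\<forall>i<n. \<forall>j<n. pd j (\<lambda>a. \<phi> (\<Psi> a) i) (\<lambda>_. 0) = (if i = j then 1 else 0)) \<and>
     (\<forall>a\<in>W. (\<forall>j<n. \<bar>a j\<bar> < \<tau>) \<longrightarrow> act (\<Psi> a) x = act (iv (\<lambda>j. e j + T a j)) x)"
proof -
  interpret group G by (rule grp)
  define tt where "tt j l = (\<Sum>k<d. s j k * L k l)" for j l
  have T: "T a j = (\<Sum>l<n. tt j l * a l)" if "j < n" for a j
  proof -
    have "T a j = (\<Sum>k<d. \<Sum>l<n. s j k * L k l * a l)"
      using that by (simp add: T_def sum_distrib_left mult.assoc)
    also have "\<dots> = (\<Sum>l<n. tt j l * a l)"
      by (subst sum.swap) (simp add: tt_def sum_distrib_right)
    finally show ?thesis .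
  qed
  \<comment> \<open>\<open>z j\<close> is the \<open>j\<close>-th column of \<open>1 - s L\<close>;
    it is killed by \<open>L\<close> because \<open>L s L = L\<close>.\<close>
  define z where "z j k = (if k = j then 1 else 0) - tt k j" for j k :: nat
  have ker: "(\<Sum>k<n. L i k * z j k) = 0" if i: "i < d" and j: "j < n" for i j
  proof -
    have "(\<Sum>k<n. L i k * z j k) = (\<Sum>k<n. if j = k then L i k else 0) - (\<Sum>k<n. L i k * tt k j)"
      unfolding sum_subtractf[symmetric] by (rule sum.cong) (auto simp: z_def algebra_simps)
    then show ?thesis using s[OF i j] j by (simp add: tt_def)
  qed
  have "\<forall>j. \<exists>\<Gamma>. one_param_subgroup G \<Gamma> \<and> (\<forall>k<n. ((\<lambda>s. \<phi> (\<Gamma> s) k) has_real_derivative z j k) (at 0))"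
    using one_param_exists by metis
  from choice[OF this] obtain \<Gamma> where "\<forall>j. one_param_subgroup G (\<Gamma> j) \<and>
      (\<forall>k<n. ((\<lambda>s. \<phi> (\<Gamma> j s) k) has_real_derivative z j k) (at 0))" ..
  then have \<Gamma>: "\<And>j. one_param_subgroup G (\<Gamma> j)"
    "\<And>j k. k < n \<Longrightarrow> ((\<lambda>s. \<phi> (\<Gamma> j s) k) has_real_derivative z j k) (at 0)" by blast+
  have "\<forall>j\<in>{..<n}. \<exists>\<tau>. \<tau> > 0 \<and> (\<forall>t. \<bar>t\<bar> < \<tau> \<longrightarrow> act (\<Gamma> j t) x = x)"
    by (intro ballI one_param_stabilizes[OF \<Gamma>(1) \<Gamma>(2) ker]) auto
  from bchoice[OF this] obtain \<tau>' where \<tau>': "\<forall>j\<in>{..<n}. \<tau>' j > 0 \<and> (\<forall>t. \<bar>t\<bar> < \<tau>' j \<longrightarrow> act (\<Gamma> j t) x = x)" ..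
  define \<tau> where "\<tau> = Min (insert 1 (\<tau>' ` {..<n}))"
  have \<tau>: "\<tau> > 0" using \<tau>' by (auto simp: \<tau>_def)
  have \<tau>j: "\<tau> \<le> \<tau>' j" if "j < n" for j unfolding \<tau>_def by (rule Min_le) (use that in auto)
  \<comment> \<open>The group need not be commutative, so the product of the
    \<open>\<Gamma> j (a j)\<close> is built recursively in a fixed order.\<close>
  define pg where "pg k a = rec_nat \<one>\<^bsub>G\<^esub> (\<lambda>j p. p \<otimes>\<^bsub>G\<^esub> \<Gamma> j (a j)) k" for k and a :: rvec
  have pg0: "pg 0 a = \<one>\<^bsub>G\<^esub>" and pgS: "pg (Suc k) a = pg k a \<otimes>\<^bsub>G\<^esub> \<Gamma> k (a k)" for k a by (simp_all add: pg_def)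
  have pgc: "pg k a \<in> carrier G" for k a
    by (induction k) (simp_all add: pg0 pgS one_param_carrier[OF \<Gamma>(1)])
  have pgp: "plot (mfd G) n (Rn n) (pg k)" for k
  proof (induction k)
    case 0
    then show ?case using plot_const[OF chd _ opn_Rn, of "\<one>\<^bsub>G\<^esub>" n] space by (simp add: pg0[abs_def])
  next
    case (Suc k)
    have "plot (mfd G) n (Rn n) (\<lambda>a. \<Gamma> k (pt (a k) 0))"
      by (rule plot_compose[where h="\<lambda>a. pt (a k)", OF chd one_param_plot[OF \<Gamma>(1)] opn_Rn pt_Rn])
         (simp add: Cinf_on_coord)
    then show ?case using plot_mult[OF Suc] by (simp add: pgS[abs_def])
  qed
  have pgx: "act (pg k a) x = x" if "\<forall>j<n. \<bar>a j\<bar> < \<tau>" "k \<le> n" for k a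
    using that(2)
  proof (induction k)
    case 0
    then show ?case by (simp add: pg0 act_one A_space xA)
  next
    case (Suc k)
    have k: "k < n" using Suc.prems by simp
    then have "\<bar>a k\<bar> < \<tau>' k" using that(1) \<tau>j[OF k] by fastforce
    then have "act (\<Gamma> k (a k)) x = x" using \<tau>' k by blast
    then show ?case
      using Suc act_mult[OF A_space[OF xA] pgc one_param_carrier[OF \<Gamma>(1)]] by (simp add: pgS)
  qed
  define bb where "bb a = (\<lambda>j. e j + T a j)" for a
  have bbR: "bb a \<in> Rn n" for a using eR by (simp add: bb_def Rn_iff T_def)
  have bbC: "Cinf_on n (Rn n) (\<lambda>a. bb a j)" if "j < n" for j
    unfolding bb_def T[OF that]
    by (intro Cinf_on_add Cinf_on_const Cinf_on_sum Cinf_on_mult Cinf_on_coord opn_Rn)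
  define W0 where "W0 = Rn n \<inter> bb -` (\<phi> ` V)"
  have W0: "opn n W0"
    unfolding W0_def
    using Cinf_continuous_map[where h=bb, OF opn_Rn opn_Rn bbR bbC]
    by (intro openin_sub_preimage[OF _ _ imopen]) (simp_all add: continuous_map_in_subtopology)
  define \<Psi> where "\<Psi> a = iv (bb a) \<otimes>\<^bsub>G\<^esub> pg n a" for a
  have ivp: "plot (mfd G) n W0 (\<lambda>a. iv (bb a))"
    by (rule plot_of_chart[OF mfd chart W0]) (auto simp: W0_def intro: Cinf_on_subset[OF bbC])
  have \<Psi>p: "plot (mfd G) n W0 \<Psi>"
    unfolding \<Psi>_def[abs_def]
    by (intro plot_mult ivp plot_restrict[OF chd pgp W0]) (simp add: W0_def)
  define W where "W = W0 \<inter> \<Psi> -` V"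
  have W: "opn n W" unfolding W_def by (rule plot_preimage[OF \<Psi>p Vopen])
  \<comment> \<open>On a coordinate axis at most one factor of the product is nontrivial, so the
    partial derivatives of \<open>\<Psi>\<close> at 0 require only the product rule at (1,
    1).\<close>
  have pgj: "pg k ((\<lambda>_. 0)(j := t)) = (if j < k then \<Gamma> j t else \<one>\<^bsub>G\<^esub>)" for k j t
    by (induction k) (auto simp: pg0 pgS one_param_one[OF \<Gamma>(1)] one_param_carrier[OF \<Gamma>(1)] less_Suc_eq)
  have bb0: "bb (\<lambda>_. 0) = e" by (simp add: bb_def T_def fun_eq_iff)
  have pg00: "pg n (\<lambda>_. 0) = \<one>\<^bsub>G\<^esub>" using pgj[of n n 0] by (simp add: fun_upd_idem)
  have \<Psi>0: "\<Psi> (\<lambda>_. 0) = \<one>\<^bsub>G\<^esub>" using oneV by (simp add: \<Psi>_def bb0 pg00 ivl)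
  have 0: "(\<lambda>_. 0) \<in> W0" "(\<lambda>_. 0) \<in> W" using oneV by (simp_all add: W_def W0_def bb0 \<Psi>0 Rn_iff)
  have pdH: "pd j (\<lambda>a. \<phi> (\<Psi> a) i) (\<lambda>_. 0) = (if i = j then 1 else 0)" if i: "i < n" and j: "j < n" for i j
  proof -
    let ?\<alpha> = "\<lambda>t. iv (bb ((\<lambda>_. 0)(j := t)))"
    have ev: "\<forall>\<^sub>F t in nhds 0. (\<lambda>_. 0)(j := t) \<in> W0" using line_eventually[OF W0 0(1) j] by simp
    have \<alpha>V: "\<forall>\<^sub>F t in nhds 0. ?\<alpha> t \<in> V" using ev by eventually_elim (simp add: W0_def iv_V)
    have bbj: "bb ((\<lambda>_. 0)(j := t)) k = e k + tt k j * t" if "k < n" for k t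
    proof -
      have "(\<Sum>l<n. tt k l * ((\<lambda>_. 0)(j := t)) l) = (\<Sum>l<n. if j = l then tt k l * t else 0)"
        by (rule sum.cong) auto
      then show ?thesis using j by (simp add: bb_def T[OF that])
    qed
    have "((\<lambda>t. \<phi> (?\<alpha> t) k) has_real_derivative tt k j) (at 0)" if k: "k < n" for k
    proof -
      have "((\<lambda>t. e k + tt k j * t) has_real_derivative tt k j) (at 0)" by (auto intro!: derivative_eq_intros)
      moreover have "\<forall>\<^sub>F t in nhds 0. e k + tt k j * t = \<phi> (?\<alpha> t) k"
        using ev by eventually_elim (simp add: W0_def iv_V bbj[OF k])
      ultimately show ?thesis
        by (rule DERIV_transfer)
    qed
    note \<alpha>d = this
    have \<alpha>0: "?\<alpha> 0 = \<one>\<^bsub>G\<^esub>" using oneV by (simp add: fun_upd_idem bb0 ivl)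
    \<comment> \<open>By the choice of \<open>z\<close> the two contributions \<open>tt i j\<close>
      and \<open>z j i\<close> add up to the Kronecker delta.\<close>
    have "((\<lambda>t. \<phi> (?\<alpha> t \<otimes>\<^bsub>G\<^esub> \<Gamma> j t) i) has_real_derivative tt i j + z j i) (at 0)"
      by (rule mult_deriv_one[where y="\<lambda>k. tt k j", OF \<alpha>V \<alpha>0 _ one_param_one[OF \<Gamma>(1)] i \<alpha>d \<Gamma>(2)])
         (use one_param_near[OF \<Gamma>(1) Vopen] one_param_one[OF \<Gamma>(1)] oneV in auto)
    moreover have "?\<alpha> t \<otimes>\<^bsub>G\<^esub> \<Gamma> j t = \<Psi> ((\<lambda>_. 0)(j := t))" for t
      using pgj[of n j t] j by (simp add: \<Psi>_def)
    ultimately have "((\<lambda>t. \<phi> (\<Psi> ((\<lambda>_. 0)(j := t))) i) has_real_derivative (if i = j then 1 else 0)) (at 0)"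
      by (simp add: z_def)
    then show ?thesis by (simp add: pd_def DERIV_imp_deriv)
  qed
  have \<Psi>x: "act (\<Psi> a) x = act (iv (bb a)) x" if "a \<in> W" "\<forall>j<n. \<bar>a j\<bar> < \<tau>" for a
  proof -
    have "iv (bb a) \<in> carrier G" using that(1) iv_V V_carrier by (auto simp: W_def W0_def)
    then show ?thesis using act_mult[OF A_space[OF xA] _ pgc] pgx[OF that(2)] by (simp add: \<Psi>_def)
  qed
  show ?thesis
  proof (intro exI conjI)
    show "plot (mfd G) n W \<Psi>" by (rule plot_restrict[OF chd \<Psi>p W]) (auto simp: W_def)
    show "\<Psi> ` W \<subseteq> V" by (auto simp: W_def)
  qed (use W 0 \<Psi>0 \<tau> pdH \<Psi>x in \<open>auto simp: W_def W0_def bb_def\<close>)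
qed

end

section \<open>Tangent vectors of plots with the same orbits\<close>

lemma pd_eventually:
  assumes "\<forall>\<^sub>F t in nhds (z k). f (z(k := t)) = g t" "(g has_real_derivative c) (at (z k))"
  shows "pd k f z = c"
  unfolding pd_def by (rule DERIV_imp_deriv[OF DERIV_transfer[OF assms(2)]]) (use assms(1) in \<open>simp add: eq_commute\<close>)

context action_chart
begin

text \<open>Let \<open>w = u + t v\<close> and \<open>P w = \<Psi>(a) R w\<close>. In coordinates,
  \<open>\<Psi>(a) R w - \<Psi>(a) x\<close> is \<open>R w - x\<close> up to a small multiple of its
  size, and \<open>\<Psi>(a) x - x\<close> is \<open>L a\<close> up to a small multiple of the size
  of \<open>T a\<close>. So \<open>P w - R w\<close> is close to a vector in the image of
  \<open>L\<close>, without any control of \<open>a\<close> beyond its smallness, and the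
  derivatives in direction \<open>v\<close> differ by an element of that image.\<close>

lemma tangent_difference:
  assumes P: "plot X m U P" and R: "plot X m U R" and u: "u \<in> U" "P u = x" "R u = x"
    and near: "\<And>N. openin (mtop (mfd G)) N \<Longrightarrow> \<one>\<^bsub>G\<^esub> \<in> N \<Longrightarrow>
      \<exists>W. opn m W \<and> u \<in> W \<and> (\<forall>w\<in>W. \<exists>g\<in>N. P w = act g (R w))"
  shows "\<exists>Z\<in>lie_algebra G. inf_action G X act Z x \<in> tangent_space X x \<and>
    plot_tangent m X P u v = (\<lambda>f. 1 * plot_tangent m X R u v f + 1 * inf_action G X act Z x f)"
proof -
  obtain s where s: "\<And>i l. i < d \<Longrightarrow> l < n \<Longrightarrow> (\<Sum>j<n. L i j * (\<Sum>k<d. s j k * L k l)) = L i l"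
    using generalized_inverse[of d n L] by blast
  define T where "T a j = (if j < n then \<Sum>k<d. s j k * (\<Sum>l<n. L k l * a l) else 0)" for a j
  obtain W \<Psi> \<tau> where W: "opn n W" "(\<lambda>_. 0) \<in> W" and \<Psi>: "plot (mfd G) n W \<Psi>" "\<Psi> ` W \<subseteq> V" "\<Psi> (\<lambda>_. 0) = \<one>\<^bsub>G\<^esub>"
    and \<tau>: "\<tau> > 0" and pd\<Psi>: "\<And>i j. i < n \<Longrightarrow> j < n \<Longrightarrow> pd j (\<lambda>a. \<phi> (\<Psi> a) i) (\<lambda>_. 0) = (if i = j then 1 else 0)"
    and \<Psi>x: "\<And>a. a \<in> W \<Longrightarrow> (\<And>j. j < n \<Longrightarrow> \<bar>a j\<bar> < \<tau>) \<Longrightarrow> act (\<Psi> a) x = act (iv (\<lambda>j. e j + T a j)) x"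
    using adapted_coordinates[of s, OF s] unfolding T_def by blast
  \<comment> \<open>\<open>L s\<close> is a projection onto the image of \<open>L\<close>; it is the
    \<open>q\<close> of \<open>derivative_in_fixed_space\<close>.\<close>
  define q where "q i k = (\<Sum>j<n. L i j * s j k)" for i k
  define C where "C = (\<Sum>j<n. \<Sum>k<d. \<bar>s j k\<bar>)"
  have C: "C \<ge> 0" unfolding C_def by (intro sum_nonneg) auto
  define la where "la a k = (\<Sum>l<n. L k l * a l)" for a :: rvec and k
  have T_la: "T a j = (\<Sum>k<d. s j k * la a k)" if "j < n" for a j using that by (simp add: T_def la_def)
  have LT: "(\<Sum>j<n. L i j * T a j) = (\<Sum>k<d. q i k * la a k)" for i a
  proof -
    have "(\<Sum>j<n. L i j * T a j) = (\<Sum>j<n. \<Sum>k<d. L i j * s j k * la a k)"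
      by (rule sum.cong) (simp_all add: T_la sum_distrib_left mult.assoc)
    also have "\<dots> = (\<Sum>k<d. q i k * la a k)"
      by (subst sum.swap) (simp add: q_def sum_distrib_right)
    finally show ?thesis .
  qed
  have ql: "(\<Sum>k<d. q i k * la a k) = la a i" if i: "i < d" for a i
  proof -
    have "(\<Sum>k<d. q i k * la a k) = (\<Sum>l<n. (\<Sum>k<d. q i k * L k l) * a l)"
      unfolding la_def by (simp add: sum_distrib_left sum_distrib_right mult.assoc) (rule sum.swap)
    also have "\<dots> = (\<Sum>l<n. L i l * a l)"
    proof (rule sum.cong[OF refl])
      fix l assume l: "l \<in> {..<n}"
      have "(\<Sum>k<d. q i k * L k l) = (\<Sum>j<n. L i j * (\<Sum>k<d. s j k * L k l))"
        unfolding q_def by (simp add: sum_distrib_left sum_distrib_right mult.assoc) (rule sum.swap)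
      then show "(\<Sum>k<d. q i k * L k l) * a l = L i l * a l" using s[OF i] l by simp
    qed
    finally show ?thesis by (simp add: la_def)
  qed
  have Tbound: "(\<Sum>j<n. \<bar>T a j\<bar>) \<le> C * (\<Sum>k<d. \<bar>la a k\<bar>)" for a
  proof -
    have "\<bar>T a j\<bar> \<le> (\<Sum>k<d. \<bar>s j k\<bar>) * (\<Sum>k<d. \<bar>la a k\<bar>)" if "j < n" for j
    proof -
      have "\<bar>T a j\<bar> \<le> (\<Sum>k<d. \<bar>s j k\<bar> * \<bar>la a k\<bar>)"
        unfolding T_la[OF that] by (rule order_trans[OF sum_abs]) (simp add: abs_mult)
      also have "\<dots> \<le> (\<Sum>k<d. \<bar>s j k\<bar> * (\<Sum>k<d. \<bar>la a k\<bar>))"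
        by (intro sum_mono mult_left_mono member_le_sum) auto
      finally show ?thesis by (simp add: sum_distrib_right)
    qed
    then have "(\<Sum>j<n. \<bar>T a j\<bar>) \<le> (\<Sum>j<n. (\<Sum>k<d. \<bar>s j k\<bar>) * (\<Sum>k<d. \<bar>la a k\<bar>))" by (intro sum_mono) simp
    then show ?thesis by (simp add: C_def sum_distrib_right)
  qed
  \<comment> \<open>The action of \<open>\<Psi>(a)\<close> on points near \<open>x\<close>, as a
    function of the concatenation of \<open>a\<close> with the coordinates of the point.\<close>
  define KK where "KK z = act (\<Psi> (lo n z)) (iA (hi n d z))" for z
  define D0 where "D0 = (Rn (n + d) \<inter> lo n -` W) \<inter> (Rn (n + d) \<inter> hi n d -` (\<psi> ` A))"
  have D0: "opn (n + d) D0" unfolding D0_def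
    by (intro openin_Int openin_sub_preimage[OF _ _ W(1)] openin_sub_preimage[OF _ _ imopenX])
       (simp_all add: continuous_map_lo continuous_map_hi)
  have KKp: "plot X (n + d) D0 KK"
    unfolding KK_def[abs_def]
    by (intro plot_act plot_compose[OF chd \<Psi>(1) D0] plot_of_chart[OF X chartX D0] Cinf_lo Cinf_hi D0)
       (auto simp: D0_def)
  define DK where "DK = D0 \<inter> KK -` A"
  have DK: "opn (n + d) DK" unfolding DK_def by (rule plot_preimage[OF KKp Aopen])
  have CK: "Ck_on 1 (n + d) DK (\<lambda>z. \<psi> (KK z) i)" if "i < d" for i
    by (rule Cinf_Ck, rule plot_coord[OF chdX KKp chartX that]) (auto simp: DK_def)
  have x0R: "x0 \<in> Rn d" by (rule chart_Rn[OF chdX chartX xA])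
  have 0: "(\<lambda>_. 0) \<in> Rn n" by (simp add: Rn_iff)
  let ?o = "cat n (\<lambda>_. 0) x0"
  have lho: "lo n ?o = (\<lambda>_. 0)" "hi n d ?o = x0" by (simp_all add: lo_cat hi_cat 0 x0R)
  have o0: "?o \<in> D0" using W(2) xA by (simp add: D0_def lho cat_Rn x0R)
  have oK: "?o \<in> DK" using o0 xA by (simp add: DK_def KK_def lho \<Psi>(3) iAl act_one A_space)
  \<comment> \<open>Only the derivatives in the directions of the point are computed: the two
    arguments compared below share the group coordinate \<open>a\<close>.\<close>
  have pdK: "pd (n + j) (\<lambda>z. \<psi> (KK z) i) ?o = (if i = j then 1 else 0)" if i: "i < d" and j: "j < d" for i j
  proof (rule pd_eventually)
    have oj: "?o (n + j) = x0 j" by (simp add: cat_def)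
    have eq: "?o(n + j := t) = cat n (\<lambda>_. 0) (x0(j := t))" for t by (auto simp: cat_def fun_eq_iff)
    have "\<forall>\<^sub>F t in nhds (x0 j). x0(j := t) \<in> \<psi> ` A" by (rule line_eventually[OF imopenX _ j]) (use xA in blast)
    then show "\<forall>\<^sub>F t in nhds (?o (n + j)). \<psi> (KK (?o(n + j := t))) i = (x0(j := t)) i"
      unfolding oj
    proof eventually_elim
      case (elim t)
      then obtain y where y: "y \<in> A" "x0(j := t) = \<psi> y" by blast
      then have "x0(j := t) \<in> Rn d" using chart_Rn[OF chdX chartX] by metis
      then have "KK (?o(n + j := t)) = act \<one>\<^bsub>G\<^esub> (iA (\<psi> y))"
        unfolding eq KK_def by (simp add: lo_cat hi_cat 0 \<Psi>(3) y(2))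
      also have "\<dots> = y" using y(1) by (simp add: iAl act_one A_space)
      finally show ?case using y(2) by simp
    qed
    show "((\<lambda>t. (x0(j := t)) i) has_real_derivative (if i = j then 1 else 0)) (at (?o (n + j)))"
      by (cases "i = j") (auto intro!: derivative_eq_intros)
  qed
  let ?r = "\<lambda>t k. u k + t * lo m v k"
  let ?c = "\<lambda>t. \<psi> (P (?r t))"
  let ?c' = "\<lambda>t. \<psi> (R (?r t))"
  have approx: "\<forall>\<^sub>F t in nhds 0. \<exists>l. (\<forall>i<d. (\<Sum>k<d. q i k * l k) = l i) \<and>
      (\<forall>i<d. \<bar>(?c t i - ?c' t i) - l i\<bar> \<le> \<epsilon> * ((\<Sum>k<d. \<bar>?c' t k - x0 k\<bar>) + C * (\<Sum>k<d. \<bar>l k\<bar>)))" if \<epsilon>: "\<epsilon> > 0" for \<epsilon>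
  proof -
    obtain rK where rK: "rK > 0" "cube (n + d) ?o rK \<subseteq> DK" "\<And>i y z. i < d \<Longrightarrow> y \<in> cube (n + d) ?o rK \<Longrightarrow> z \<in> cube (n + d) ?o rK \<Longrightarrow>
      \<bar>\<psi> (KK y) i - \<psi> (KK z) i - (\<Sum>j<n + d. pd j (\<lambda>z. \<psi> (KK z) i) ?o * (y j - z j))\<bar> \<le> \<epsilon> * (\<Sum>j<n + d. \<bar>y j - z j\<bar>)"
      using strict_diff_family[where f="\<lambda>i z. \<psi> (KK z) i" and d=d, OF DK CK oK \<epsilon>] by blast
    obtain rO where rO: "rO > 0" "cube n e rO \<subseteq> DO" "\<And>i y z. i < d \<Longrightarrow> y \<in> cube n e rO \<Longrightarrow> z \<in> cube n e rO \<Longrightarrow>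
      \<bar>orb i y - orb i z - (\<Sum>j<n. pd j (orb i) e * (y j - z j))\<bar> \<le> \<epsilon> * (\<Sum>j<n. \<bar>y j - z j\<bar>)"
      using strict_diff_family[where f=orb and d=d, OF DO_open Cinf_Ck[OF Cinf_orb] e_DO \<epsilon>] by blast
    \<comment> \<open>Chosen so that \<open>\<bar>T a j\<bar> \<le> M * \<eta>\<close> on the cube
      of radius \<open>\<eta>\<close> about 0.\<close>
    define M where "M = (\<Sum>j<n. \<Sum>k<d. \<Sum>l<n. \<bar>s j k\<bar> * \<bar>L k l\<bar>)"
    have M: "M \<ge> 0" unfolding M_def by (intro sum_nonneg) auto
    \<comment> \<open>The bounds serve, in this order, the estimate for \<open>KK\<close>, the range
      in which the one-parameter subgroups fix \<open>x\<close>, and, through \<open>M\<close>, the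
      estimate for \<open>orb\<close> at \<open>e + T a\<close>.\<close>
    define \<eta> where "\<eta> = min (min rK \<tau>) (rO / (M + 1))"
    have \<eta>: "\<eta> > 0" "\<eta> \<le> rK" "\<eta> \<le> \<tau>" "M * \<eta> < rO"
    proof -
      show "\<eta> > 0" unfolding \<eta>_def using rK rO \<tau> M by simp
      show "\<eta> \<le> rK" "\<eta> \<le> \<tau>" by (auto simp: \<eta>_def)
      have "M * \<eta> \<le> M * (rO / (M + 1))" by (rule mult_left_mono[OF _ M]) (simp add: \<eta>_def)
      also have "\<dots> < rO" using M rO(1) by (simp add: divide_simps)
      finally show "M * \<eta> < rO" .
    qed
    have Tsmall: "\<bar>T a j\<bar> < rO" if a: "a \<in> cube n (\<lambda>_. 0) \<eta>" and j: "j < n" for a j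
    proof -
      have al: "\<bar>a l\<bar> \<le> \<eta>" if "l < n" for l using cubeD(2)[OF a that] by simp
      have "\<bar>T a j\<bar> \<le> (\<Sum>k<d. \<bar>s j k * la a k\<bar>)" unfolding T_la[OF j] by (rule sum_abs)
      also have "\<dots> \<le> (\<Sum>k<d. (\<Sum>l<n. \<bar>s j k\<bar> * \<bar>L k l\<bar>) * \<eta>)"
      proof (rule sum_mono)
        fix k
        have "\<bar>la a k\<bar> \<le> (\<Sum>l<n. \<bar>L k l\<bar> * \<eta>)"
          unfolding la_def by (rule order_trans[OF sum_abs sum_mono]) (use al in \<open>auto simp: abs_mult intro: mult_left_mono\<close>)
        then have "\<bar>s j k\<bar> * \<bar>la a k\<bar> \<le> \<bar>s j k\<bar> * (\<Sum>l<n. \<bar>L k l\<bar> * \<eta>)" by (rule mult_left_mono) simp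
        then show "\<bar>s j k * la a k\<bar> \<le> (\<Sum>l<n. \<bar>s j k\<bar> * \<bar>L k l\<bar>) * \<eta>"
          by (simp add: abs_mult sum_distrib_left sum_distrib_right mult.assoc)
      qed
      also have "\<dots> = (\<Sum>k<d. \<Sum>l<n. \<bar>s j k\<bar> * \<bar>L k l\<bar>) * \<eta>" by (simp add: sum_distrib_right)
      also have "\<dots> \<le> M * \<eta>"
        unfolding M_def using j \<eta>(1)
        by (intro mult_right_mono member_le_sum[where f="\<lambda>j. \<Sum>k<d. \<Sum>l<n. \<bar>s j k\<bar> * \<bar>L k l\<bar>"] sum_nonneg) auto
      finally show ?thesis using \<eta>(4) by simp
    qed
    have CH: "Ck_on 1 n W (\<lambda>a. \<phi> (\<Psi> a) i)" if "i < n" for i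
      by (rule Cinf_Ck, rule plot_coord[OF chd \<Psi>(1) chart that _ \<Psi>(2)]) simp
    \<comment> \<open>Every group element close to 1 is \<open>\<Psi> a\<close> for a small
      \<open>a\<close>; continuity of \<open>a\<close> in the element is not claimed.\<close>
    obtain \<rho> where \<rho>: "\<rho> > 0" "\<And>w. (\<And>i. i < n \<Longrightarrow> \<bar>w i - e i\<bar> < \<rho>) \<Longrightarrow>
        \<exists>a\<in>cube n (\<lambda>_. 0) \<eta>. a \<in> W \<and> (\<forall>i<n. \<phi> (\<Psi> a) i = w i)"
      using local_surj[where H="\<lambda>i a. \<phi> (\<Psi> a) i", OF W CH pd\<Psi> \<eta>(1)] \<Psi>(3) by auto
    define N where "N = V \<inter> \<phi> -` cube n e \<rho>"
    have No: "openin (mtop (mfd G)) N" unfolding N_def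
      by (rule openin_sub_preimage[OF Vopen chart_cont[OF chd chart] openin_cube])
    have N1: "\<one>\<^bsub>G\<^esub> \<in> N" using oneV cube_self[OF eR \<rho>(1)] by (simp add: N_def)
    from near[OF No N1] obtain W' where "opn m W' \<and> u \<in> W' \<and> (\<forall>w\<in>W'. \<exists>g\<in>N. P w = act g (R w))" ..
    then have W': "opn m W'" "u \<in> W'" "\<And>w. w \<in> W' \<Longrightarrow> \<exists>g\<in>N. P w = act g (R w)" by auto
    define Y where "Y = A \<inter> \<psi> -` cube d x0 rK"
    have Y: "openin (mtop X) Y" unfolding Y_def
      by (rule openin_sub_preimage[OF Aopen chart_cont[OF chdX chartX] openin_cube])
    have "opn m (W' \<inter> (U \<inter> R -` Y))" by (intro openin_Int W'(1) plot_preimage[OF R Y])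
    moreover have "u \<in> W' \<inter> (U \<inter> R -` Y)" using W'(2) u xA x0R cube_self[OF x0R rK(1)] by (simp add: Y_def)
    ultimately have "\<forall>\<^sub>F t in nhds 0. ?r t \<in> W' \<inter> (U \<inter> R -` Y)" by (rule ray_eventually)
    then show ?thesis
    proof eventually_elim
      case (elim t)
      then obtain g where g: "g \<in> N" "P (?r t) = act g (R (?r t))" using W'(3) by blast
      obtain a where a: "a \<in> cube n (\<lambda>_. 0) \<eta>" "a \<in> W" "\<And>i. i < n \<Longrightarrow> \<phi> (\<Psi> a) i = \<phi> g i"
        using \<rho>(2)[of "\<phi> g"] g(1) by (auto simp: N_def cube_def)
      have gV: "g \<in> V" "\<Psi> a \<in> V" using g(1) \<Psi>(2) a(2) by (auto simp: N_def)
      have "\<phi> (\<Psi> a) = \<phi> g" by (rule Rn_eqI[OF phiR phiR]) (use gV a(3) in auto)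
      then have \<Psi>g: "\<Psi> a = g" using gV ivl by metis
      have aR: "a \<in> Rn n" by (rule cubeD(1)[OF a(1)])
      have al: "\<bar>a l\<bar> < \<eta>" if "l < n" for l using cubeD(2)[OF a(1) that] by simp
      define y where "y = ?c' t"
      have yA: "R (?r t) \<in> A" "y \<in> cube d x0 rK" using elim by (auto simp: Y_def y_def)
      have yR: "y \<in> Rn d" by (rule cubeD(1)[OF yA(2)])
      have catc: "cat n a w \<in> cube (n + d) ?o rK" if "w \<in> cube d x0 rK" for w
      proof (rule cubeI)
        show "cat n a w \<in> Rn (n + d)" using cubeD(1)[OF that] by (rule cat_Rn)
        fix i assume "i < n + d"
        then show "\<bar>cat n a w i - ?o i\<bar> < rK"
          using al[of i] \<eta>(2) cubeD(2)[OF that, of "i - n"] by (auto simp: cat_def)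
      qed
      have K1: "KK (cat n a y) = P (?r t)"
        using yA(1) by (simp add: KK_def lo_cat hi_cat aR yR \<Psi>g g(2)) (simp add: y_def iAl)
      have K2: "KK (cat n a x0) = act (iv (\<lambda>j. e j + T a j)) x"
        using \<Psi>x[OF a(2)] al \<eta>(3) by (simp add: KK_def lo_cat hi_cat aR x0R iAl xA) (metis order_less_le_trans)
      have bc: "(\<lambda>j. e j + T a j) \<in> cube n e rO"
        using Tsmall[OF a(1)] eR by (intro cubeI) (auto simp: Rn_iff T_def)
      show ?case
      proof (intro exI[of _ "la a"] conjI allI impI)
        fix i assume i: "i < d"
        show "(\<Sum>k<d. q i k * la a k) = la a i" by (rule ql[OF i])
        have sK: "(\<Sum>j<n + d. pd j (\<lambda>z. \<psi> (KK z) i) ?o * (cat n a y j - cat n a x0 j)) = y i - x0 i"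
        proof -
          have "(\<Sum>j<d. pd (n + j) (\<lambda>z. \<psi> (KK z) i) ?o * (y j - x0 j)) = (\<Sum>j<d. if i = j then y j - x0 j else 0)"
            by (rule sum.cong) (use pdK[OF i] in auto)
          then show ?thesis using i unfolding sum_split by (simp add: cat_def)
        qed
        have sK': "(\<Sum>j<n + d. \<bar>cat n a y j - cat n a x0 j\<bar>) = (\<Sum>j<d. \<bar>y j - x0 j\<bar>)"
          unfolding sum_split by (simp add: cat_def)
        \<comment> \<open>The same \<open>a\<close> acting at \<open>y\<close> and at
          \<open>x0\<close>, then the orbit map at \<open>e + T a\<close>, then \<open>T a\<close>
          bounded by \<open>L a\<close>: the three estimates add up to the claim.\<close>
        have "\<bar>\<psi> (P (?r t)) i - orb i (\<lambda>j. e j + T a j) - (y i - x0 i)\<bar> \<le> \<epsilon> * (\<Sum>j<d. \<bar>y j - x0 j\<bar>)"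
          using rK(3)[OF i catc[OF yA(2)] catc[OF cube_self[OF x0R rK(1)]]] unfolding sK sK' K1 K2 orb_def .
        moreover have "\<bar>orb i (\<lambda>j. e j + T a j) - x0 i - la a i\<bar> \<le> \<epsilon> * (\<Sum>j<n. \<bar>T a j\<bar>)"
          using rO(3)[OF i bc cube_self[OF eR rO(1)]] LT[of i a] ql[OF i, of a] by (simp add: orb_e L_def)
        moreover have "\<epsilon> * (\<Sum>j<n. \<bar>T a j\<bar>) \<le> \<epsilon> * (C * (\<Sum>k<d. \<bar>la a k\<bar>))"
          using Tbound \<epsilon> by (intro mult_left_mono) auto
        ultimately show "\<bar>(?c t i - ?c' t i) - la a i\<bar> \<le> \<epsilon> * ((\<Sum>k<d. \<bar>?c' t k - x0 k\<bar>) + C * (\<Sum>k<d. \<bar>la a k\<bar>))"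
          unfolding y_def[symmetric] distrib_left by linarith
      qed
    qed
  qed
  define w where "w i = dir_deriv m (\<lambda>y. \<psi> (P y) i) u v - dir_deriv m (\<lambda>y. \<psi> (R y) i) u v" for i
  have qw: "(\<Sum>k<d. q i k * w k) = w i" if i: "i < d" for i
  proof (rule derivative_in_fixed_space[where \<delta>="\<lambda>i t. ?c t i - ?c' t i" and E="\<lambda>k t. ?c' t k - x0 k"
        and w'="\<lambda>k. dir_deriv m (\<lambda>y. \<psi> (R y) k) u v", OF _ _ _ _ C approx i])
    fix k assume k: "k < d"
    show "((\<lambda>t. ?c t k - ?c' t k) has_real_derivative w k) (at 0)"
      unfolding w_def by (rule DERIV_diff[OF coord_ray_deriv[OF P u(1,2) k] coord_ray_deriv[OF R u(1,3) k]])
    show "((\<lambda>t. ?c' t k - x0 k) has_real_derivative dir_deriv m (\<lambda>y. \<psi> (R y) k) u v) (at 0)"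
      using DERIV_diff[OF coord_ray_deriv[OF R u(1,3) k] DERIV_const] by simp
  qed (use u in auto)
  \<comment> \<open>\<open>s w\<close> is a preimage of \<open>w\<close> under \<open>L\<close>,
    because \<open>L s w = q w = w\<close>.\<close>
  define z where "z j = (\<Sum>k<d. s j k * w k)" for j
  obtain \<Gamma> where \<Gamma>: "one_param_subgroup G \<Gamma>" "\<And>j. j < n \<Longrightarrow> ((\<lambda>s. \<phi> (\<Gamma> s) j) has_real_derivative z j) (at 0)"
    by (rule one_param_exists[of z]) blast
  let ?Z = "velocity (mfd G) \<Gamma> 0"
  have Lz: "(\<Sum>j<n. L i j * z j) = w i" if i: "i < d" for i
  proof -
    have "(\<Sum>j<n. L i j * z j) = (\<Sum>k<d. q i k * w k)"
      unfolding z_def q_def by (simp add: sum_distrib_left sum_distrib_right mult.assoc) (rule sum.swap)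
    then show ?thesis using qw[OF i] by simp
  qed
  have "plot_tangent m X P u v f = 1 * plot_tangent m X R u v f + 1 * inf_action G X act ?Z x f" for f
  proof (cases "f \<in> smooth_fun X")
    case True
    have "inf_action G X act ?Z x f = (\<Sum>i<d. (\<Sum>j<n. L i j * z j) * pd i (\<lambda>y. f (iA y)) x0)"
      by (rule inf_action_coords[OF \<Gamma>(1) \<Gamma>(2) True])
    also have "\<dots> = (\<Sum>i<d. w i * pd i (\<lambda>y. f (iA y)) x0)"
      by (rule sum.cong) (simp_all add: Lz)
    finally have I: "inf_action G X act ?Z x f = (\<Sum>i<d. w i * pd i (\<lambda>y. f (iA y)) x0)" .
    show ?thesis
      unfolding tangent_coords[OF P u(1,2) True] tangent_coords[OF R u(1,3) True] I
      by (simp add: w_def sum_subtractf left_diff_distrib)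
  next
    case False
    then show ?thesis unfolding inf_action_one_param[OF \<Gamma>(1)] by (simp add: plot_tangent_def velocity_def)
  qed
  moreover have "inf_action G X act ?Z x \<in> tangent_space X x"
    using velocity_in[OF X orbit_curve_plot[OF \<Gamma>(1)] pt_Rn[of 0]]
    unfolding inf_action_one_param[OF \<Gamma>(1)] by (simp add: one_param_one[OF \<Gamma>(1)] act_one A_space xA)
  ultimately show ?thesis using velocity_lie_algebra[OF \<Gamma>(1)] by blast
qed

end

section \<open>Reduction\<close>

lemma manifold_locally_compact:
  assumes M: "smooth_manifold M"
  shows "locally_compact_space (mtop M)"
  unfolding locally_compact_space_def
proof
  note M' = smooth_manifold_charted[OF M]
  fix x assume "x \<in> mspace M"
  then obtain V \<psi> where V: "(V, \<psi>) \<in> charts M" "x \<in> V" using chart_exists[OF M'] by blast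
  obtain r where r: "r > 0" "cube (mdim M) (\<psi> x) r \<subseteq> \<psi> ` V"
    using opn_cube[OF chart_image_open[OF M' V(1)]] V(2) by blast
  let ?U = "V \<inter> \<psi> -` cube (mdim M) (\<psi> x) (r / 2)"
  let ?K0 = "{z \<in> Rn (mdim M). \<forall>j<mdim M. \<bar>z j - \<psi> x j\<bar> \<le> r / 2}"
  have "openin (mtop M) ?U" by (rule openin_sub_preimage[OF chart_open[OF M' V(1)] chart_cont[OF M' V(1)] openin_cube])
  moreover have "compactin (mtop M) (inv_into V \<psi> ` ?K0)"
  proof (rule image_compactin[OF _ chart_inv_cont[OF M' V(1)]])
    have "?K0 \<subseteq> \<psi> ` V" using r by (force simp: cube_def)
    then show "compactin (subtopology (Euclidean_space (mdim M)) (\<psi> ` V)) ?K0"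
      unfolding compactin_subtopology by (intro conjI compactin_closed_cube)
  qed
  moreover have "x \<in> ?U" using V(2) chart_Rn[OF M' V] r(1) by (simp add: cube_self)
  moreover have "?U \<subseteq> inv_into V \<psi> ` ?K0"
  proof
    fix y assume y: "y \<in> ?U"
    then have "\<psi> y \<in> ?K0" by (auto simp: cube_def less_imp_le)
    moreover have "y = inv_into V \<psi> (\<psi> y)" using y chart_inv[OF M' V(1)] by simp
    ultimately show "y \<in> inv_into V \<psi> ` ?K0" by blast
  qed
  ultimately show "\<exists>U K. openin (mtop M) U \<and> compactin (mtop M) K \<and> x \<in> U \<and> U \<subseteq> K" by blast
qed

text \<open>The compact ones among the closures of the members of a countable base suffice: by local
  compactness every neighbourhood contains a compact closed one, and a base member inside it has a
  compact closure there.\<close>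

lemma countable_compact_network:
  assumes M: "smooth_manifold M"
  obtains \<K> where "countable \<K>" "\<And>K. K \<in> \<K> \<Longrightarrow> compactin (mtop M) K"
    "\<And>N p. openin (mtop M) N \<Longrightarrow> p \<in> N \<Longrightarrow> \<exists>K\<in>\<K>. p \<in> K \<and> K \<subseteq> N"
proof -
  have H: "Hausdorff_space (mtop M)" using M by (simp add: smooth_manifold_def)
  have "second_countable (mtop M)" using M by (simp add: smooth_manifold_def)
  then obtain \<B> where \<B>: "countable \<B>" "\<forall>V\<in>\<B>. openin (mtop M) V"
    "\<forall>U x. openin (mtop M) U \<and> x \<in> U \<longrightarrow> (\<exists>V\<in>\<B>. x \<in> V \<and> V \<subseteq> U)"
    unfolding second_countable_def by blast
  have nb: "neighbourhood_base_of (\<lambda>C. compactin (mtop M) C \<and> closedin (mtop M) C) (mtop M)"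
    using locally_compact_space_neighbourhood_base_closedin H manifold_locally_compact[OF M] by blast
  define \<K> where "\<K> = {K \<in> (closure_of) (mtop M) ` \<B>. compactin (mtop M) K}"
  show thesis
  proof
    show "countable \<K>" using \<B>(1) by (simp add: \<K>_def)
    show "compactin (mtop M) K" if "K \<in> \<K>" for K using that by (simp add: \<K>_def)
    fix N p assume "openin (mtop M) N" "p \<in> N"
    with nb[unfolded neighbourhood_base_of, rule_format, of N p] obtain U C where U: "openin (mtop M) U" "compactin (mtop M) C" "closedin (mtop M) C" "p \<in> U" "U \<subseteq> C" "C \<subseteq> N"
      by blast
    then obtain B where B: "B \<in> \<B>" "p \<in> B" "B \<subseteq> U" using \<B>(3) by blast
    have sub: "mtop M closure_of B \<subseteq> C" using B U by (intro closure_of_minimal) auto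
    have "compactin (mtop M) (mtop M closure_of B)"
      by (rule closed_compactin[OF U(2) sub]) simp
    moreover have "p \<in> mtop M closure_of B"
      using B U openin_subset[OF U(1)] closure_of_subset[of B "mtop M"] by blast
    ultimately show "\<exists>K\<in>\<K>. p \<in> K \<and> K \<subseteq> N" using sub U(6) B(1) by (auto simp: \<K>_def)
  qed
qed

text \<open>For a countable family of compact sets \<open>K \<subseteq> G\<close> as above, the sets \<open>{u. P u \<in> K \<cdot> Q u}\<close> are closed, so by
  Baire's theorem some \<open>u\<close> lies outside all their frontiers.  At such a point any \<open>g\<close> with \<open>P u = g \<cdot> Q u\<close> is
  a limit of elements relating \<open>P\<close> and \<open>Q\<close> at nearby points.\<close>

lemma generic_point:
  assumes M: "smooth_manifold M" and X: "smooth_manifold X"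
    and act: "smooth_map (prod_manifold M X) X (\<lambda>(g, x). act g x)"
    and P: "plot X m U P" and Q: "plot X m U Q" and W: "opn m W" "W \<noteq> {}" "W \<subseteq> U"
  shows "\<exists>u\<in>W. \<forall>g N. act g (Q u) = P u \<and> openin (mtop M) N \<and> g \<in> N \<longrightarrow>
      (\<exists>W'. opn m W' \<and> u \<in> W' \<and> (\<forall>w\<in>W'. \<exists>g'\<in>N. act g' (Q w) = P w))"
proof -
  obtain \<K> where \<K>: "countable \<K>" "\<And>K. K \<in> \<K> \<Longrightarrow> compactin (mtop M) K"
    "\<And>N p. openin (mtop M) N \<Longrightarrow> p \<in> N \<Longrightarrow> \<exists>K\<in>\<K>. p \<in> K \<and> K \<subseteq> N"
    by (rule countable_compact_network[OF M]) blast
  have U: "opn m U" by (rule plot_opn[OF P])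
  define T where "T = subtopology (Euclidean_space m) U"
  have tT: "topspace T = U" unfolding T_def by (rule topspace_sub[OF opn_subset[OF U]])
  have HX: "Hausdorff_space (mtop X)" using X by (simp add: smooth_manifold_def)
  have ac: "continuous_map (prod_topology (mtop M) (mtop X)) (mtop X) (\<lambda>(g, x). act g x)"
    using act by (simp add: smooth_map_def prod_manifold_def)
  define S where "S K = {u \<in> U. \<exists>g\<in>K. act g (Q u) = P u}" for K
  have S: "closedin T (S K)" if "compactin (mtop M) K" for K
  proof -
    let ?Z = "prod_topology T (subtopology (mtop M) K)"
    have KM: "K \<subseteq> mspace M" using that compactin_subset_topspace by blast
    have Pc: "continuous_map ?Z (mtop X) (\<lambda>z. P (fst z))"
      using continuous_map_compose[OF continuous_map_fst plot_cont[OF P]] by (simp add: T_def o_def)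
    have Qc: "continuous_map ?Z (mtop X) (\<lambda>z. Q (fst z))"
      using continuous_map_compose[OF continuous_map_fst plot_cont[OF Q]] by (simp add: T_def o_def)
    have gc: "continuous_map ?Z (mtop M) snd"
      using continuous_map_snd[of T "subtopology (mtop M) K"] by (simp add: continuous_map_in_subtopology)
    have Ac: "continuous_map ?Z (mtop X) (\<lambda>z. act (snd z) (Q (fst z)))"
      using continuous_map_compose[OF continuous_map_pairedI[OF gc Qc] ac] by (simp add: o_def)
    have cl: "closedin ?Z {z \<in> topspace ?Z. act (snd z) (Q (fst z)) = P (fst z)}"
      by (rule closedin_continuous_maps_eq[OF HX Ac Pc])
    have "compact_space (subtopology (mtop M) K)" using that by (rule compact_space_subtopology)
    \<comment> \<open>Compactness of \<open>K\<close> makes the projection along it a closed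
      map.\<close>
    then have "closed_map ?Z T fst" by (rule Abstract_Topological_Spaces.closed_map_fst)
    then have "closedin T (fst ` {z \<in> topspace ?Z. act (snd z) (Q (fst z)) = P (fst z)})"
      using cl by (simp add: closed_map_def)
    moreover have "fst ` {z \<in> topspace ?Z. act (snd z) (Q (fst z)) = P (fst z)} = S K"
      using KM by (force simp: S_def tT)
    ultimately show ?thesis by simp
  qed
  \<comment> \<open>As \<open>S K\<close> is closed, this is its frontier, a closed set without
    interior.\<close>
  define F where "F K = S K - T interior_of (S K)" for K
  have "T interior_of \<Union>(F ` \<K>) = {}"
  proof (rule Baire_category_alt)
    have "locally_compact_space T"
      unfolding T_def
      by (rule locally_compact_space_open_subset[OF _ locally_compact_Euclidean_space U])
         (simp add: metrizable_imp_regular_space metrizable_Euclidean_space)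
    moreover have "regular_space T" unfolding T_def
      by (intro regular_space_subtopology metrizable_imp_regular_space metrizable_Euclidean_space)
    ultimately show "completely_metrizable_space T \<or> locally_compact_space T \<and> regular_space T" by blast
    show "countable (F ` \<K>)" using \<K>(1) by simp
    fix C assume "C \<in> F ` \<K>"
    then obtain K where K: "K \<in> \<K>" "C = F K" by blast
    have "closedin T C"
      unfolding K(2) F_def by (intro closedin_diff S \<K>(2) K(1)) simp
    moreover have "T interior_of C = {}"
    proof -
      have "T interior_of C \<subseteq> T interior_of (S K)"
        by (rule interior_of_mono) (auto simp: K(2) F_def)
      moreover have "T interior_of C \<subseteq> C" by (rule interior_of_subset)
      ultimately show ?thesis by (auto simp: K(2) F_def)
    qed
    ultimately show "closedin T C \<and> T interior_of C = {}" by blast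
  qed
  moreover have WT: "openin T W" unfolding T_def openin_open_subtopology[OF U] using W by blast
  ultimately have "\<not> W \<subseteq> \<Union>(F ` \<K>)" using interior_of_maximal[of W _ T] W(2) by blast
  then obtain u where u: "u \<in> W" "\<And>K. K \<in> \<K> \<Longrightarrow> u \<notin> F K" by blast
  show ?thesis
  proof (intro bexI[OF _ u(1)] allI impI)
    fix g N assume "act g (Q u) = P u \<and> openin (mtop M) N \<and> g \<in> N"
    then have g: "act g (Q u) = P u" and N: "openin (mtop M) N" "g \<in> N" by auto
    obtain K where K: "K \<in> \<K>" "g \<in> K" "K \<subseteq> N" using \<K>(3)[OF N] by blast
    have "u \<in> S K" using g K(2) u(1) W(3) by (auto simp: S_def)
    \<comment> \<open>Off the frontier of \<open>S K\<close>, a relation at \<open>u\<close> by an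
      element of \<open>K\<close> propagates to a neighbourhood of \<open>u\<close>.\<close>
    then have ui: "u \<in> T interior_of (S K)" using u(2)[OF K(1)] by (simp add: F_def)
    have "openin T (T interior_of (S K))" by simp
    then have o: "opn m (T interior_of (S K))" unfolding T_def openin_open_subtopology[OF U] by blast
    have "\<exists>g'\<in>N. act g' (Q w) = P w" if "w \<in> T interior_of (S K)" for w
      using that interior_of_subset[of T "S K"] K(3) by (auto simp: S_def)
    then show "\<exists>W'. opn m W' \<and> u \<in> W' \<and> (\<forall>w\<in>W'. \<exists>g'\<in>N. act g' (Q w) = P w)" using o ui by blast
  qed
qed

lemma tangent_map_in:
  assumes M: "smooth_manifold M" and N: "smooth_manifold N" and f: "smooth_map M N f" and D: "D \<in> tangent_space M p"
  shows "tangent_map N f D \<in> tangent_space N (f p)"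
proof -
  note c = smooth_fun_compose[OF M smooth_manifold_charted[OF N] f]
  have lin: "D (\<lambda>x. a * h x + b * k x) = a * D h + b * D k" if "h \<in> smooth_fun M" "k \<in> smooth_fun M" for a b h k
    using D that by (simp add: tangent_space_def)
  have lei: "D (\<lambda>x. h x * k x) = h p * D k + k p * D h" if "h \<in> smooth_fun M" "k \<in> smooth_fun M" for h k
    using D that by (simp add: tangent_space_def)
  show ?thesis
    unfolding tangent_space_def tangent_map_def mem_Collect_eq
    using lin[OF c c] lei[OF c c] smooth_fun_lin[OF N] smooth_fun_mult[OF N] by simp
qed

section \<open>Plots with the same orbits at generic points\<close>

context
  fixes G :: "'g lie_struct" and X :: "'x manifold" and act
  assumes G: "lie_group G" and X: "smooth_manifold X" and sact: "smooth_action G X act"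
begin

lemma Ggrp: "group G" and Gmfd: "smooth_manifold (mfd G)" and Gspace: "mspace (mfd G) = carrier G"
  and Gmult: "smooth_map (prod_manifold (mfd G) (mfd G)) (mfd G) (\<lambda>(g, h). g \<otimes>\<^bsub>G\<^esub> h)"
  using G by (simp_all add: lie_group_def)

lemma Xga: "group_action G (mspace X) act"
  and Xact: "smooth_map (prod_manifold (mfd G) X) X (\<lambda>(g, y). act g y)"
  using sact by (simp_all add: smooth_action_def)

lemma smooth_translation: "g \<in> carrier G \<Longrightarrow> smooth_map X X (act g)"
proof (rule smooth_map_of_plots)
  note X' = smooth_manifold_charted[OF X] and G' = smooth_manifold_charted[OF Gmfd]
  fix V \<psi> assume g: "g \<in> carrier G" and V: "(V, \<psi>) \<in> charts X"
  show "plot X (mdim X) (\<psi> ` V) (\<lambda>y. act g (inv_into V \<psi> y))"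
    by (rule plot_smooth_map2[OF G' X' X' Xact plot_const[OF G' _ chart_image_open[OF X' V]] plot_chart_inv[OF X V]])
       (use g Gspace in simp)
qed (rule smooth_manifold_charted[OF X])+

text \<open>Equivariance evaluates the moment map at \<open>Ad\<close>-translates, and the zero
  level speaks of elements of the Lie algebra only.\<close>

lemma Ad_in: "g \<in> carrier G \<Longrightarrow> Z \<in> lie_algebra G \<Longrightarrow> Ad G g Z \<in> lie_algebra G"
proof -
  assume g: "g \<in> carrier G" and Z: "Z \<in> lie_algebra G"
  interpret group G by (rule Ggrp)
  note G' = smooth_manifold_charted[OF Gmfd]
  have "smooth_map (mfd G) (mfd G) (\<lambda>h. g \<otimes>\<^bsub>G\<^esub> h \<otimes>\<^bsub>G\<^esub> inv\<^bsub>G\<^esub> g)"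
  proof (rule smooth_map_of_plots[OF G' G'])
    fix V \<psi> assume V: "(V, \<psi>) \<in> charts (mfd G)"
    note c = plot_const[OF G' _ chart_image_open[OF G' V]]
    show "plot (mfd G) (mdim (mfd G)) (\<psi> ` V) (\<lambda>y. g \<otimes>\<^bsub>G\<^esub> inv_into V \<psi> y \<otimes>\<^bsub>G\<^esub> inv\<^bsub>G\<^esub> g)"
      by (rule plot_smooth_map2[OF G' G' G' Gmult plot_smooth_map2[OF G' G' G' Gmult c plot_chart_inv[OF Gmfd V]] c])
         (use g Gspace in auto)
  qed
  from tangent_map_in[OF Gmfd Gmfd this, of Z "\<one>\<^bsub>G\<^esub>"] Z g
  show ?thesis by (simp add: Ad_def lie_algebra_def)
qed

lemma generic_tangent:
  assumes P: "plot X m U P" and Q: "plot X m U Q" and orb: "\<And>u. u \<in> U \<Longrightarrow> orbit G act (P u) = orbit G act (Q u)"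
    and W: "opn m W" "W \<noteq> {}" "W \<subseteq> U"
  shows "\<exists>u\<in>W. \<exists>g\<in>carrier G. act g (Q u) = P u \<and> plot X m U (\<lambda>w. act g (Q w)) \<and> (\<forall>v.
    \<exists>Z\<in>lie_algebra G. inf_action G X act Z (P u) \<in> tangent_space X (P u) \<and>
    plot_tangent m X P u v =
      (\<lambda>f. 1 * plot_tangent m X (\<lambda>w. act g (Q w)) u v f + 1 * inf_action G X act Z (P u) f))"
proof -
  interpret group G by (rule Ggrp)
  note X' = smooth_manifold_charted[OF X] and G' = smooth_manifold_charted[OF Gmfd]
  obtain u where u: "u \<in> W" and near: "\<And>g N. act g (Q u) = P u \<Longrightarrow> openin (mtop (mfd G)) N \<Longrightarrow> g \<in> N \<Longrightarrow>
      \<exists>W'. opn m W' \<and> u \<in> W' \<and> (\<forall>w\<in>W'. \<exists>g'\<in>N. act g' (Q w) = P w)"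
    using generic_point[OF Gmfd X Xact P Q W] by blast
  have uU: "u \<in> U" using u W by blast
  have "P u \<in> orbit G act (Q u)"
    using group_action.orbit_refl[OF Xga plot_in[OF P uU]] orb[OF uU] by simp
  \<comment> \<open>Any such \<open>g\<close> will do: the conclusion of
    \<open>generic_point\<close> at \<open>u\<close> covers all of them.\<close>
  then obtain g where g: "g \<in> carrier G" "act g (Q u) = P u" by (auto simp: orbit_def)
  define R where "R w = act g (Q w)" for w
  have R: "plot X m U R"
    unfolding R_def by (rule smooth_map_plot[OF X' X' smooth_translation[OF g(1)] Q])
  obtain V \<phi> where V: "(V, \<phi>) \<in> charts (mfd G)" "\<one>\<^bsub>G\<^esub> \<in> V"
    using chart_exists[OF G', of "\<one>\<^bsub>G\<^esub>"] Gspace by auto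
  obtain A \<psi> where A: "(A, \<psi>) \<in> charts X" "P u \<in> A" using chart_exists[OF X' plot_in[OF P uU]] by blast
  interpret ac: action_chart G V \<phi> X act A \<psi> "P u"
    by unfold_locales (use G X sact V A in auto)
  have nR: "\<exists>W. opn m W \<and> u \<in> W \<and> (\<forall>w\<in>W. \<exists>h\<in>N. P w = act h (R w))"
    if N: "openin (mtop (mfd G)) N" "\<one>\<^bsub>G\<^esub> \<in> N" for N
  proof -
    \<comment> \<open>The translate \<open>N g\<close>: if \<open>h\<close> in it carries
      \<open>Q w\<close> to \<open>P w\<close>, then \<open>h\<close> times the inverse of
      \<open>g\<close> lies in \<open>N\<close> and carries \<open>R w\<close> to
      \<open>P w\<close>.\<close>
    let ?N = "{h \<in> mspace (mfd G). h \<otimes>\<^bsub>G\<^esub> inv\<^bsub>G\<^esub> g \<in> N}"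
    have mc: "continuous_map (prod_topology (mtop (mfd G)) (mtop (mfd G))) (mtop (mfd G)) (\<lambda>(h, k). h \<otimes>\<^bsub>G\<^esub> k)"
      using Gmult by (simp add: smooth_map_def prod_manifold_def)
    have "continuous_map (mtop (mfd G)) (prod_topology (mtop (mfd G)) (mtop (mfd G))) (\<lambda>h. (h, inv\<^bsub>G\<^esub> g))"
      using g(1) Gspace by (intro continuous_map_pairedI) auto
    from continuous_map_compose[OF this mc]
    have "continuous_map (mtop (mfd G)) (mtop (mfd G)) (\<lambda>h. h \<otimes>\<^bsub>G\<^esub> inv\<^bsub>G\<^esub> g)" by (simp add: o_def)
    then have No: "openin (mtop (mfd G)) ?N" using N(1) by (rule openin_continuous_map_preimage)
    have "g \<in> ?N" using g(1) N(2) Gspace by simp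
    from near[OF g(2) No this] obtain W0 where "opn m W0 \<and> u \<in> W0 \<and> (\<forall>w\<in>W0. \<exists>h\<in>?N. act h (Q w) = P w)" ..
    then have W0: "opn m W0" "u \<in> W0" "\<And>w. w \<in> W0 \<Longrightarrow> \<exists>h\<in>?N. act h (Q w) = P w" by auto
    have "\<exists>h\<in>N. P w = act h (R w)" if w: "w \<in> W0 \<inter> U" for w
    proof -
      obtain h where h: "h \<in> carrier G" "h \<otimes>\<^bsub>G\<^esub> inv\<^bsub>G\<^esub> g \<in> N" "act h (Q w) = P w" using W0(3) w Gspace by auto
      have Qw: "Q w \<in> mspace X" using plot_in[OF Q] w by blast
      have "act (h \<otimes>\<^bsub>G\<^esub> inv\<^bsub>G\<^esub> g) (R w) = act ((h \<otimes>\<^bsub>G\<^esub> inv\<^bsub>G\<^esub> g) \<otimes>\<^bsub>G\<^esub> g) (Q w)"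
        unfolding R_def using h(1) g(1) by (simp add: ac.act_mult[OF Qw])
      also have "(h \<otimes>\<^bsub>G\<^esub> inv\<^bsub>G\<^esub> g) \<otimes>\<^bsub>G\<^esub> g = h" using h(1) g(1) by (simp add: m_assoc)
      finally show ?thesis using h by metis
    qed
    then show ?thesis using W0 uU plot_opn[OF P] openin_Int[of "Euclidean_space m" W0 U]
      by (intro exI[of _ "W0 \<inter> U"]) auto
  qed
  have "R u = P u" by (simp add: R_def g(2))
  from ac.tangent_difference[OF P R uU refl this nR]
  show ?thesis using u g R unfolding R_def by blast
qed

lemma invariant_pullback:
  assumes inv: "invariant_form k G X act \<omega>" and g: "g \<in> carrier G" and Q: "plot X m U Q" and u: "u \<in> U"
    and vs: "length vs = k"
  shows "mform_pullback m X (\<lambda>w. act g (Q w)) \<omega> u vs = mform_pullback m X Q \<omega> u vs"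
proof -
  have "tangent_map X (act g) \<circ> plot_tangent m X Q u = plot_tangent m X (\<lambda>w. act g (Q w)) u"
    using tangent_map_plot[OF X smooth_manifold_charted[OF X] smooth_translation[OF g]] by (simp add: fun_eq_iff)
  moreover have "\<omega> (act g (Q u)) (map (tangent_map X (act g)) (map (plot_tangent m X Q u) vs))
      = \<omega> (Q u) (map (plot_tangent m X Q u) vs)"
  proof -
    have "length (map (plot_tangent m X Q u) vs) = k \<and> set (map (plot_tangent m X Q u) vs) \<subseteq> tangent_space X (Q u)"
      using vs plot_tangent_in[OF X Q u] by auto
    then show ?thesis using inv g plot_in[OF Q u] unfolding invariant_form_def by blast
  qed
  ultimately show ?thesis by (simp add: mform_pullback_def)
qed

text \<open>Descent and density combined: the two pullbacks have to be compared at one point of each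
  nonempty open subset only.\<close>

lemma carries_reduced_formI:
  assumes \<omega>: "differential_form k X \<omega>"
    and eq: "\<And>m U P Q W vs. plot X m U P \<Longrightarrow> plot X m U Q \<Longrightarrow> P ` U \<subseteq> zero_level G X \<Phi> \<Longrightarrow> Q ` U \<subseteq> zero_level G X \<Phi> \<Longrightarrow>
      (\<And>u. u \<in> U \<Longrightarrow> orbit G act (P u) = orbit G act (Q u)) \<Longrightarrow> opn m W \<Longrightarrow> W \<noteq> {} \<Longrightarrow> W \<subseteq> U \<Longrightarrow>
      length vs = k \<Longrightarrow> \<exists>u\<in>W. mform_pullback m X P \<omega> u vs = mform_pullback m X Q \<omega> u vs"
  shows "carries_reduced_form k G X act \<Phi> \<omega>"
  unfolding carries_reduced_form_def reduced_diffeology_def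
proof (rule form_descends[OF X \<omega> zero_level_diffeology_def])
  fix n U P Q u and vs :: "rvec list"
  assume P: "zero_level_diffeology G X \<Phi> n U P" and Q: "zero_level_diffeology G X \<Phi> n U Q"
    and orb: "\<And>v. v \<in> U \<Longrightarrow> orbit G act (P v) = orbit G act (Q v)" and u: "u \<in> U"
    and vs: "length vs = k" "set vs \<subseteq> Rn n"
  have pP: "plot X n U P" "P ` U \<subseteq> zero_level G X \<Phi>" and pQ: "plot X n U Q" "Q ` U \<subseteq> zero_level G X \<Phi>"
    using P Q by (simp_all add: zero_level_diffeology_def subset_diffeology_def)
  show "mform_pullback n X P \<omega> u vs = mform_pullback n X Q \<omega> u vs"
    by (rule mform_pullback_eq_dense[OF X \<omega> pP(1) pQ(1) eq[OF pP(1) pQ(1) pP(2) pQ(2) orb _ _ _ vs(1)] vs u])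
qed

end

section \<open>The two reduction theorems\<close>

lemma alternating_form2_swap:
  assumes "alternating_form 2 V \<alpha>" "v \<in> V" "w \<in> V" "(\<lambda>j. 1 * v j + 1 * w j) \<in> V"
  shows "\<alpha> [v, w] = - \<alpha> [w, v]"
proof -
  let ?s = "\<lambda>j. 1 * v j + 1 * w j"
  have rep: "\<alpha> [a, a] = 0" if "a \<in> V" for a
  proof -
    have "length [a, a] = 2 \<and> set [a, a] \<subseteq> V \<and> (0::nat) < 1 \<and> (1::nat) < 2 \<and> [a, a] ! 0 = [a, a] ! 1" using that by simp
    then show ?thesis using assms(1) unfolding alternating_form_def by blast
  qed
  have 1: "\<alpha> [?s, b] = \<alpha> [v, b] + \<alpha> [w, b]" if "b \<in> V" for b
    using alternating_form_slot[OF assms(1), of "[]" "[b]" v w 1 1] assms that by simp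
  have 2: "\<alpha> [b, ?s] = \<alpha> [b, v] + \<alpha> [b, w]" if "b \<in> V" for b
    using alternating_form_slot[OF assms(1), of "[b]" "[]" v w 1 1] assms that by simp
  \<comment> \<open>Alternation is given as vanishing on equal arguments; expanding it on
    \<open>v + w\<close> yields the sign.\<close>
  show ?thesis using rep[OF assms(4)] 1[OF assms(4)] 2[OF assms(2)] 2[OF assms(3)] rep[OF assms(2)] rep[OF assms(3)] by simp
qed

text \<open>Applied to the components of the moment map, which vanish along plots of the zero
  level.\<close>

lemma plot_tangent_vanishing:
  assumes "opn m U" "u \<in> U" "\<And>w. w \<in> U \<Longrightarrow> f (P w) = 0"
  shows "plot_tangent m X P u v f = 0"
proof -
  have "dir_deriv m (\<lambda>y. f (P y)) u v = dir_deriv m (\<lambda>_. 0) u v"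
    by (rule dir_deriv_cong[OF assms(1,2)]) (rule assms(3))
  also have "\<dots> = 0" by (simp add: dir_deriv_def pd_def)
  finally show ?thesis by (simp add: plot_tangent_def)
qed

lemma tangent_space_add:
  assumes M: "smooth_manifold M" and "D \<in> tangent_space M p" "E \<in> tangent_space M p"
  shows "(\<lambda>f. 1 * D f + 1 * E f) \<in> tangent_space M p"
  using assms smooth_fun_lin[OF M] smooth_fun_mult[OF M]
  unfolding tangent_space_def by (simp add: algebra_simps)

theorem prequantum_reduction:
  assumes G: "lie_group G" and pq: "prequantum_space G X act \<eta>"
  shows "carries_reduced_form 1 G X act (prequantum_moment G X act \<eta>) \<eta>"
proof -
  have X: "smooth_manifold X" and sact: "smooth_action G X act" and \<eta>: "differential_form 1 X \<eta>"
    and inv: "invariant_form 1 G X act \<eta>"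
    using pq by (auto simp: prequantum_space_def contact_form_def)
  show ?thesis
  proof (rule carries_reduced_formI[OF G X sact \<eta>])
    fix m U P Q W and vs :: "rvec list"
    assume P: "plot X m U P" and Q: "plot X m U Q" and zP: "P ` U \<subseteq> zero_level G X (prequantum_moment G X act \<eta>)"
      and orb: "\<And>u. u \<in> U \<Longrightarrow> orbit G act (P u) = orbit G act (Q u)"
      and W: "opn m W" "W \<noteq> {}" "W \<subseteq> U" and vs: "length vs = 1"
    obtain v where v: "vs = [v]" using vs by (cases vs) auto
    obtain u g where u: "u \<in> W" and g: "g \<in> carrier G" "act g (Q u) = P u" and R: "plot X m U (\<lambda>w. act g (Q w))"
      and Z: "\<And>v. \<exists>Z\<in>lie_algebra G. inf_action G X act Z (P u) \<in> tangent_space X (P u) \<and> plot_tangent m X P u v =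
         (\<lambda>f. 1 * plot_tangent m X (\<lambda>w. act g (Q w)) u v f + 1 * inf_action G X act Z (P u) f)"
      using generic_tangent[OF G X sact P Q orb W] by blast
    have uU: "u \<in> U" using u W by blast
    obtain Z where Z: "Z \<in> lie_algebra G" "inf_action G X act Z (P u) \<in> tangent_space X (P u)" "plot_tangent m X P u v =
         (\<lambda>f. 1 * plot_tangent m X (\<lambda>w. act g (Q w)) u v f + 1 * inf_action G X act Z (P u) f)" using Z by blast
    have alt: "alternating_form 1 (tangent_space X (P u)) (\<eta> (P u))"
      using \<eta> plot_in[OF P uU] by (simp add: differential_form_def)
    have Rt: "plot_tangent m X (\<lambda>w. act g (Q w)) u v \<in> tangent_space X (P u)"
      using plot_tangent_in[OF X R uU, of v] g(2) by simp
    \<comment> \<open>On the zero level the generators of the action lie in the kernel of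
      \<open>\<eta>\<close>, by the definition of the moment map.\<close>
    have "\<eta> (P u) [inf_action G X act Z (P u)] = 0"
      using zP uU Z(1) by (auto simp: zero_level_def prequantum_moment_def)
    then have "mform_pullback m X P \<eta> u vs = mform_pullback m X (\<lambda>w. act g (Q w)) \<eta> u vs"
      using alternating_form_slot[OF alt, of "[]" "[]" _ _ 1 1] Rt Z(2) by (simp add: mform_pullback_def v Z(3) g(2))
    also have "\<dots> = mform_pullback m X Q \<eta> u vs" by (rule invariant_pullback[OF G X sact inv g(1) Q uU vs])
    finally show "\<exists>u\<in>W. mform_pullback m X P \<eta> u vs = mform_pullback m X Q \<eta> u vs" using u by blast
  qed
qed

theorem hamiltonian_reduction:
  assumes G: "lie_group G" and ham: "hamiltonian_space G X act \<omega> \<Phi>"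
  shows "carries_reduced_form 2 G X act \<Phi> \<omega>"
proof -
  have X: "smooth_manifold X" and sact: "smooth_action G X act" and \<omega>: "differential_form 2 X \<omega>"
    and inv: "invariant_form 2 G X act \<omega>"
    and equi: "\<And>g x Z. g \<in> carrier G \<Longrightarrow> x \<in> mspace X \<Longrightarrow> Z \<in> lie_algebra G \<Longrightarrow> \<Phi> (act g x) Z = coAd G g (\<Phi> x) Z"
    and mom: "\<And>Z x w. Z \<in> lie_algebra G \<Longrightarrow> x \<in> mspace X \<Longrightarrow> w \<in> tangent_space X x \<Longrightarrow>
       \<omega> x [inf_action G X act Z x, w] = - w (\<lambda>y. \<Phi> y Z)"
    using ham by (auto simp: hamiltonian_space_def symplectic_form_def)
  interpret group G using G by (simp add: lie_group_def)
  show ?thesis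
  proof (rule carries_reduced_formI[OF G X sact \<omega>])
    fix m U P Q W and vs :: "rvec list"
    assume P: "plot X m U P" and Q: "plot X m U Q" and zP: "P ` U \<subseteq> zero_level G X \<Phi>" and zQ: "Q ` U \<subseteq> zero_level G X \<Phi>"
      and orb: "\<And>u. u \<in> U \<Longrightarrow> orbit G act (P u) = orbit G act (Q u)"
      and W: "opn m W" "W \<noteq> {}" "W \<subseteq> U" and vs: "length vs = 2"
    obtain v w where v: "vs = [v, w]" using vs by (auto simp: numeral_2_eq_2 length_Suc_conv)
    obtain u g where u: "u \<in> W" and g: "g \<in> carrier G" "act g (Q u) = P u" and R: "plot X m U (\<lambda>w. act g (Q w))"
      and Z: "\<And>v. \<exists>Z\<in>lie_algebra G. inf_action G X act Z (P u) \<in> tangent_space X (P u) \<and> plot_tangent m X P u v =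
         (\<lambda>f. 1 * plot_tangent m X (\<lambda>w. act g (Q w)) u v f + 1 * inf_action G X act Z (P u) f)"
      using generic_tangent[OF G X sact P Q orb W] by blast
    have uU: "u \<in> U" using u W by blast
    let ?x = "P u" and ?R = "\<lambda>w. act g (Q w)"
    let ?Y = "\<lambda>Z. inf_action G X act Z ?x"
    have x: "?x \<in> mspace X" by (rule plot_in[OF P uU])
    obtain Zv where Zv: "Zv \<in> lie_algebra G" "?Y Zv \<in> tangent_space X ?x"
      "plot_tangent m X P u v = (\<lambda>f. 1 * plot_tangent m X ?R u v f + 1 * ?Y Zv f)" using Z by blast
    obtain Zw where Zw: "Zw \<in> lie_algebra G" "?Y Zw \<in> tangent_space X ?x"
      "plot_tangent m X P u w = (\<lambda>f. 1 * plot_tangent m X ?R u w f + 1 * ?Y Zw f)" using Z by blast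
    have alt: "alternating_form 2 (tangent_space X ?x) (\<omega> ?x)"
      using \<omega> x by (simp add: differential_form_def)
    have Rt: "plot_tangent m X ?R u b \<in> tangent_space X ?x" for b
      using plot_tangent_in[OF X R uU, of b] g(2) by simp
    have Pt: "plot_tangent m X P u b \<in> tangent_space X ?x" for b by (rule plot_tangent_in[OF X P uU])
    \<comment> \<open>By equivariance the translate of a plot of the zero level stays in the zero
      level, so its tangent vectors too are orthogonal to the orbit with respect to
      \<open>\<omega>\<close>.\<close>
    have RZ: "\<Phi> (?R y) Z = 0" if "y \<in> U" "Z \<in> lie_algebra G" for y Z
    proof -
      have "Ad G (inv\<^bsub>G\<^esub> g) Z \<in> lie_algebra G" by (rule Ad_in[OF G X sact _ that(2)]) (use g in simp)
      then show ?thesis using equi[OF g(1) plot_in[OF Q that(1)] that(2)] zQ that(1)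
        by (auto simp: coAd_def zero_level_def)
    qed
    have YP: "\<omega> ?x [?Y Z, plot_tangent m X P u b] = 0" if "Z \<in> lie_algebra G" for Z b
    proof -
      have "plot_tangent m X P u b (\<lambda>y. \<Phi> y Z) = 0"
        by (rule plot_tangent_vanishing[OF plot_opn[OF P] uU]) (use zP that in \<open>auto simp: zero_level_def\<close>)
      then show ?thesis using mom[OF that x Pt] by simp
    qed
    have YR: "\<omega> ?x [?Y Z, plot_tangent m X ?R u b] = 0" if "Z \<in> lie_algebra G" for Z b
      using mom[OF that x Rt] plot_tangent_vanishing[where f="\<lambda>y. \<Phi> y Z" and P="?R", OF plot_opn[OF P] uU] RZ that
      by simp
    \<comment> \<open>The first slot is expanded while the second still belongs to \<open>P\<close>,
      then the second while the first belongs to the translate. So each correction term pairs an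
      orbit direction with a tangent vector of a plot in the zero level.\<close>
    have "\<omega> ?x [plot_tangent m X P u v, plot_tangent m X P u w] =
        \<omega> ?x [plot_tangent m X ?R u v, plot_tangent m X P u w] + \<omega> ?x [?Y Zv, plot_tangent m X P u w]"
      unfolding Zv(3) using alternating_form_slot[OF alt, of "[]" "[plot_tangent m X P u w]" _ _ 1 1] Rt Zv(2) Pt by simp
    also have "\<omega> ?x [plot_tangent m X ?R u v, plot_tangent m X P u w] =
        \<omega> ?x [plot_tangent m X ?R u v, plot_tangent m X ?R u w] + \<omega> ?x [plot_tangent m X ?R u v, ?Y Zw]"
      unfolding Zw(3) using alternating_form_slot[OF alt, of "[plot_tangent m X ?R u v]" "[]" _ _ 1 1] Rt Zw(2) by simp
    also have "\<omega> ?x [plot_tangent m X ?R u v, ?Y Zw] = - \<omega> ?x [?Y Zw, plot_tangent m X ?R u v]"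
      by (rule alternating_form2_swap[OF alt Rt Zw(2) tangent_space_add[OF X Rt Zw(2)]])
    finally have "mform_pullback m X P \<omega> u vs = mform_pullback m X ?R \<omega> u vs"
      using YP[OF Zv(1)] YR[OF Zw(1)] by (simp add: mform_pullback_def v g(2))
    also have "\<dots> = mform_pullback m X Q \<omega> u vs" by (rule invariant_pullback[OF G X sact inv g(1) Q uU vs])
    finally show "\<exists>u\<in>W. mform_pullback m X P \<omega> u vs = mform_pullback m X Q \<omega> u vs" using u by blast
  qed
qed

theorem theorem8p1:
  fixes G :: "'g lie_struct"
  assumes "lie_group G"
  shows "(\<forall>(X :: 'x manifold) act \<omega> \<Phi>.
            hamiltonian_space G X act \<omega> \<Phi> \<and> proper_action G X act \<longrightarrow>
              carries_reduced_form 2 G X act \<Phi> \<omega>) \<and>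
         (\<forall>(X :: 'y manifold) act \<eta>.
            prequantum_space G X act \<eta> \<and> proper_action G X act \<longrightarrow>
              carries_reduced_form 1 G X act (prequantum_moment G X act \<eta>) \<eta>)"
  using hamiltonian_reduction[OF assms] prequantum_reduction[OF assms] by blast

end
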